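(* Let $\Omega\subset\mathbb{R}^d$ ($d\in\{2,3\}$) be a bounded Lipschitz domain with outward normal $\boldsymbol n$, let $\delta t>0$ and $T_{\min}>0$. Suppose smooth functions $\boldsymbol v^n,\psi^n,T^n$ (time level $n$) and $\boldsymbol v^{n+1},p^{n+1},\psi^{n+1},T^{n+1}$ (time level $n+1$) on $\overline\Omega$ satisfy the semi-discrete scheme \begin{align*} \rho^n\frac{\boldsymbol v^{n+1}-\boldsymbol v^n}{\delta t}+\rho^n(\boldsymbol v^n\cdot\nabla)\boldsymbol v^{n+1}&=\nabla\cdot\boldsymbol\Sigma^{n+1}-\frac{\rho^n}{\mathrm{Fr}}\boldsymbol e_d,\\ \nabla\cdot\boldsymbol v^n&=\frac{\alpha}{\mathrm{Pe}_\psi}\nabla\cdot(m_\psi^n\nabla\mu_c^{n+1}),\\ \psi_{\bar t}+\nabla\cdot(\psi^{n+1}\boldsymbol v^n)&=\frac1{\mathrm{Pe}_\psi}\nabla\cdot(m_\psi^n\nabla\mu_c^{n+1}),\\ (\rho C_h)^{n+1}T_{\bar t}+(\rho C_h)^{n+1}(\boldsymbol v^n\cdot\nabla T^n)&=-\nabla\cdot\boldsymbol q_E^{n+1}+hs, \end{align*} with boundary conditions $\boldsymbol v^n=0$, $\boldsymbol n\cdot\nabla\mu_c^{n+1}=0$, $\boldsymbol n\cdot\nabla\psi^{n+1}=0$, $\boldsymbol n\cdot\nabla T^n=\boldsymbol n\cdot\nabla T^{n+1}=0$ on $\partial\Omega$. Then $\int_\Omega\rho^{n+1}dx=\int_\Omega\rho^ndx$.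 If moreover $T^n\ge T_{\min}$, $T^{n+1}\ge T_{\min}$, $0\le\psi^n\le1$, $0\le\psi^{n+1}\le1$ and $\lambda_f(T^n)\ge0$ on $\Omega$, then, with $S^m=\int_\Omega\hat s^m\,dx$, $\hat s^m=\frac1{\mathrm{Ec}}\rho^mC_h^m\ln(T^m/T_0)+\frac1{\mathrm{We}}\lambda_s\delta^m$ ($m=n,n+1$), $$\frac{S^{n+1}-S^n}{\delta t}=\int_\Omega\Big\{\frac{k}{\mathrm{Ec}\,\mathrm{Pe}_T}\frac{|\nabla T^{n+1}+\nabla T^n|^2}{4(T^n)^2}+\frac1{\mathrm{Re}}\frac{\boldsymbol\tau^{n+1}:\nabla\boldsymbol v^{n+1}}{T^n}+\frac{m_\psi^n}{\mathrm{Pe}_\psi}\frac{|\nabla\mu_c^{n+1}|^2}{T^n}+res\Big\}dx\ \ge0,$$ where $$res=\frac{\lambda_f(T^n)}{\mathrm{We}\,\epsilon\,T^n\delta t}\Big[\tfrac18(\psi^{n+1}-\psi^n)^2+W'(\psi^{n+1})(\psi^{n+1}-\psi^n)-W(\psi^{n+1})+W(\psi^n)\Big]+\frac{(\rho C_h)^{n+1}}{\mathrm{Ec}\,T^n\delta t}\Big[\frac{T^n(T^{n+1}-T^n)^2}{2T_{\min}^2}-\big(T^{n+1}-T^n-T^n\ln(T^{n+1}/T^n)\big)\Big]$$ and $res\ge0$ pointwise.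
   Context: Constants: $\mathrm{Re},\mathrm{We},\mathrm{Ca},\mathrm{Ma},\mathrm{Fr},\mathrm{Pe}_\psi,\mathrm{Pe}_T,\mathrm{Ec}>0$, $\epsilon,\eta,T_0>0$, ratios $\zeta_\rho,\zeta_\mu,\zeta_{C_h},\zeta_k>0$, $\alpha=(\zeta_\rho-1)/\zeta_\rho$; $\boldsymbol e_d$ the vertical unit vector. For any quantity $X$, $X_{\bar t}=(X^{n+1}-X^n)/\delta t$. For $m\in\{n,n+1\}$ and $\Lambda\in\{\rho,\mu,C_h,k\}$: $\Lambda^m=\psi^m+\zeta_\Lambda(1-\psi^m)$, $(\rho C_h)^m=\rho^mC_h^m$; $m_\psi^n=|\psi^n(1-\psi^n)|$; $W(\psi)=\psi^2(1-\psi)^2/4$, $W'(\psi)=\psi(\psi-1)(\psi-\tfrac12)$; $\delta^m=W(\psi^m)/\epsilon+\epsilon|\nabla\psi^m|^2/2$. $\lambda_s=\eta\,\mathrm{Ca}\,\mathrm{Ma}$, $\lambda_u=\eta(1+\mathrm{Ca}\,\mathrm{Ma}\,T_0)$, $\lambda_f(T)=\eta(1-\mathrm{Ca}\,\mathrm{Ma}(T-T_0))$. Define $F_\psi=\frac1{\mathrm{Ec}}[(1-\zeta_\rho)C_h^{n+1}+(1-\zeta_{C_h})\rho^n]T^n(1-\ln(T^n/T_0))$, $U_\psi=\frac1{\mathrm{Ec}}[(1-\zeta_\rho)C_h^{n+1}+(1-\zeta_{C_h})\rho^n]T^n$, $\tilde S=\frac1{\mathrm{Ec}}\rho^{n+1}C_h^{n+1}\ln(T^n/T_0)$,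 $G=\frac1{\mathrm{Ec}}[(1-\zeta_\rho)C_h^{n+1}+(1-\zeta_{C_h})\rho^{n+1}]\ln(T^n/T_0)$, $\tilde U_\psi=F_\psi+T^nG$, $\tilde s=\tilde S+\frac1{\mathrm{We}}\lambda_s\delta^{n+1}$; $w^{n+1}=W'(\psi^{n+1})/\epsilon-\epsilon\Delta\psi^{n+1}$, $\mu_0^{n+1}=F_\psi+\frac1{\mathrm{We}}\lambda_f(T^n)w^{n+1}$, $\mu_c^{n+1}=\mu_0^{n+1}+\alpha p^{n+1}$; $\hat f^{n+1}=\frac1{\mathrm{Ec}}\rho^{n+1}C_h^{n+1}T^n(1-\ln(T^n/T_0))+\frac1{\mathrm{We}}\lambda_f(T^n)\delta^{n+1}$; $\mathbf M^{n+1}=-p^{n+1}\mathbf I-\frac1{\mathrm{We}}\lambda_f(T^n)\epsilon\nabla\psi^{n+1}\otimes\nabla\psi^{n+1}-\mu_0^{n+1}\psi^{n+1}\mathbf I$; $\boldsymbol\tau^{n+1}=\mu^n(\nabla\boldsymbol v^{n+1}+(\nabla\boldsymbol v^{n+1})^\top)-\frac23\mu^n(\nabla\cdot\boldsymbol v^{n+1})\mathbf I$; $\boldsymbol\Sigma^{n+1}=\mathbf M^{n+1}+\frac1{\mathrm{Re}}\boldsymbol\tau^{n+1}+\hat f^{n+1}\mathbf I$; $k$ denotes $k^{n+1}$; $\boldsymbol q_E^{n+1}=-\frac{k}{2\mathrm{Pe}_T}(\nabla T^{n+1}+\nabla T^n)-\frac{\mathrm{Ec}}{\mathrm{Pe}_\psi}m_\psi^n\mu_c^{n+1}\nabla\mu_c^{n+1}-\frac{\mathrm{Ec}}{\mathrm{We}}\lambda_u\epsilon\big(\nabla\psi^{n+1}\psi_{\bar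 t}+(\nabla\psi^{n+1}\otimes\nabla\psi^{n+1})\boldsymbol v^n\big)$; $corr=\frac{\mathrm{Ec}}{\mathrm{We}}\lambda_f(T^n)\frac{(\psi^{n+1}-\psi^n)^2}{8\delta t\epsilon}-\frac{\mathrm{Ec}}{\mathrm{We}}\lambda_f(T^n)\epsilon\frac{|\nabla\psi^{n+1}-\nabla\psi^n|^2}{2\delta t}+\frac{(\rho C_h)^{n+1}T^n(T^{n+1}-T^n)^2}{2T_{\min}^2\delta t}+\frac{k|\nabla T^{n+1}|^2-k|\nabla T^n|^2}{4\mathrm{Pe}_TT^n}$; $hs=-\mathrm{Ec}\,U_\psi\psi_{\bar t}-\mathrm{Ec}\,\tilde U_\psi(\boldsymbol v^n\cdot\nabla\psi^{n+1})+\mathrm{Ec}\,\mathbf M^{n+1}:\nabla\boldsymbol v^n+\frac{\mathrm{Ec}}{\mathrm{Re}}\boldsymbol\tau^{n+1}:\nabla\boldsymbol v^{n+1}-\mathrm{Ec}\,T^n\tilde s(\nabla\cdot\boldsymbol v^n)-\frac{\mathrm{Ec}}{\mathrm{We}}\lambda_u\delta_{\bar t}-\frac{\mathrm{Ec}}{\mathrm{We}}\lambda_u(\boldsymbol v^n\cdot\nabla\delta^{n+1})+corr$. Conventions: $(\nabla\cdot\boldsymbol\Sigma)_i=\sum_j\partial_j\Sigma_{ij}$, $A:B=\sum_{ij}A_{ij}B_{ij}$, $(\nabla\boldsymbol v)_{ij}=\partial_jv_i$. *)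

theory Defs
  imports "HOL-Analysis.Analysis"
begin

record prm =
  pRe :: real  pWe :: real  pCa :: real  pMa :: real  pFr :: real
  pPepsi :: real  pPeT :: real  pEc :: real
  peps :: real  peta :: real  pT0 :: real
  zrho :: real  zmu :: real  zCh :: real  zk :: real
  pdt :: real  pTmin :: real

definition params_pos :: "prm \<Rightarrow> bool" where
  "params_pos P \<longleftrightarrow> pRe P > 0 \<and> pWe P > 0 \<and> pCa P > 0 \<and> pMa P > 0 \<and> pFr P > 0 \<and>
     pPepsi P > 0 \<and> pPeT P > 0 \<and> pEc P > 0 \<and> peps P > 0 \<and> peta P > 0 \<and> pT0 P > 0 \<and>
     zrho P > 0 \<and> zmu P > 0 \<and> zCh P > 0 \<and> zk P > 0 \<and> pdt P > 0 \<and> pTmin P > 0"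

definition partial :: "'n::finite \<Rightarrow> (real^'n \<Rightarrow> real) \<Rightarrow> real^'n \<Rightarrow> real" where
  "partial i f x = deriv (\<lambda>t. f (x + t *\<^sub>R axis i 1)) 0"

definition grad :: "(real^'n::finite \<Rightarrow> real) \<Rightarrow> real^'n \<Rightarrow> real^'n" where
  "grad f x = (\<chi> i. partial i f x)"

definition divg :: "(real^'n::finite \<Rightarrow> real^'n) \<Rightarrow> real^'n \<Rightarrow> real" where
  "divg F x = (\<Sum>i\<in>UNIV. partial i (\<lambda>y. F y $ i) x)"

definition jac :: "(real^'n::finite \<Rightarrow> real^'n) \<Rightarrow> real^'n \<Rightarrow> real^'n^'n" where
  "jac F x = (\<chi> i j. partial j (\<lambda>y. F y $ i) x)"

definition divT :: "(real^'n::finite \<Rightarrow> real^'n^'n) \<Rightarrow> real^'n \<Rightarrow> real^'n" where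
  "divT S x = (\<chi> i. \<Sum>j\<in>UNIV. partial j (\<lambda>y. S y $ i $ j) x)"

definition lap :: "(real^'n::finite \<Rightarrow> real) \<Rightarrow> real^'n \<Rightarrow> real" where
  "lap f x = (\<Sum>i\<in>UNIV. partial i (partial i f) x)"

definition ddot :: "real^'n::finite^'n \<Rightarrow> real^'n^'n \<Rightarrow> real" where
  "ddot A B = (\<Sum>i\<in>UNIV. \<Sum>j\<in>UNIV. A $ i $ j * B $ i $ j)"

definition outer :: "real^'n::finite \<Rightarrow> real^'n \<Rightarrow> real^'n^'n" where
  "outer a b = (\<chi> i j. a $ i * b $ j)"

fun Ck :: "nat \<Rightarrow> (real^'n::finite) set \<Rightarrow> (real^'n \<Rightarrow> real) \<Rightarrow> bool" where
  "Ck 0 U f = continuous_on U f"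
| "Ck (Suc k) U f = (continuous_on U f \<and>
      (\<forall>i. \<forall>x\<in>U. (\<lambda>t. f (x + t *\<^sub>R axis i 1)) differentiable (at 0)) \<and>
      (\<forall>i. Ck k U (partial i f)))"

definition smooth_on :: "(real^'n::finite) set \<Rightarrow> (real^'n \<Rightarrow> real) \<Rightarrow> bool" where
  "smooth_on U f \<longleftrightarrow> (\<forall>k. Ck k U f)"

definition smooth_vec_on :: "(real^'n::finite) set \<Rightarrow> (real^'n \<Rightarrow> real^'n) \<Rightarrow> bool" where
  "smooth_vec_on U v \<longleftrightarrow> (\<forall>i. smooth_on U (\<lambda>x. v x $ i))"

text \<open>Bounded (strong) Lipschitz domain: open, connected, bounded, nonempty, and near each
  boundary point the domain is the subgraph of a Lipschitz function in some unit direction e.\<close>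
definition lipschitz_domain :: "(real^'n::finite) set \<Rightarrow> bool" where
  "lipschitz_domain \<Omega> \<longleftrightarrow> open \<Omega> \<and> connected \<Omega> \<and> bounded \<Omega> \<and> \<Omega> \<noteq> {} \<and>
     (\<forall>x\<in>frontier \<Omega>. \<exists>r>0. \<exists>e g L. norm e = 1 \<and> L-lipschitz_on UNIV g \<and>
        (\<forall>y t. g (y + t *\<^sub>R e) = g y) \<and>
        \<Omega> \<inter> ball x r = {y \<in> ball x r. y \<bullet> e < g y})"

text \<open>nu is the outward unit normal of Omega at the boundary point x (the blow-up of Omega at x
  is the half space {z. z . nu < 0}); for a Lipschitz domain it exists at a.e. boundary point.\<close>
definition outward_normal :: "(real^'n::finite) set \<Rightarrow> real^'n \<Rightarrow> real^'n \<Rightarrow> bool" where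
  "outward_normal \<Omega> x \<nu> \<longleftrightarrow> x \<in> frontier \<Omega> \<and> norm \<nu> = 1 \<and>
     (\<forall>\<epsilon>>0. \<exists>r>0. \<forall>y\<in>ball x r.
        ((y - x) \<bullet> \<nu> < - \<epsilon> * norm (y - x) \<longrightarrow> y \<in> \<Omega>) \<and>
        ((y - x) \<bullet> \<nu> > \<epsilon> * norm (y - x) \<longrightarrow> y \<notin> \<Omega>))"

definition lam :: "real \<Rightarrow> real \<Rightarrow> real" where "lam z s = s + z * (1 - s)"
definition Wf :: "real \<Rightarrow> real" where "Wf s = s\<^sup>2 * (1 - s)\<^sup>2 / 4"
definition dW :: "real \<Rightarrow> real" where "dW s = s * (s - 1) * (s - 1/2)"

definition alph :: "prm \<Rightarrow> real" where "alph P = (zrho P - 1) / zrho P"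
definition lam_s :: "prm \<Rightarrow> real" where "lam_s P = peta P * pCa P * pMa P"
definition lam_u :: "prm \<Rightarrow> real" where "lam_u P = peta P * (1 + pCa P * pMa P * pT0 P)"
definition lam_f :: "prm \<Rightarrow> real \<Rightarrow> real" where
  "lam_f P T = peta P * (1 - pCa P * pMa P * (T - pT0 P))"

definition tbar :: "prm \<Rightarrow> ('a \<Rightarrow> real) \<Rightarrow> ('a \<Rightarrow> real) \<Rightarrow> 'a \<Rightarrow> real" where
  "tbar P X1 X0 x = (X1 x - X0 x) / pdt P"

definition rho :: "prm \<Rightarrow> (real^'n::finite \<Rightarrow> real) \<Rightarrow> real^'n \<Rightarrow> real" where
  "rho P psi x = lam (zrho P) (psi x)"
definition visc :: "prm \<Rightarrow> (real^'n::finite \<Rightarrow> real) \<Rightarrow> real^'n \<Rightarrow> real" where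
  "visc P psi x = lam (zmu P) (psi x)"
definition Ch :: "prm \<Rightarrow> (real^'n::finite \<Rightarrow> real) \<Rightarrow> real^'n \<Rightarrow> real" where
  "Ch P psi x = lam (zCh P) (psi x)"
definition kap :: "prm \<Rightarrow> (real^'n::finite \<Rightarrow> real) \<Rightarrow> real^'n \<Rightarrow> real" where
  "kap P psi x = lam (zk P) (psi x)"

definition mpsi :: "(real^'n::finite \<Rightarrow> real) \<Rightarrow> real^'n \<Rightarrow> real" where
  "mpsi psi0 x = \<bar>psi0 x * (1 - psi0 x)\<bar>"

definition delta :: "prm \<Rightarrow> (real^'n::finite \<Rightarrow> real) \<Rightarrow> real^'n \<Rightarrow> real" where
  "delta P psi x = Wf (psi x) / peps P + peps P * (norm (grad psi x))\<^sup>2 / 2"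

definition Fpsi :: "prm \<Rightarrow> (real^'n::finite \<Rightarrow> real) \<Rightarrow> (real^'n \<Rightarrow> real) \<Rightarrow> (real^'n \<Rightarrow> real) \<Rightarrow> real^'n \<Rightarrow> real" where
  "Fpsi P psi0 psi1 Tn x = 1 / pEc P * ((1 - zrho P) * Ch P psi1 x + (1 - zCh P) * rho P psi0 x)
      * Tn x * (1 - ln (Tn x / pT0 P))"

definition Upsi :: "prm \<Rightarrow> (real^'n::finite \<Rightarrow> real) \<Rightarrow> (real^'n \<Rightarrow> real) \<Rightarrow> (real^'n \<Rightarrow> real) \<Rightarrow> real^'n \<Rightarrow> real" where
  "Upsi P psi0 psi1 Tn x = 1 / pEc P * ((1 - zrho P) * Ch P psi1 x + (1 - zCh P) * rho P psi0 x) * Tn x"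

definition Stil :: "prm \<Rightarrow> (real^'n::finite \<Rightarrow> real) \<Rightarrow> (real^'n \<Rightarrow> real) \<Rightarrow> real^'n \<Rightarrow> real" where
  "Stil P psi1 Tn x = 1 / pEc P * rho P psi1 x * Ch P psi1 x * ln (Tn x / pT0 P)"

definition Gf :: "prm \<Rightarrow> (real^'n::finite \<Rightarrow> real) \<Rightarrow> (real^'n \<Rightarrow> real) \<Rightarrow> real^'n \<Rightarrow> real" where
  "Gf P psi1 Tn x = 1 / pEc P * ((1 - zrho P) * Ch P psi1 x + (1 - zCh P) * rho P psi1 x)
      * ln (Tn x / pT0 P)"

definition Util :: "prm \<Rightarrow> (real^'n::finite \<Rightarrow> real) \<Rightarrow> (real^'n \<Rightarrow> real) \<Rightarrow> (real^'n \<Rightarrow> real) \<Rightarrow> real^'n \<Rightarrow> real" where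
  "Util P psi0 psi1 Tn x = Fpsi P psi0 psi1 Tn x + Tn x * Gf P psi1 Tn x"

definition stil :: "prm \<Rightarrow> (real^'n::finite \<Rightarrow> real) \<Rightarrow> (real^'n \<Rightarrow> real) \<Rightarrow> real^'n \<Rightarrow> real" where
  "stil P psi1 Tn x = Stil P psi1 Tn x + 1 / pWe P * lam_s P * delta P psi1 x"

definition wchem :: "prm \<Rightarrow> (real^'n::finite \<Rightarrow> real) \<Rightarrow> real^'n \<Rightarrow> real" where
  "wchem P psi1 x = dW (psi1 x) / peps P - peps P * lap psi1 x"

definition mu0 :: "prm \<Rightarrow> (real^'n::finite \<Rightarrow> real) \<Rightarrow> (real^'n \<Rightarrow> real) \<Rightarrow> (real^'n \<Rightarrow> real) \<Rightarrow> real^'n \<Rightarrow> real" where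
  "mu0 P psi0 psi1 Tn x = Fpsi P psi0 psi1 Tn x + 1 / pWe P * lam_f P (Tn x) * wchem P psi1 x"

definition muc :: "prm \<Rightarrow> (real^'n::finite \<Rightarrow> real) \<Rightarrow> (real^'n \<Rightarrow> real) \<Rightarrow> (real^'n \<Rightarrow> real)
     \<Rightarrow> (real^'n \<Rightarrow> real) \<Rightarrow> real^'n \<Rightarrow> real" where
  "muc P psi0 psi1 Tn p x = mu0 P psi0 psi1 Tn x + alph P * p x"

definition fhat :: "prm \<Rightarrow> (real^'n::finite \<Rightarrow> real) \<Rightarrow> (real^'n \<Rightarrow> real) \<Rightarrow> real^'n \<Rightarrow> real" where
  "fhat P psi1 Tn x = 1 / pEc P * rho P psi1 x * Ch P psi1 x * Tn x * (1 - ln (Tn x / pT0 P))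
      + 1 / pWe P * lam_f P (Tn x) * delta P psi1 x"

definition Mten :: "prm \<Rightarrow> (real^'n::finite \<Rightarrow> real) \<Rightarrow> (real^'n \<Rightarrow> real) \<Rightarrow> (real^'n \<Rightarrow> real)
     \<Rightarrow> (real^'n \<Rightarrow> real) \<Rightarrow> real^'n \<Rightarrow> real^'n^'n" where
  "Mten P psi0 psi1 Tn p x =
      - (p x *\<^sub>R mat 1)
      - (1 / pWe P * lam_f P (Tn x) * peps P) *\<^sub>R outer (grad psi1 x) (grad psi1 x)
      - (mu0 P psi0 psi1 Tn x * psi1 x) *\<^sub>R mat 1"

definition tau :: "prm \<Rightarrow> (real^'n::finite \<Rightarrow> real) \<Rightarrow> (real^'n \<Rightarrow> real^'n) \<Rightarrow> real^'n \<Rightarrow> real^'n^'n" where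
  "tau P psi0 v1 x = visc P psi0 x *\<^sub>R (jac v1 x + transpose (jac v1 x))
      - (2 / 3 * visc P psi0 x * divg v1 x) *\<^sub>R mat 1"

definition Sigma :: "prm \<Rightarrow> (real^'n::finite \<Rightarrow> real^'n) \<Rightarrow> (real^'n \<Rightarrow> real) \<Rightarrow> (real^'n \<Rightarrow> real)
     \<Rightarrow> (real^'n \<Rightarrow> real) \<Rightarrow> (real^'n \<Rightarrow> real) \<Rightarrow> real^'n \<Rightarrow> real^'n^'n" where
  "Sigma P v1 psi0 psi1 Tn p x = Mten P psi0 psi1 Tn p x + (1 / pRe P) *\<^sub>R tau P psi0 v1 x
      + fhat P psi1 Tn x *\<^sub>R mat 1"

definition qE :: "prm \<Rightarrow> (real^'n::finite \<Rightarrow> real^'n) \<Rightarrow> (real^'n \<Rightarrow> real) \<Rightarrow> (real^'n \<Rightarrow> real)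
     \<Rightarrow> (real^'n \<Rightarrow> real) \<Rightarrow> (real^'n \<Rightarrow> real) \<Rightarrow> (real^'n \<Rightarrow> real) \<Rightarrow> real^'n \<Rightarrow> real^'n" where
  "qE P v0 psi0 psi1 Tn Tn1 p x =
      - (kap P psi1 x / (2 * pPeT P)) *\<^sub>R (grad Tn1 x + grad Tn x)
      - (pEc P / pPepsi P * mpsi psi0 x * muc P psi0 psi1 Tn p x) *\<^sub>R grad (muc P psi0 psi1 Tn p) x
      - (pEc P / pWe P * lam_u P * peps P) *\<^sub>R
          (tbar P psi1 psi0 x *\<^sub>R grad psi1 x + outer (grad psi1 x) (grad psi1 x) *v v0 x)"

definition corr :: "prm \<Rightarrow> (real^'n::finite \<Rightarrow> real) \<Rightarrow> (real^'n \<Rightarrow> real) \<Rightarrow> (real^'n \<Rightarrow> real)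
     \<Rightarrow> (real^'n \<Rightarrow> real) \<Rightarrow> real^'n \<Rightarrow> real" where
  "corr P psi0 psi1 Tn Tn1 x =
      pEc P / pWe P * lam_f P (Tn x) * (psi1 x - psi0 x)\<^sup>2 / (8 * pdt P * peps P)
    - pEc P / pWe P * lam_f P (Tn x) * peps P * (norm (grad psi1 x - grad psi0 x))\<^sup>2 / (2 * pdt P)
    + rho P psi1 x * Ch P psi1 x * Tn x * (Tn1 x - Tn x)\<^sup>2 / (2 * (pTmin P)\<^sup>2 * pdt P)
    + (kap P psi1 x * (norm (grad Tn1 x))\<^sup>2 - kap P psi1 x * (norm (grad Tn x))\<^sup>2) / (4 * pPeT P * Tn x)"

definition hs :: "prm \<Rightarrow> (real^'n::finite \<Rightarrow> real^'n) \<Rightarrow> (real^'n \<Rightarrow> real^'n) \<Rightarrow> (real^'n \<Rightarrow> real)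
     \<Rightarrow> (real^'n \<Rightarrow> real) \<Rightarrow> (real^'n \<Rightarrow> real) \<Rightarrow> (real^'n \<Rightarrow> real) \<Rightarrow> (real^'n \<Rightarrow> real)
     \<Rightarrow> real^'n \<Rightarrow> real" where
  "hs P v0 v1 psi0 psi1 Tn Tn1 p x =
      - pEc P * Upsi P psi0 psi1 Tn x * tbar P psi1 psi0 x
      - pEc P * Util P psi0 psi1 Tn x * (v0 x \<bullet> grad psi1 x)
      + pEc P * ddot (Mten P psi0 psi1 Tn p x) (jac v0 x)
      + pEc P / pRe P * ddot (tau P psi0 v1 x) (jac v1 x)
      - pEc P * Tn x * stil P psi1 Tn x * divg v0 x
      - pEc P / pWe P * lam_u P * tbar P (delta P psi1) (delta P psi0) x
      - pEc P / pWe P * lam_u P * (v0 x \<bullet> grad (delta P psi1) x)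
      + corr P psi0 psi1 Tn Tn1 x"

definition shat :: "prm \<Rightarrow> (real^'n::finite \<Rightarrow> real) \<Rightarrow> (real^'n \<Rightarrow> real) \<Rightarrow> real^'n \<Rightarrow> real" where
  "shat P psi T x = 1 / pEc P * rho P psi x * Ch P psi x * ln (T x / pT0 P)
      + 1 / pWe P * lam_s P * delta P psi x"

definition res :: "prm \<Rightarrow> (real^'n::finite \<Rightarrow> real) \<Rightarrow> (real^'n \<Rightarrow> real) \<Rightarrow> (real^'n \<Rightarrow> real)
     \<Rightarrow> (real^'n \<Rightarrow> real) \<Rightarrow> real^'n \<Rightarrow> real" where
  "res P psi0 psi1 Tn Tn1 x =
      lam_f P (Tn x) / (pWe P * peps P * Tn x * pdt P) *
        (1/8 * (psi1 x - psi0 x)\<^sup>2 + dW (psi1 x) * (psi1 x - psi0 x) - Wf (psi1 x) + Wf (psi0 x))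
    + rho P psi1 x * Ch P psi1 x / (pEc P * Tn x * pdt P) *
        (Tn x * (Tn1 x - Tn x)\<^sup>2 / (2 * (pTmin P)\<^sup>2)
         - (Tn1 x - Tn x - Tn x * ln (Tn1 x / Tn x)))"

definition prod_density :: "prm \<Rightarrow> (real^'n::finite \<Rightarrow> real^'n) \<Rightarrow> (real^'n \<Rightarrow> real)
     \<Rightarrow> (real^'n \<Rightarrow> real) \<Rightarrow> (real^'n \<Rightarrow> real) \<Rightarrow> (real^'n \<Rightarrow> real) \<Rightarrow> (real^'n \<Rightarrow> real)
     \<Rightarrow> real^'n \<Rightarrow> real" where
  "prod_density P v1 psi0 psi1 Tn Tn1 p x =
      kap P psi1 x / (pEc P * pPeT P) * (norm (grad Tn1 x + grad Tn x))\<^sup>2 / (4 * (Tn x)\<^sup>2)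
    + 1 / pRe P * ddot (tau P psi0 v1 x) (jac v1 x) / Tn x
    + mpsi psi0 x / pPepsi P * (norm (grad (muc P psi0 psi1 Tn p) x))\<^sup>2 / Tn x
    + res P psi0 psi1 Tn Tn1 x"

end

theory Submission
  imports Defs
begin

text \<open>
  Dividing the temperature equation by \<open>T\<^sup>n\<close> and using the phase equation and the divergence constraint to
  eliminate the chemical potential, the discrete entropy density satisfies pointwise
  \<open>(s\<^sup>n\<^sup>+\<^sup>1 - s\<^sup>n) / \<delta>t = production + \<nabla> \<cdot> \<Psi>\<close>, where \<open>\<Psi>\<close> combines heat conduction, convection of entropy and a
  capillary flux along \<open>\<nabla>\<psi>\<^sup>n\<^sup>+\<^sup>1\<close>, hence is tangential to the boundary.  Likewise \<open>\<rho>\<^sup>n\<^sup>+\<^sup>1 - \<rho>\<^sup>n\<close> is the divergence of a field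
  proportional to \<open>(1 / \<alpha> - \<psi>\<^sup>n\<^sup>+\<^sup>1) v\<^sup>n\<close>.  The production is nonnegative by a trace inequality for the viscous
  stress (this uses \<open>d \<le> 3\<close>), by \<open>W'' \<ge> - 1 / 4\<close>, and by Taylor's formula for the logarithm.

  What remains is the divergence theorem on a Lipschitz domain for a field \<open>F\<close> with \<open>F \<cdot> \<nu> = 0\<close> wherever the
  outward normal exists.  Near a boundary point the domain lies below a Lipschitz graph, and Rademacher's theorem
  provides the normals; integrating by parts against a steep Lipschitz approximation of the
  indicator function then leaves a boundary term that tends to \<open>0\<close>.
\<close>

section \<open>Lipschitz functions of one real variable\<close>

text \<open>The mobility \<open>mpsi\<close> contains an absolute value, and \<open>\<psi>\<close>
  is confined to [0, 1] only in the entropy half. The mass half therefore never expands the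
  diffusive flux: its divergence is a number, eliminated between phase equation and constraint. In
  the entropy half \<open>mpsi\<close> agrees on \<open>\<Omega>\<close> with a polynomial in
  \<open>psi0\<close>. To remove the chemical potential, the phase equation is weighted with
  \<open>mu0\<close> and the constraint with \<open>p\<close>; the resulting work terms cancel those
  of \<open>Mten\<close>. The decisive relation is \<open>lam_u = lam_f T + lam_s * T\<close>: the
  \<open>lam_f\<close> part cancels up to a double-well remainder, with \<open>corr\<close>
  completing the squares, and the \<open>lam_s\<close> part is the entropy of the interface. The
  boundary conditions on gradients hold only where a blow-up normal exists, so the boundary flux has
  to be controlled from inside \<open>\<Omega>\<close>. This works because the graph function is
  constant along \<open>e\<close>: a point where it is differentiable gives differentiability, and
  hence a normal, at the graph point above it.\<close>

lemma continuous_induction_nonneg: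
  fixes \<Phi> :: "real \<Rightarrow> real"
  assumes ab: "a \<le> b" and cont: "continuous_on {a..b} \<Phi>" and start: "\<Phi> a \<ge> 0"
    and step: "\<And>y. a \<le> y \<Longrightarrow> y < b \<Longrightarrow> \<Phi> y \<ge> 0 \<Longrightarrow> \<exists>t>0. y + t \<le> b \<and> \<Phi> (y + t) \<ge> 0"
  shows "\<Phi> b \<ge> 0"
proof -
  define S where "S = {y \<in> {a..b}. \<Phi> y \<ge> 0}"
  have "closed S"
    unfolding S_def using continuous_on_closed_Collect_le[OF continuous_on_const cont, of 0] by simp
  moreover have "bounded S" by (rule bounded_subset[of "{a..b}"]) (auto simp: S_def)
  ultimately have "compact S" by (simp add: compact_eq_bounded_closed)
  moreover have "a \<in> S" using ab start by (simp add: S_def)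
  ultimately obtain s where s: "s \<in> S" "\<And>y. y \<in> S \<Longrightarrow> y \<le> s"
    using compact_attains_sup[of S] by auto
  have "s = b"
  proof (rule ccontr)
    assume "s \<noteq> b"
    then have "a \<le> s" "s < b" "\<Phi> s \<ge> 0" using s(1) by (auto simp: S_def)
    then obtain t where "t > 0" "s + t \<le> b" "\<Phi> (s + t) \<ge> 0" using step by blast
    then have "s + t \<in> S" using \<open>a \<le> s\<close> by (simp add: S_def)
    then show False using s(2) \<open>t > 0\<close> by fastforce
  qed
  then show ?thesis using s(1) by (simp add: S_def)
qed

section \<open>Measure of a Borel set inside a growing interval\<close>

lemma measure_Int_interval_diff:
  fixes A :: "real set"
  assumes "A \<in> sets borel" "a \<le> y" "y \<le> z"
  shows "measure lborel (A \<inter> {a..z}) - measure lborel (A \<inter> {a..y}) = measure lborel (A \<inter> {y<..z})"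
proof -
  have "A \<inter> {a..z} = (A \<inter> {a..y}) \<union> (A \<inter> {y<..z})" using assms by auto
  moreover have "measure lborel ((A \<inter> {a..y}) \<union> (A \<inter> {y<..z})) =
      measure lborel (A \<inter> {a..y}) + measure lborel (A \<inter> {y<..z})"
  proof (rule measure_Union)
    show "emeasure lborel (A \<inter> {a..y}) \<noteq> \<infinity>" "emeasure lborel (A \<inter> {y<..z}) \<noteq> \<infinity>"
      using emeasure_bounded_finite[of "A \<inter> {a..y}"] emeasure_bounded_finite[of "A \<inter> {y<..z}"]
      by (auto simp: bounded_Int)
  qed (use assms in auto)
  ultimately show ?thesis by simp
qed

lemma measure_Int_interval_le:
  fixes A :: "real set"
  assumes "A \<in> sets borel" "y \<le> z"
  shows "measure lborel (A \<inter> {y<..z}) \<le> z - y"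
proof -
  have "measure lborel (A \<inter> {y<..z}) \<le> measure lborel {y<..z}"
    by (rule measure_mono_fmeasurable) (use assms in \<open>auto simp: fmeasurable_def\<close>)
  then show ?thesis using assms by simp
qed

lemma measure_Int_singleton: "measure lborel (A \<inter> {a::real}) = 0"
proof -
  have "A \<inter> {a} = (if a \<in> A then {a} else {})" by auto
  then show ?thesis by (simp del: Int_insert_right)
qed

lemma continuous_on_measure_Int_interval:
  fixes A :: "real set"
  assumes "A \<in> sets borel"
  shows "continuous_on {a..b} (\<lambda>y. measure lborel (A \<inter> {a..y}))"
proof (rule lipschitz_on_continuous_on)
  have *: "\<bar>measure lborel (A \<inter> {a..z}) - measure lborel (A \<inter> {a..y})\<bar> \<le> z - y"
    if "a \<le> y" "y \<le> z" for y z
    using measure_Int_interval_diff[OF assms that] measure_Int_interval_le[OF assms that(2)]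
    by simp
  show "1-lipschitz_on {a..b} (\<lambda>y. measure lborel (A \<inter> {a..y}))"
  proof (rule lipschitz_onI)
    fix x y assume "x \<in> {a..b}" "y \<in> {a..b}"
    then show "dist (measure lborel (A \<inter> {a..x})) (measure lborel (A \<inter> {a..y})) \<le> 1 * dist x y"
      using *[of x y] *[of y x] by (cases "x \<le> y") (auto simp: dist_real_def)
  qed simp
qed

text \<open>Continuous induction on the surplus \<open>\<Phi>\<close> of \<open>h\<close> over the
  claimed bound on \<open>{a..y}\<close>: from a point of \<open>K\<close> the hypothesis supplies a
  step at rate \<open>\<beta>\<close>; off the closed set \<open>K\<close> a short step avoids
  \<open>K\<close> and loses at most rate \<open>L\<close>.\<close>

lemma lipschitz_increment_ge:
  fixes h :: "real \<Rightarrow> real"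
  assumes lip: "L-lipschitz_on UNIV h" and K: "compact K" and ab: "a \<le> b" and beta: "- L \<le> \<beta>"
    and up: "\<And>x d. x \<in> K \<Longrightarrow> d > 0 \<Longrightarrow> \<exists>t>0. t < d \<and> h (x + t) - h x \<ge> \<beta> * t"
  shows "h b - h a \<ge> \<beta> * measure lborel (K \<inter> {a..b}) - L * (b - a - measure lborel (K \<inter> {a..b}))"
proof -
  have Kb: "K \<in> sets borel" using compact_imp_closed[OF K] by simp
  define m where "m y = measure lborel (K \<inter> {a..y})" for y
  define \<Phi> where "\<Phi> y = h y - h a - (\<beta> + L) * m y + L * (y - a)" for y
  have inc: "m z - m y = measure lborel (K \<inter> {y<..z})" "m z - m y \<le> z - y" if "a \<le> y" "y \<le> z" for y z
    unfolding m_def using measure_Int_interval_diff[OF Kb that] measure_Int_interval_le[OF Kb that(2)] by auto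
  have "\<Phi> b \<ge> 0"
  proof (rule continuous_induction_nonneg[of a b \<Phi>])
    show "a \<le> b" by (rule ab)
    have "continuous_on {a..b} h"
      by (rule lipschitz_on_continuous_on[OF lipschitz_on_subset[OF lip]]) simp
    then show "continuous_on {a..b} \<Phi>"
      unfolding \<Phi>_def m_def by (intro continuous_intros continuous_on_measure_Int_interval Kb)
    have "m a = 0" using measure_Int_singleton[of K a] by (simp add: m_def)
    then show "\<Phi> a \<ge> 0" by (simp add: \<Phi>_def)
  next
    fix y assume y: "a \<le> y" "y < b" "\<Phi> y \<ge> 0"
    show "\<exists>t>0. y + t \<le> b \<and> \<Phi> (y + t) \<ge> 0"
    proof (cases "y \<in> K")
      case True
      then obtain t where t: "t > 0" "t < b - y" "h (y + t) - h y \<ge> \<beta> * t"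
        using up[of y "b - y"] y by auto
      \<comment> \<open>The step need not stay in \<open>K\<close>, but since
        \<open>\<beta> + L \<ge> 0\<close> a gain of \<open>\<beta> * t\<close> is at least what the
        bound demands for any share of \<open>K\<close> in it.\<close>
      have "(\<beta> + L) * (m (y + t) - m y) \<le> (\<beta> + L) * t"
        using inc(2)[of y "y+t"] y t beta by (intro mult_left_mono) auto
      then have "\<Phi> (y + t) \<ge> 0" using t y(3) unfolding \<Phi>_def by (simp add: algebra_simps)
      then show ?thesis using t by (intro exI[of _ t]) auto
    next
      case False
      have "open (- K)" using compact_imp_closed[OF K] by (simp add: open_Compl)
      then obtain e where e: "e > 0" "ball y e \<subseteq> - K" using False open_contains_ball by blast
      define t where "t = min (e / 2) (b - y)"
      have t: "t > 0" "t < e" "t \<le> b - y" using e y by (auto simp: t_def)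
      have "K \<inter> {y<..y+t} = {}"
      proof -
        have "x \<in> ball y e" if "y < x" "x \<le> y + t" for x using that t by (auto simp: dist_real_def)
        then show ?thesis using e(2) by fastforce
      qed
      then have "m (y + t) = m y" using inc(1)[of y "y+t"] y t by simp
      moreover have "\<bar>h (y + t) - h y\<bar> \<le> L * t"
        using lipschitz_onD[OF lip, of "y+t" y] t by (simp add: dist_real_def)
      ultimately have "\<Phi> (y + t) \<ge> 0" using y(3) unfolding \<Phi>_def by (simp add: algebra_simps)
      then show ?thesis using t by (intro exI[of _ t]) auto
    qed
  qed
  then show ?thesis unfolding \<Phi>_def m_def by (simp add: algebra_simps)
qed

text \<open>A weak form of the Lebesgue density theorem, by continuous induction instead of a covering argument.\<close>
lemma compact_null_if_small_density:
  fixes K :: "real set"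
  assumes K: "compact K" and c: "0 \<le> c" "c < 1"
    and small: "\<And>a b. a \<le> b \<Longrightarrow> measure lborel (K \<inter> {a..b}) \<le> c * (b - a)"
  shows "measure lborel K = 0"
proof -
  have Kb: "K \<in> sets borel" using compact_imp_closed[OF K] by simp
  have Kfin: "emeasure lborel K \<noteq> \<infinity>" using emeasure_compact_finite[OF K] by auto
  obtain r where r: "r > 0" "K \<subseteq> ball 0 r"
    using compact_imp_bounded[OF K] bounded_subset_ballD by blast
  have bound: "measure lborel K \<le> c * (measure lborel K + \<eta>)" if \<eta>: "\<eta> > 0" for \<eta>
  proof -
    \<comment> \<open>Induction along \<open>{-r..r}\<close> bounds the measure of \<open>K\<close>
      by \<open>c\<close> times that of \<open>G\<close>: at a point of \<open>K\<close> a whole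
      short interval lies in \<open>G\<close>, so the density bound can be charged to it; off
      \<open>K\<close> a short interval adds nothing to the left side.\<close>
    obtain G where G: "open G" "K \<subseteq> G" "emeasure lborel (G - K) < ennreal \<eta>"
      using outer_regular_lborel[OF Kb \<eta>] by metis
    have Gb: "G \<in> sets borel" using G by auto
    define m where "m y = measure lborel (K \<inter> {-r..y})" for y
    define n where "n y = measure lborel (G \<inter> {-r..y})" for y
    have incm: "m z - m y = measure lborel (K \<inter> {y<..z})" "m z - m y \<le> c * (z - y)"
      if "-r \<le> y" "y \<le> z" for y z
    proof -
      show *: "m z - m y = measure lborel (K \<inter> {y<..z})"
        unfolding m_def using measure_Int_interval_diff[OF Kb that] .
      have "measure lborel (K \<inter> {y<..z}) \<le> measure lborel (K \<inter> {y..z})"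
        by (rule measure_mono_fmeasurable)
           (use Kb emeasure_bounded_finite[of "K \<inter> {y..z}"] in \<open>auto simp: fmeasurable_def bounded_Int\<close>)
      with * small[OF that(2)] show "m z - m y \<le> c * (z - y)" by linarith
    qed
    have incn: "n z - n y = measure lborel (G \<inter> {y<..z})" if "-r \<le> y" "y \<le> z" for y z
      unfolding n_def using measure_Int_interval_diff[OF Gb that] .
    define \<Phi> where "\<Phi> y = c * n y - m y" for y
    have "\<Phi> r \<ge> 0"
    proof (rule continuous_induction_nonneg[of "-r" r \<Phi>])
      show "- r \<le> r" using r by simp
      show "continuous_on {-r..r} \<Phi>"
        unfolding \<Phi>_def m_def n_def by (intro continuous_intros continuous_on_measure_Int_interval Kb Gb)
      have "m (-r) = 0" "n (-r) = 0"
        using measure_Int_singleton[of _ "-r"] by (simp_all add: m_def n_def)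
      then show "\<Phi> (-r) \<ge> 0" by (simp add: \<Phi>_def)
    next
      fix y assume y: "-r \<le> y" "y < r" "\<Phi> y \<ge> 0"
      show "\<exists>t>0. y + t \<le> r \<and> \<Phi> (y + t) \<ge> 0"
      proof (cases "y \<in> K")
        case True
        then obtain e where e: "e > 0" "ball y e \<subseteq> G" using G open_contains_ball by blast
        define t where "t = min (e / 2) (r - y)"
        have t: "t > 0" "t < e" "t \<le> r - y" using e y by (auto simp: t_def)
        have "{y<..y+t} \<subseteq> ball y e" using t by (auto simp: dist_real_def)
        then have "G \<inter> {y<..y+t} = {y<..y+t}" using e(2) by auto
        then have "n (y + t) - n y = t" using incn[of y "y+t"] y t by simp
        moreover have "m (y + t) - m y \<le> c * t" using incm(2)[of y "y+t"] y t by simp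
        moreover have "c * n (y + t) = c * n y + c * (n (y + t) - n y)" by (simp add: algebra_simps)
        ultimately have "\<Phi> (y + t) \<ge> 0" using y(3) unfolding \<Phi>_def by simp
        then show ?thesis using t by (intro exI[of _ t]) auto
      next
        case False
        have "open (- K)" using compact_imp_closed[OF K] by (simp add: open_Compl)
        then obtain e where e: "e > 0" "ball y e \<subseteq> - K" using False open_contains_ball by blast
        define t where "t = min (e / 2) (r - y)"
        have t: "t > 0" "t < e" "t \<le> r - y" using e y by (auto simp: t_def)
        have "{y<..y+t} \<subseteq> ball y e" using t by (auto simp: dist_real_def)
        then have "K \<inter> {y<..y+t} = {}" using e(2) by auto
        then have "m (y + t) = m y" using incm(1)[of y "y+t"] y t by simp
        moreover have "n (y + t) - n y \<ge> 0" using incn[of y "y+t"] y t by simp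
        then have "c * n (y + t) \<ge> c * n y" using c by (simp add: mult_left_mono)
        ultimately have "\<Phi> (y + t) \<ge> 0" using y(3) unfolding \<Phi>_def by simp
        then show ?thesis using t by (intro exI[of _ t]) auto
      qed
    qed
    then have le: "m r \<le> c * n r" unfolding \<Phi>_def by simp
    have "K \<inter> {-r..r} = K" using r(2) by auto (auto simp: dist_real_def subset_iff abs_less_iff)
    then have mr: "m r = measure lborel K" by (simp add: m_def)
    have fG: "emeasure lborel (G - K) \<noteq> \<infinity>" using G(3) by auto
    have "measure lborel (G \<inter> {-r..r}) \<le> measure lborel (K \<union> (G - K))"
    proof (rule measure_mono_fmeasurable)
      show "K \<union> (G - K) \<in> fmeasurable lborel"
        using Kb Gb Kfin fG by (intro fmeasurable.Un fmeasurableI) (auto simp: less_top)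
    qed (use Gb in auto)
    also have "\<dots> = measure lborel K + measure lborel (G - K)"
      by (rule measure_Union) (use Kb Gb Kfin fG in auto)
    also have "measure lborel (G - K) \<le> \<eta>"
      using G(3) \<eta> by (simp add: measure_def enn2real_leI)
    finally have "n r \<le> measure lborel K + \<eta>" unfolding n_def by simp
    then have "c * n r \<le> c * (measure lborel K + \<eta>)" using c by (simp add: mult_left_mono)
    with le mr show ?thesis by simp
  qed
  have "(1 - c) * measure lborel K \<le> 0"
  proof (rule field_le_epsilon)
    fix e :: real assume "e > 0"
    have "c * e \<le> 1 * e" using c \<open>e > 0\<close> by (intro mult_right_mono) auto
    then show "(1 - c) * measure lborel K \<le> 0 + e"
      using bound[OF \<open>e > 0\<close>] by (simp add: algebra_simps)
  qed
  then have "measure lborel K \<le> 0" using c by (simp add: mult_le_0_iff)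
  then show ?thesis using measure_nonneg[of lborel K] by linarith
qed

text \<open>The increment bound applies to \<open>h\<close> and to \<open>-h\<close>. Adding the
  two, the increments of \<open>h\<close> cancel and leave
  \<open>(\<beta> - \<alpha>) * m \<le> 2 * L * (b - a - m)\<close> for the measure \<open>m\<close>
  of \<open>K\<close> in \<open>{a..b}\<close>. So \<open>K\<close> has density at most a fixed
  \<open>c < 1\<close> in every interval.\<close>

lemma lipschitz_oscillation_compact_null:
  fixes h :: "real \<Rightarrow> real"
  assumes lip: "L-lipschitz_on UNIV h" and K: "compact K" and ab: "\<alpha> < \<beta>"
    and up: "\<And>x d. x \<in> K \<Longrightarrow> d > 0 \<Longrightarrow> \<exists>t>0. t < d \<and> h (x + t) - h x > \<beta> * t"
    and lo: "\<And>x d. x \<in> K \<Longrightarrow> d > 0 \<Longrightarrow> \<exists>t>0. t < d \<and> h (x + t) - h x < \<alpha> * t"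
  shows "measure lborel K = 0"
proof (cases "K = {}")
  case False
  then obtain x where x: "x \<in> K" by auto
  have bd: "\<bar>h (x + t) - h x\<bar> \<le> L * t" if "t > 0" for t
    using lipschitz_onD[OF lip, of "x+t" x] that by (simp add: dist_real_def)
  \<comment> \<open>All slopes of \<open>h\<close> lie between \<open>-L\<close> and
    \<open>L\<close>, so the hypotheses at a single point already force
    \<open>-L < \<alpha> < \<beta> < L\<close>.\<close>
  obtain t where t: "t > 0" "h (x + t) - h x > \<beta> * t" using up[OF x, of 1] by auto
  have "\<beta> * t < L * t" using t bd[of t] by linarith
  then have bL: "\<beta> < L" using t by simp
  obtain s where s: "s > 0" "h (x + s) - h x < \<alpha> * s" using lo[OF x, of 1] by auto
  have "(-L) * s < \<alpha> * s" using s bd[of s] by linarith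
  then have aL: "-L < \<alpha>" using s(1) mult_less_cancel_right_pos by blast
  have Lpos: "L > 0" using aL bL ab by linarith
  have lip': "L-lipschitz_on UNIV (\<lambda>x. - h x)" using lip by simp
  have key: "(\<beta> - \<alpha>) * measure lborel (K \<inter> {a..b}) \<le> 2 * L * (b - a - measure lborel (K \<inter> {a..b}))"
    if "a \<le> b" for a b
  proof -
    have 1: "h b - h a \<ge> \<beta> * measure lborel (K \<inter> {a..b}) - L * (b - a - measure lborel (K \<inter> {a..b}))"
    proof (rule lipschitz_increment_ge[OF lip K that])
      show "-L \<le> \<beta>" using aL ab by simp
      fix x d :: real assume "x \<in> K" "d > 0"
      then obtain t where "t>0" "t < d" "h (x + t) - h x > \<beta> * t" using up by blast
      then show "\<exists>t>0. t < d \<and> \<beta> * t \<le> h (x + t) - h x" by (intro exI[of _ t]) auto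
    qed
    have 2: "- h b - - h a \<ge> (-\<alpha>) * measure lborel (K \<inter> {a..b}) - L * (b - a - measure lborel (K \<inter> {a..b}))"
    proof (rule lipschitz_increment_ge[OF lip' K that])
      show "-L \<le> -\<alpha>" using bL ab by simp
      fix x d :: real assume "x \<in> K" "d > 0"
      then obtain t where "t>0" "t < d" "h (x + t) - h x < \<alpha> * t" using lo by blast
      then show "\<exists>t>0. t < d \<and> - \<alpha> * t \<le> - h (x + t) - - h x" by (intro exI[of _ t]) auto
    qed
    from 1 2 show ?thesis by (simp add: algebra_simps)
  qed
  define c where "c = 2 * L / (\<beta> - \<alpha> + 2 * L)"
  show ?thesis
  proof (rule compact_null_if_small_density[OF K])
    show "0 \<le> c" "c < 1" using Lpos ab by (auto simp: c_def)
    fix a b :: real assume "a \<le> b"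
    from key[OF this] show "measure lborel (K \<inter> {a..b}) \<le> c * (b - a)"
      unfolding c_def using Lpos ab by (simp add: field_simps)
  qed
qed simp

text \<open>Both oscillation hypotheses pass to subsets, so after cutting \<open>E\<close> to
  bounded pieces it is enough to treat the compact sets given by inner regularity.\<close>

lemma lipschitz_oscillation_null:
  fixes h :: "real \<Rightarrow> real"
  assumes lip: "L-lipschitz_on UNIV h" and E: "E \<in> sets borel" and ab: "\<alpha> < \<beta>"
    and up: "\<And>x d. x \<in> E \<Longrightarrow> d > 0 \<Longrightarrow> \<exists>t>0. t < d \<and> h (x + t) - h x > \<beta> * t"
    and lo: "\<And>x d. x \<in> E \<Longrightarrow> d > 0 \<Longrightarrow> \<exists>t>0. t < d \<and> h (x + t) - h x < \<alpha> * t"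
  shows "emeasure lborel E = 0"
proof -
  have bdd: "emeasure lborel (E \<inter> {-real n..real n}) = 0" for n
  proof -
    let ?E = "E \<inter> {-real n..real n}"
    have Eb: "?E \<in> sets lebesgue" using E by auto
    have *: "emeasure lborel ?E \<le> 0 + ennreal e" if e: "0 < e" for e :: real
    proof -
      obtain T where T: "closed T" "T \<subseteq> ?E" "emeasure lebesgue (?E - T) < ennreal e"
        by (rule sets_lebesgue_inner_closed[OF Eb e])
      have "bounded T" by (rule bounded_subset[of "{-real n..real n}"]) (use T(2) in auto)
      then have cT: "compact T" using T(1) by (simp add: compact_eq_bounded_closed)
      have "measure lborel T = 0"
        by (rule lipschitz_oscillation_compact_null[OF lip cT ab]) (use T(2) up lo in auto)
      then have T0: "emeasure lborel T = 0"
        using emeasure_compact_finite[OF cT] by (simp add: emeasure_eq_ennreal_measure)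
      have "emeasure lborel ?E \<le> emeasure lborel T + emeasure lborel (?E - T)"
      proof -
        have "?E = T \<union> (?E - T)" using T(2) by blast
        then show ?thesis
          using emeasure_subadditive[of T lborel "?E - T"] E T(1) by simp
      qed
      also have "emeasure lborel (?E - T) = emeasure lebesgue (?E - T)"
        using E T(1) by (simp add: borel_closed)
      finally show ?thesis using T0 T(3) by simp
    qed
    have "emeasure lborel ?E \<le> 0" by (rule ennreal_le_epsilon) (rule *)
    then show ?thesis by simp
  qed
  have "(\<Union>n. E \<inter> {-real n..real n}) \<in> null_sets lborel"
    by (rule null_sets_UN) (use bdd E in \<open>auto simp: null_sets_def\<close>)
  moreover have "(\<Union>n. E \<inter> {-real n..real n}) = E"
  proof -
    have "x \<in> (\<Union>n. E \<inter> {-real n..real n})" if "x \<in> E" for x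
    proof -
      obtain n where "\<bar>x\<bar> \<le> real n" using real_arch_simple by blast
      then show ?thesis using that by (intro UN_I[of n]) auto
    qed
    then show ?thesis by blast
  qed
  ultimately show ?thesis by (simp add: null_sets_def)
qed

text \<open>Fubini without rotating \<open>v\<close> to a coordinate axis: the set of pairs
  \<open>(t, x)\<close> with \<open>t\<close> in \<open>{0..1}\<close> and
  \<open>x + t *\<^sub>R v \<in> A\<close> has translates of \<open>A\<close> as slices at fixed
  \<open>t\<close>, hence the measure of \<open>A\<close>, and subsets of the null line sections as
  slices at fixed \<open>x\<close>.\<close>

lemma null_if_null_on_lines:
  fixes A :: "'a::euclidean_space set" and v :: 'a
  assumes A: "A \<in> sets borel" and lines: "\<And>x. emeasure lborel {t::real. x + t *\<^sub>R v \<in> A} = 0"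
  shows "emeasure lborel A = 0"
proof -
  let ?X = "{z :: real \<times> 'a. snd z + fst z *\<^sub>R v \<in> A} \<inter> ({0..1} \<times> UNIV)"
  have [measurable]: "A \<in> sets borel" by fact
  have "(\<lambda>z :: real \<times> 'a. snd z + fst z *\<^sub>R v) \<in> borel \<rightarrow>\<^sub>M borel"
    by (intro borel_measurable_continuous_onI continuous_intros)
  then have "{z :: real \<times> 'a. snd z + fst z *\<^sub>R v \<in> A} \<in> sets borel"
    using A measurable_sets[of "\<lambda>z :: real \<times> 'a. snd z + fst z *\<^sub>R v" borel borel A] by (simp add: vimage_def)
  moreover have "({0..1::real} \<times> (UNIV::'a set)) \<in> sets borel"
    by (intro borel_closed closed_Times) auto
  ultimately have X: "?X \<in> sets (lborel \<Otimes>\<^sub>M lborel)"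
    by (metis (no_types, lifting) borel_prod lborel_prod sets.Int sets_lborel)
  have tr: "emeasure lborel {x. x + t *\<^sub>R v \<in> A} = emeasure lborel A" for t :: real
  proof -
    have "emeasure lborel A = emeasure (distr lborel borel ((+) (t *\<^sub>R v))) A"
      by (simp add: lborel_distr_plus)
    also have "\<dots> = emeasure lborel {x. x + t *\<^sub>R v \<in> A}"
      using A by (subst emeasure_distr) (auto simp: vimage_def add.commute)
    finally show ?thesis ..
  qed
  have "emeasure (lborel \<Otimes>\<^sub>M lborel) ?X = (\<integral>\<^sup>+t. emeasure lborel (Pair t -` ?X) \<partial>lborel)"
    by (rule lborel.emeasure_pair_measure_alt[OF X])
  also have "\<dots> = (\<integral>\<^sup>+t. emeasure lborel A * indicator {0..1} t \<partial>(lborel::real measure))"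
  proof (rule nn_integral_cong)
    fix t :: real
    have "Pair t -` ?X = (if t \<in> {0..1} then {x. x + t *\<^sub>R v \<in> A} else {})" by auto
    then show "emeasure lborel (Pair t -` ?X) = emeasure lborel A * indicator {0..1} t"
      by (auto simp: tr indicator_def)
  qed
  also have "\<dots> = emeasure lborel A" by (simp add: nn_integral_cmult_indicator)
  finally have 1: "emeasure (lborel \<Otimes>\<^sub>M lborel) ?X = emeasure lborel A" .
  have "emeasure (lborel \<Otimes>\<^sub>M lborel) ?X = (\<integral>\<^sup>+x. emeasure lborel ((\<lambda>t. (t, x)) -` ?X) \<partial>lborel)"
    by (rule lborel_pair.emeasure_pair_measure_alt2[OF X])
  also have "\<dots> = (\<integral>\<^sup>+x. 0 \<partial>(lborel::'a measure))"
  proof (rule nn_integral_cong)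
    fix x :: 'a
    have "{t::real. x + t *\<^sub>R v \<in> A} \<in> sets borel" by measurable
    then have "emeasure lborel ((\<lambda>t. (t, x)) -` ?X) \<le> emeasure lborel {t::real. x + t *\<^sub>R v \<in> A}"
      by (intro emeasure_mono) auto
    then show "emeasure lborel ((\<lambda>t. (t, x)) -` ?X) = 0" using lines[of x] by simp
  qed
  finally show ?thesis using 1 by simp
qed

section \<open>Rademacher's theorem\<close>

text \<open>Only \<open>t > 0\<close> is used because the one-dimensional oscillation lemma works
  with steps to the right. Reversed directions are recovered in \<open>rademacher\<close> from
  additivity.\<close>

definition has_right_derivative :: "('a::real_normed_vector \<Rightarrow> real) \<Rightarrow> 'a \<Rightarrow> 'a \<Rightarrow> real \<Rightarrow> bool" where
  "has_right_derivative f x v D \<longleftrightarrow> ((\<lambda>t. (f (x + t *\<^sub>R v) - f x) / t) \<longlongrightarrow> D) (at_right 0)"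

lemma has_right_derivative_unique:
  "has_right_derivative f x v D \<Longrightarrow> has_right_derivative f x v D' \<Longrightarrow> D = D'"
  unfolding has_right_derivative_def by (rule tendsto_unique[OF trivial_limit_at_right_real])

lemma has_right_derivative_minus:
  "has_right_derivative f x v D \<Longrightarrow> has_right_derivative (\<lambda>x. - f x) x v (- D)"
  unfolding has_right_derivative_def
  by (drule tendsto_minus) (simp add: minus_divide_left)

lemma has_right_derivative_scale:
  assumes "has_right_derivative f x v D" "q > 0"
  shows "has_right_derivative f x (q *\<^sub>R v) (q * D)"
proof -
  have "filterlim (\<lambda>t::real. q * t) (at_right 0) (at_right 0)"
    unfolding filterlim_at
  proof
    show "\<forall>\<^sub>F t in at_right 0. q * t \<in> {0<..} \<and> q * t \<noteq> 0"
      using eventually_at_right_less[of "0::real"] by eventually_elim (use assms(2) in simp)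
    have "((\<lambda>t. q * t) \<longlongrightarrow> q * 0) (at_right 0)" by (intro tendsto_intros)
    then show "((\<lambda>t. q * t) \<longlongrightarrow> 0) (at_right 0)" by simp
  qed
  then have "((\<lambda>t. (f (x + (q * t) *\<^sub>R v) - f x) / (q * t)) \<longlongrightarrow> D) (at_right 0)"
    using assms(1) unfolding has_right_derivative_def by (rule filterlim_compose[rotated])
  then have "((\<lambda>t. q * ((f (x + (q * t) *\<^sub>R v) - f x) / (q * t))) \<longlongrightarrow> q * D) (at_right 0)"
    by (intro tendsto_intros)
  then show ?thesis
    unfolding has_right_derivative_def using assms(2) by (simp add: mult.commute)
qed

lemma has_right_derivative_gt:
  assumes "has_right_derivative f x v D" "a < D"
  shows "\<exists>d>0. \<forall>t. 0 < t \<and> t < d \<longrightarrow> f (x + t *\<^sub>R v) - f x > a * t"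
proof -
  have "eventually (\<lambda>t. (f (x + t *\<^sub>R v) - f x) / t > a) (at_right 0)"
    using assms order_tendstoD(1) unfolding has_right_derivative_def by blast
  then obtain d where d: "d > 0" "\<And>t. t > 0 \<Longrightarrow> t < d \<Longrightarrow> (f (x + t *\<^sub>R v) - f x) / t > a"
    unfolding eventually_at_right_field by auto
  then show ?thesis by (intro exI[of _ d]) (auto simp: field_simps)
qed

lemma has_right_derivative_lt:
  assumes "has_right_derivative f x v D" "D < a"
  shows "\<exists>d>0. \<forall>t. 0 < t \<and> t < d \<longrightarrow> f (x + t *\<^sub>R v) - f x < a * t"
proof -
  obtain d where "d > 0" "\<forall>t. 0 < t \<and> t < d \<longrightarrow> - a * t < - f (x + t *\<^sub>R v) - - f x"
    using has_right_derivative_gt[OF has_right_derivative_minus[OF assms(1)], of "- a"] assms(2) by auto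
  then show ?thesis by (intro exI[of _ d]) force
qed

text \<open>Only the range of \<open>d\<close> has to be made countable: for fixed \<open>d\<close>
  the union over the uncountably many \<open>t\<close> is open.\<close>

lemma borel_frequently_gt_0:
  fixes \<phi> :: "real \<Rightarrow> 'a::topological_space \<Rightarrow> real"
  assumes "\<And>t. continuous_on UNIV (\<phi> t)"
  shows "{x. \<forall>d>0. \<exists>t>0. t < d \<and> \<phi> t x > 0} \<in> sets borel"
proof -
  have eq: "{x. \<forall>d>0. \<exists>t>0. t < d \<and> \<phi> t x > 0} =
      (\<Inter>n::nat. \<Union>t\<in>{0<..<1 / real (Suc n)}. {x. \<phi> t x > 0})" (is "?A = ?B")
  proof (intro equalityI subsetI)
    fix x assume "x \<in> ?B"
    show "x \<in> ?A"
    proof (intro CollectI allI impI)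
      fix d :: real assume "d > 0"
      then obtain n where n: "inverse (real (Suc n)) < d" using reals_Archimedean by blast
      obtain t where "t \<in> {0<..<1 / real (Suc n)}" "\<phi> t x > 0" using \<open>x \<in> ?B\<close> by blast
      then show "\<exists>t>0. t < d \<and> \<phi> t x > 0" using n by (intro exI[of _ t]) (auto simp: inverse_eq_divide)
    qed
  next
    fix x assume x: "x \<in> ?A"
    show "x \<in> ?B"
    proof
      fix n :: nat
      have "1 / real (Suc n) > 0" by simp
      then obtain t where "t > 0" "t < 1 / real (Suc n)" "\<phi> t x > 0" using x by blast
      then show "x \<in> (\<Union>t\<in>{0<..<1 / real (Suc n)}. {x. \<phi> t x > 0})" by auto
    qed
  qed
  have "open (\<Union>t\<in>{0<..<1 / real (Suc n)}. {x. \<phi> t x > 0})" for n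
    by (intro open_UN ballI open_Collect_less assms continuous_on_const)
  then show ?thesis unfolding eq by (intro sets.countable_INT) auto
qed

text \<open>The quotients are bounded by \<open>L * norm v\<close>, so failure to converge means
  oscillation across some rational gap \<open>\<alpha> < \<beta>\<close>. For each gap the
  exceptional set is Borel and null on every line of direction \<open>v\<close>.\<close>

lemma lipschitz_right_derivative_ae:
  fixes f :: "'a::euclidean_space \<Rightarrow> real"
  assumes lip: "L-lipschitz_on UNIV f"
  shows "\<exists>N\<in>null_sets lborel. \<forall>x. x \<notin> N \<longrightarrow> (\<exists>D. has_right_derivative f x v D)"
proof -
  have cf: "continuous_on UNIV f" by (rule lipschitz_on_continuous_on[OF lip])
  have cont: "continuous_on UNIV (\<lambda>x. f (x + t *\<^sub>R v))" for t
    by (rule continuous_on_compose2[OF cf]) (auto intro!: continuous_intros)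
  define Up where "Up \<beta> = {x. \<forall>d>0. \<exists>t>0. t < d \<and> f (x + t *\<^sub>R v) - f x - \<beta> * t > 0}" for \<beta>
  define Lo where "Lo \<alpha> = {x. \<forall>d>0. \<exists>t>0. t < d \<and> \<alpha> * t - (f (x + t *\<^sub>R v) - f x) > 0}" for \<alpha>
  have meas: "Up \<beta> \<in> sets borel" "Lo \<beta> \<in> sets borel" for \<beta>
    unfolding Up_def Lo_def by (intro borel_frequently_gt_0 continuous_intros cont cf)+
  define I where "I = {(\<alpha>, \<beta>). \<alpha> \<in> \<rat> \<and> \<beta> \<in> \<rat> \<and> \<alpha> < (\<beta>::real)}"
  define N where "N = (\<Union>(\<alpha>, \<beta>)\<in>I. Up \<beta> \<inter> Lo \<alpha>)"
  have cI: "countable I"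
    by (rule countable_subset[of _ "\<rat> \<times> \<rat>"]) (auto simp: I_def countable_rat)
  have null: "Up \<beta> \<inter> Lo \<alpha> \<in> null_sets lborel" if "\<alpha> < \<beta>" for \<alpha> \<beta>
  proof -
    have "emeasure lborel (Up \<beta> \<inter> Lo \<alpha>) = 0"
    proof (rule null_if_null_on_lines[of _ v])
      show b: "Up \<beta> \<inter> Lo \<alpha> \<in> sets borel" using meas by auto
      fix x
      define h where "h t = f (x + t *\<^sub>R v)" for t :: real
      have shift: "x + t *\<^sub>R v + s *\<^sub>R v = x + (t + s) *\<^sub>R v" for s t :: real
        by (simp add: algebra_simps)
      have "(L * norm v)-lipschitz_on UNIV h"
      proof (rule lipschitz_onI)
        fix s t :: real
        have "dist (h s) (h t) \<le> L * dist (x + s *\<^sub>R v) (x + t *\<^sub>R v)"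
          unfolding h_def by (rule lipschitz_onD[OF lip]) auto
        also have "dist (x + s *\<^sub>R v) (x + t *\<^sub>R v) = norm v * dist s t"
          by (simp add: dist_norm scaleR_diff_left[symmetric] dist_real_def)
        finally show "dist (h s) (h t) \<le> L * norm v * dist s t" by simp
      qed (use lipschitz_on_nonneg[OF lip] in simp)
      then show "emeasure lborel {t. x + t *\<^sub>R v \<in> Up \<beta> \<inter> Lo \<alpha>} = 0"
      proof (rule lipschitz_oscillation_null[OF _ _ that])
        show "{t. x + t *\<^sub>R v \<in> Up \<beta> \<inter> Lo \<alpha>} \<in> sets borel"
        proof -
          have "(\<lambda>t::real. x + t *\<^sub>R v) \<in> borel \<rightarrow>\<^sub>M borel"
            by (intro borel_measurable_continuous_onI continuous_intros)
          from measurable_sets[OF this b] show ?thesis by (simp add: vimage_def)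
        qed
        fix t d :: real assume t: "t \<in> {t. x + t *\<^sub>R v \<in> Up \<beta> \<inter> Lo \<alpha>}" and d: "d > 0"
        show "\<exists>s>0. s < d \<and> h (t + s) - h t > \<beta> * s"
          using t d unfolding Up_def h_def by (auto simp: shift)
        show "\<exists>s>0. s < d \<and> h (t + s) - h t < \<alpha> * s"
          using t d unfolding Lo_def h_def by (auto simp: shift)
      qed
    qed
    then show ?thesis using meas by auto
  qed
  have "N \<in> null_sets lborel"
    unfolding N_def by (rule null_sets_UN'[OF cI]) (auto simp: I_def null split: prod.splits)
  moreover have "\<exists>D. has_right_derivative f x v D" if x: "x \<notin> N" for x
  proof -
    define q where "q t = (f (x + t *\<^sub>R v) - f x) / t" for t
    have bd: "\<bar>q t\<bar> \<le> L * norm v" if "t > 0" for t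
      using lipschitz_onD[OF lip, of "x + t *\<^sub>R v" x] that
      by (simp add: q_def dist_norm field_simps)
    \<comment> \<open>\<open>S\<close> collects the eventual upper bounds of the quotients, so its
      infimum is their upper limit.\<close>
    define S where "S = {\<beta>. \<exists>d>0. \<forall>t. 0 < t \<and> t < d \<longrightarrow> q t \<le> \<beta>}"
    have "L * norm v \<in> S" unfolding S_def using bd by (auto intro!: exI[of _ 1] simp: abs_le_iff)
    moreover have lb: "- (L * norm v) \<le> \<beta>" if \<beta>: "\<beta> \<in> S" for \<beta>
    proof -
      obtain d where d: "d > 0" "\<forall>t. 0 < t \<and> t < d \<longrightarrow> q t \<le> \<beta>"
        using \<beta> unfolding S_def mem_Collect_eq by blast
      then have "q (d / 2) \<le> \<beta>" by simp
      then show ?thesis using bd[of "d/2"] d(1) by (simp add: abs_le_iff)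
    qed
    ultimately have ne: "S \<noteq> {}" by blast
    have bb: "bdd_below S" using lb by (rule bdd_belowI)
    define D where "D = Inf S"
    have "(q \<longlongrightarrow> D) (at_right 0)"
    proof (rule order_tendstoI)
      fix a assume "a < D"
      then obtain \<alpha> where \<alpha>: "\<alpha> \<in> \<rat>" "a < \<alpha>" "\<alpha> < D" using Rats_dense_in_real by blast
      then obtain \<beta> where \<beta>: "\<beta> \<in> \<rat>" "\<alpha> < \<beta>" "\<beta> < D" using Rats_dense_in_real by blast
      \<comment> \<open>A number below the upper limit is exceeded at arbitrarily small scales;
        since \<open>x \<notin> N\<close>, the quotients cannot also drop below
        \<open>\<alpha>\<close> at arbitrarily small scales.\<close>
      have "\<beta> \<notin> S" using \<beta>(3) cInf_lower[OF _ bb] by (force simp: D_def)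
      then have "x \<in> Up \<beta>"
        unfolding S_def Up_def q_def by (auto simp: not_le field_simps)
      then have "x \<notin> Lo \<alpha>" using x \<alpha> \<beta> by (auto simp: N_def I_def)
      then obtain d where d: "d > 0" "\<And>t. 0 < t \<Longrightarrow> t < d \<Longrightarrow> \<alpha> * t \<le> f (x + t *\<^sub>R v) - f x"
        unfolding Lo_def by (auto simp: not_less) (meson not_le)
      have "a < q t" if "0 < t" "t < d" for t
      proof -
        have "\<alpha> \<le> q t" using d(2)[OF that] that by (simp add: q_def pos_le_divide_eq)
        then show ?thesis using \<alpha>(2) by linarith
      qed
      then show "eventually (\<lambda>t. a < q t) (at_right 0)"
        unfolding eventually_at_right_field using d(1) by auto
    next
      fix a assume "D < a"
      then obtain \<beta> where "\<beta> \<in> S" "\<beta> < a" unfolding D_def using cInf_lessD[OF ne] by blast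
      then obtain d where "d > 0" "\<And>t. 0 < t \<Longrightarrow> t < d \<Longrightarrow> q t < a" unfolding S_def by force
      then show "eventually (\<lambda>t. q t < a) (at_right 0)"
        unfolding eventually_at_right_field by auto
    qed
    then show ?thesis unfolding has_right_derivative_def q_def by blast
  qed
  ultimately show ?thesis by blast
qed

text \<open>If \<open>f\<close> increases at rate at least \<open>a\<close> along \<open>v\<close> from both ends of \<open>[x, x + tv]\<close>, at rate at least \<open>b\<close> along
  \<open>w\<close>, but at rate less than \<open>a + b\<close> along \<open>v + w\<close>, all at a uniform scale, then following \<open>v\<close> and then \<open>w\<close>
  gives a contradiction.  So such points are isolated on every line of direction \<open>v\<close>.\<close>
lemma lipschitz_right_derivative_superadditive_ae:
  fixes f :: "'a::euclidean_space \<Rightarrow> real"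
  assumes cf: "continuous_on UNIV f"
  shows "\<exists>N\<in>null_sets lborel. \<forall>x a b c. x \<notin> N \<longrightarrow> has_right_derivative f x v a \<longrightarrow>
      has_right_derivative f x w b \<longrightarrow> has_right_derivative f x (v + w) c \<longrightarrow> a + b \<le> c"
proof -
  have cont: "continuous_on UNIV (\<lambda>x. f (x + t *\<^sub>R u))" for t u
    by (rule continuous_on_compose2[OF cf]) (auto intro!: continuous_intros)
  define E where "E = (\<lambda>(k::nat, a, b, s). {x. \<forall>t\<in>{0<..<1 / real (Suc k)}.
      a * t \<le> f (x + t *\<^sub>R v) - f x \<and> b * t \<le> f (x + t *\<^sub>R w) - f x \<and>
      f (x + t *\<^sub>R (v + w)) - f x \<le> s * t})"
  define I where "I = {(k::nat, a, b, s). a \<in> \<rat> \<and> b \<in> \<rat> \<and> s \<in> \<rat> \<and> s < a + (b::real)}"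
  have cI: "countable I"
    by (rule countable_subset[of _ "UNIV \<times> \<rat> \<times> \<rat> \<times> \<rat>"]) (auto simp: I_def countable_rat)
  have null: "E i \<in> null_sets lborel" if iI: "i \<in> I" for i
  proof -
    obtain k a b s where i: "i = (k, a, b, s)" and abs: "s < a + b"
      using iI unfolding I_def by blast
    have Ei: "E i = (\<Inter>t\<in>{0<..<1 / real (Suc k)}. {x. a * t \<le> f (x + t *\<^sub>R v) - f x}
        \<inter> {x. b * t \<le> f (x + t *\<^sub>R w) - f x} \<inter> {x. f (x + t *\<^sub>R (v + w)) - f x \<le> s * t})"
      by (auto simp: E_def i)
    have "closed (E i)"
      unfolding Ei by (intro closed_INT ballI closed_Int closed_Collect_le continuous_intros cont cf)
    then have b: "E i \<in> sets borel" by simp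
    have "emeasure lborel (E i) = 0"
    proof (rule null_if_null_on_lines[OF b, of v])
      fix x
      let ?T = "{t. x + t *\<^sub>R v \<in> E i}"
      have gap: "t' - t \<ge> 1 / real (Suc k)" if t: "t \<in> ?T" "t' \<in> ?T" "t < t'" for t t'
      proof (rule ccontr)
        assume "\<not> ?thesis"
        then have r: "t' - t \<in> {0<..<1 / real (Suc k)}" using t(3) by auto
        define r where "r = t' - t"
        have e: "x + t *\<^sub>R v + r *\<^sub>R v = x + t' *\<^sub>R v"
          "x + t *\<^sub>R v + r *\<^sub>R (v + w) = x + t' *\<^sub>R v + r *\<^sub>R w"
          by (simp_all add: r_def algebra_simps)
        have "a * r \<le> f (x + t *\<^sub>R v + r *\<^sub>R v) - f (x + t *\<^sub>R v)"
          "f (x + t *\<^sub>R v + r *\<^sub>R (v + w)) - f (x + t *\<^sub>R v) \<le> s * r"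
          using t(1) r unfolding E_def i r_def by auto
        moreover have "b * r \<le> f (x + t' *\<^sub>R v + r *\<^sub>R w) - f (x + t' *\<^sub>R v)"
          using t(2) r unfolding E_def i r_def by auto
        ultimately have "a * r + b * r \<le> s * r" unfolding e by linarith
        then have "(a + b) * r \<le> s * r" by (simp add: algebra_simps)
        then show False using abs r by (simp add: r_def mult_le_cancel_right)
      qed
      have "inj_on (\<lambda>t. \<lfloor>t * real (Suc k)\<rfloor>) ?T"
      proof (rule linorder_inj_onI')
        fix t t' assume "t \<in> ?T" "t' \<in> ?T" "t < t'"
        then have "t * real (Suc k) + 1 \<le> t' * real (Suc k)"
          using gap[of t t'] by (simp add: field_simps)
        then show "\<lfloor>t * real (Suc k)\<rfloor> \<noteq> \<lfloor>t' * real (Suc k)\<rfloor>" by linarith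
      qed
      then have "countable ?T" by (rule countableI')
      then show "emeasure lborel ?T = 0" by (rule emeasure_lborel_countable)
    qed
    then show ?thesis using b by auto
  qed
  define N where "N = (\<Union>i\<in>I. E i)"
  have "N \<in> null_sets lborel" unfolding N_def by (rule null_sets_UN'[OF cI]) (rule null)
  moreover have "a + b \<le> c"
    if x: "x \<notin> N" and d: "has_right_derivative f x v a" "has_right_derivative f x w b"
      "has_right_derivative f x (v + w) c" for x a b c
  proof (rule ccontr)
    assume "\<not> ?thesis"
    then have pos: "(a + b - c) / 3 > 0" by simp
    \<comment> \<open>A third of the deficit: then
      \<open>s < c + e = a + b - 2 * e < a' + b'\<close>, which leaves room for rational
      replacements of all three rates.\<close>
    define e where "e = (a + b - c) / 3"
    have e: "e > 0" "c = a + b - 3 * e" using pos by (auto simp: e_def field_simps)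
    obtain a' where a': "a' \<in> \<rat>" "a - e < a'" "a' < a" using Rats_dense_in_real[of "a - e" a] e by auto
    obtain b' where b': "b' \<in> \<rat>" "b - e < b'" "b' < b" using Rats_dense_in_real[of "b - e" b] e by auto
    obtain s where s: "s \<in> \<rat>" "c < s" "s < c + e" using Rats_dense_in_real[of c "c + e"] e by auto
    obtain d1 where d1: "d1 > 0" "\<And>t. 0 < t \<and> t < d1 \<Longrightarrow> f (x + t *\<^sub>R v) - f x > a' * t"
      using has_right_derivative_gt[OF d(1) a'(3)] by blast
    obtain d2 where d2: "d2 > 0" "\<And>t. 0 < t \<and> t < d2 \<Longrightarrow> f (x + t *\<^sub>R w) - f x > b' * t"
      using has_right_derivative_gt[OF d(2) b'(3)] by blast
    obtain d3 where d3: "d3 > 0" "\<And>t. 0 < t \<and> t < d3 \<Longrightarrow> f (x + t *\<^sub>R (v + w)) - f x < s * t"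
      using has_right_derivative_lt[OF d(3) s(2)] by blast
    have "min d1 (min d2 d3) > 0" using d1 d2 d3 by simp
    then obtain k where k: "inverse (real (Suc k)) < min d1 (min d2 d3)" using reals_Archimedean by blast
    have "x \<in> E (k, a', b', s)"
      unfolding E_def using d1(2) d2(2) d3(2) k by (auto simp: inverse_eq_divide intro!: less_imp_le)
    moreover have "(k, a', b', s) \<in> I" unfolding I_def using a' b' s e(2) by auto
    ultimately show False using x by (auto simp: N_def)
  qed
  ultimately show ?thesis by blast
qed

lemma lipschitz_right_derivative_add_ae:
  fixes f :: "'a::euclidean_space \<Rightarrow> real"
  assumes cf: "continuous_on UNIV f"
  shows "\<exists>N\<in>null_sets lborel. \<forall>x a b c. x \<notin> N \<longrightarrow> has_right_derivative f x v a \<longrightarrow>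
      has_right_derivative f x w b \<longrightarrow> has_right_derivative f x (v + w) c \<longrightarrow> c = a + b"
proof -
  obtain N where N: "N \<in> null_sets lborel" "\<And>x a b c. x \<notin> N \<Longrightarrow> has_right_derivative f x v a \<Longrightarrow>
      has_right_derivative f x w b \<Longrightarrow> has_right_derivative f x (v + w) c \<Longrightarrow> a + b \<le> c"
    using lipschitz_right_derivative_superadditive_ae[OF cf, of v w] by blast
  have "continuous_on UNIV (\<lambda>x. - f x)" using cf by (intro continuous_intros)
  then obtain N' where N': "N' \<in> null_sets lborel" "\<And>x a b c. x \<notin> N' \<Longrightarrow>
      has_right_derivative (\<lambda>x. - f x) x v a \<Longrightarrow> has_right_derivative (\<lambda>x. - f x) x w b \<Longrightarrow>
      has_right_derivative (\<lambda>x. - f x) x (v + w) c \<Longrightarrow> a + b \<le> c"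
    using lipschitz_right_derivative_superadditive_ae[of "\<lambda>x. - f x" v w] by blast
  show ?thesis
  proof (intro bexI[of _ "N \<union> N'"] allI impI)
    fix x a b c assume x: "x \<notin> N \<union> N'" and d: "has_right_derivative f x v a"
      "has_right_derivative f x w b" "has_right_derivative f x (v + w) c"
    have "a + b \<le> c" using N(2) x d by blast
    moreover have "- a + - b \<le> - c"
      using N'(2)[of x] x d[THEN has_right_derivative_minus] by blast
    ultimately show "c = a + b" by linarith
  qed (use N N' in auto)
qed

text \<open>Outside one null set the right derivatives \<open>G\<close> along the countable set
  \<open>V\<close> of vectors with rational coordinates exist and are additive, hence
  rational-linear, and so they determine a linear \<open>f'\<close>. Compactness of the sphere and
  the Lipschitz bound carry the estimate from finitely many directions in \<open>V\<close> to all
  directions uniformly.\<close>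

theorem rademacher:
  fixes f :: "'a::euclidean_space \<Rightarrow> real"
  assumes lip: "L-lipschitz_on UNIV f"
  shows "\<exists>N\<in>null_sets lborel. \<forall>x. x \<notin> N \<longrightarrow> f differentiable (at x)"
proof -
  have cf: "continuous_on UNIV f" by (rule lipschitz_on_continuous_on[OF lip])
  have L0: "L \<ge> 0" by (rule lipschitz_on_nonneg[OF lip])
  define V where "V = {v::'a. \<forall>b\<in>Basis. v \<bullet> b \<in> \<rat>}"
  have cV: "countable V"
  proof -
    have "v \<in> (\<lambda>q. \<Sum>b\<in>Basis. q b *\<^sub>R b) ` (Basis \<rightarrow>\<^sub>E \<rat>)" if "v \<in> V" for v
    proof (rule image_eqI[of _ _ "restrict (\<lambda>b. v \<bullet> b) Basis"])
      show "v = (\<Sum>b\<in>Basis. restrict (\<lambda>b. v \<bullet> b) Basis b *\<^sub>R b)"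
        by (simp add: euclidean_representation)
    qed (use that in \<open>auto simp: V_def\<close>)
    then have "V \<subseteq> (\<lambda>q. \<Sum>b\<in>Basis. q b *\<^sub>R b) ` (Basis \<rightarrow>\<^sub>E \<rat>)" by blast
    moreover have "countable (Basis \<rightarrow>\<^sub>E (\<rat>::real set) :: ('a \<Rightarrow> real) set)"
      by (rule countable_PiE) (auto simp: countable_rat)
    ultimately show ?thesis by (meson countable_image countable_subset)
  qed
  have V_dense: "\<exists>v\<in>V. dist u v < \<eta>" if "\<eta> > 0" for u :: 'a and \<eta>
  proof -
    define \<delta> where "\<delta> = \<eta> / real DIM('a)"
    have "\<delta> > 0" using that by (simp add: \<delta>_def)
    then have "\<forall>b. \<exists>q\<in>\<rat>. u \<bullet> b - \<delta> < q \<and> q < u \<bullet> b"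
      using Rats_dense_in_real by (metis diff_less_eq less_add_same_cancel1)
    then obtain q where q: "\<And>b. q b \<in> \<rat>" "\<And>b. u \<bullet> b - \<delta> < q b" "\<And>b. q b < u \<bullet> b" by metis
    define v where "v = (\<Sum>b\<in>Basis. q b *\<^sub>R b)"
    have vb: "v \<bullet> b = q b" if "b \<in> Basis" for b using that by (simp add: v_def)
    have "norm (u - v) \<le> (\<Sum>b\<in>Basis. \<bar>(u - v) \<bullet> b\<bar>)" by (rule norm_le_l1)
    also have "\<dots> < (\<Sum>b\<in>(Basis::'a set). \<delta>)"
    proof (rule sum_strict_mono)
      fix b :: 'a assume "b \<in> Basis"
      then show "\<bar>(u - v) \<bullet> b\<bar> < \<delta>" using q(2,3)[of b] by (simp add: inner_diff_left vb)
    qed auto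
    also have "\<dots> = \<eta>" by (simp add: \<delta>_def)
    finally have "dist u v < \<eta>" by (simp add: dist_norm)
    then show ?thesis using q(1) by (intro bexI[of _ v]) (auto simp: V_def vb)
  qed
  have V_add: "v + w \<in> V" if "v \<in> V" "w \<in> V" for v w using that by (auto simp: V_def inner_add_left)
  have V_scale: "q *\<^sub>R v \<in> V" if "v \<in> V" "q \<in> \<rat>" for v q using that by (auto simp: V_def)
  have V_Basis: "b \<in> V" if "b \<in> Basis" for b using that by (auto simp: V_def inner_Basis)
  have "\<forall>v. \<exists>N. N \<in> null_sets lborel \<and> (\<forall>x. x \<notin> N \<longrightarrow> (\<exists>D. has_right_derivative f x v D))"
    using lipschitz_right_derivative_ae[OF lip] by blast
  then obtain N1 where N1: "\<And>v. N1 v \<in> null_sets lborel"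
    "\<And>v x. x \<notin> N1 v \<Longrightarrow> \<exists>D. has_right_derivative f x v D" by metis
  have "\<forall>p. \<exists>N. N \<in> null_sets lborel \<and> (\<forall>x a b c. x \<notin> N \<longrightarrow> has_right_derivative f x (fst p) a \<longrightarrow>
      has_right_derivative f x (snd p) b \<longrightarrow> has_right_derivative f x (fst p + snd p) c \<longrightarrow> c = a + b)"
  proof
    fix p
    show "\<exists>N. N \<in> null_sets lborel \<and> (\<forall>x a b c. x \<notin> N \<longrightarrow> has_right_derivative f x (fst p) a \<longrightarrow>
      has_right_derivative f x (snd p) b \<longrightarrow> has_right_derivative f x (fst p + snd p) c \<longrightarrow> c = a + b)"
      using lipschitz_right_derivative_add_ae[OF cf, of "fst p" "snd p"] unfolding Bex_def .
  qed
  then obtain N2 where N2: "\<And>p. N2 p \<in> null_sets lborel"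
    "\<And>p x a b c. x \<notin> N2 p \<Longrightarrow> has_right_derivative f x (fst p) a \<Longrightarrow>
      has_right_derivative f x (snd p) b \<Longrightarrow> has_right_derivative f x (fst p + snd p) c \<Longrightarrow> c = a + b"
    by metis
  define N where "N = (\<Union>v\<in>V. N1 v) \<union> (\<Union>p\<in>V \<times> V. N2 p)"
  have "(\<Union>v\<in>V. N1 v) \<in> null_sets lborel" by (rule null_sets_UN'[OF cV]) (rule N1)
  moreover have "(\<Union>p\<in>V \<times> V. N2 p) \<in> null_sets lborel"
    by (rule null_sets_UN') (auto simp: cV N2)
  ultimately have "N \<in> null_sets lborel" unfolding N_def by (rule null_sets.Un)
  moreover have "f differentiable (at x)" if x: "x \<notin> N" for x
  proof -
    have "\<forall>v\<in>V. \<exists>D. has_right_derivative f x v D" using x N1(2) by (auto simp: N_def)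
    then obtain G where G: "\<And>v. v \<in> V \<Longrightarrow> has_right_derivative f x v (G v)" by metis
    have Gadd: "G (v + w) = G v + G w" if "v \<in> V" "w \<in> V" for v w
      using N2(2)[of x "(v, w)" "G v" "G w" "G (v + w)"] G that V_add x by (auto simp: N_def)
    have V0: "0 \<in> V" by (simp add: V_def)
    have G0: "G 0 = 0" using Gadd[OF V0 V0] by simp
    have Gpos: "G (q *\<^sub>R v) = q * G v" if "v \<in> V" "q \<in> \<rat>" "q > 0" for q v
      using has_right_derivative_unique[OF G[OF V_scale[OF that(1,2)]] has_right_derivative_scale[OF G[OF that(1)] that(3)]] .
    have Gscale: "G (q *\<^sub>R v) = q * G v" if "v \<in> V" "q \<in> \<rat>" for q v
    proof (cases q "0::real" rule: linorder_cases)
      case less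
      \<comment> \<open>Right derivatives scale only under positive factors; the sign comes from
        additivity and \<open>G 0 = 0\<close>.\<close>
      have "G (q *\<^sub>R v + (- q) *\<^sub>R v) = G (q *\<^sub>R v) + G ((- q) *\<^sub>R v)"
        by (rule Gadd) (use that in \<open>auto intro!: V_scale simp del: scaleR_minus_left\<close>)
      moreover have "q *\<^sub>R v + (- q) *\<^sub>R v = 0" by simp
      moreover have "G ((- q) *\<^sub>R v) = (- q) * G v" by (rule Gpos) (use that less in auto)
      ultimately show ?thesis using G0 by simp
    qed (use that G0 Gpos in auto)
    define f' where "f' h = (\<Sum>b\<in>Basis. (h \<bullet> b) * G b)" for h
    have f'V: "f' v = G v" if v: "v \<in> V" for v
    proof -
      have "(\<Sum>b\<in>B. (v \<bullet> b) *\<^sub>R b) \<in> V \<and> G (\<Sum>b\<in>B. (v \<bullet> b) *\<^sub>R b) = (\<Sum>b\<in>B. (v \<bullet> b) * G b)"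
        if "finite B" "B \<subseteq> Basis" for B
        using that
      proof (induction B rule: finite_induct)
        case (insert b B)
        have "(v \<bullet> b) *\<^sub>R b \<in> V" using insert.prems v by (intro V_scale V_Basis) (auto simp: V_def)
        moreover have "G ((v \<bullet> b) *\<^sub>R b) = (v \<bullet> b) * G b"
          using insert.prems v by (intro Gscale V_Basis) (auto simp: V_def)
        ultimately show ?case using insert by (auto simp: V_add Gadd)
      qed (simp add: V0 G0)
      from this[of Basis] show ?thesis by (simp add: f'_def euclidean_representation)
    qed
    have bl: "bounded_linear f'"
      unfolding f'_def by (intro bounded_linear_sum bounded_linear_mult_left[THEN bounded_linear_compose] bounded_linear_inner_left)
    obtain M where M: "M \<ge> 0" "\<And>h. \<bar>f' h\<bar> \<le> norm h * M"
      using bounded_linear.nonneg_bounded[OF bl] by (auto simp: real_norm_def)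
    have "(f has_derivative f') (at x)"
      unfolding has_derivative_at_alt
    proof (intro conjI allI impI bl)
      fix e :: real assume e: "e > 0"
      \<comment> \<open>Replacing a unit direction by one at distance below \<open>\<eta>\<close>
        changes \<open>f\<close> and \<open>f'\<close> at scale \<open>t\<close> by at most
        \<open>L * t * \<eta>\<close> and \<open>M * t * \<eta>\<close>, together at most
        \<open>e / 2 * t\<close>. The added 1 keeps the denominator positive.\<close>
      define \<eta> where "\<eta> = e / (2 * (L + M + 1))"
      have \<eta>: "\<eta> > 0" "(L + M) * \<eta> \<le> e / 2" using e L0 M(1) by (auto simp: \<eta>_def field_simps)
      have "sphere (0::'a) 1 \<subseteq> (\<Union>v\<in>V. ball v \<eta>)"
        using V_dense[OF \<eta>(1)] by (auto simp: dist_commute)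
      then obtain W where W: "W \<subseteq> V" "finite W" "sphere (0::'a) 1 \<subseteq> (\<Union>v\<in>W. ball v \<eta>)"
        using compactE_image[OF compact_sphere, of V "\<lambda>v. ball v \<eta>" 0 1] by (metis open_ball)
      have "\<exists>d>0. \<forall>t. 0 < t \<and> t < d \<longrightarrow> \<bar>f (x + t *\<^sub>R w) - f x - t * f' w\<bar> \<le> e / 2 * t" if "w \<in> W" for w
      proof -
        have w: "has_right_derivative f x w (f' w)" using that G f'V W(1) by auto
        obtain d1 where d1: "d1 > 0" "\<And>t. 0 < t \<and> t < d1 \<Longrightarrow> f (x + t *\<^sub>R w) - f x > (f' w - e / 2) * t"
          using has_right_derivative_gt[OF w, of "f' w - e / 2"] e by auto
        obtain d2 where d2: "d2 > 0" "\<And>t. 0 < t \<and> t < d2 \<Longrightarrow> f (x + t *\<^sub>R w) - f x < (f' w + e / 2) * t"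
          using has_right_derivative_lt[OF w, of "f' w + e / 2"] e by auto
        show ?thesis
        proof (intro exI[of _ "min d1 d2"] conjI allI impI)
          fix t assume "0 < t \<and> t < min d1 d2"
          then show "\<bar>f (x + t *\<^sub>R w) - f x - t * f' w\<bar> \<le> e / 2 * t"
            using d1(2)[of t] d2(2)[of t] unfolding abs_le_iff by (auto simp: algebra_simps)
        qed (use d1 d2 in auto)
      qed
      then obtain d where d: "\<And>w. w \<in> W \<Longrightarrow> d w > 0"
        "\<And>w t. w \<in> W \<Longrightarrow> 0 < t \<Longrightarrow> t < d w \<Longrightarrow> \<bar>f (x + t *\<^sub>R w) - f x - t * f' w\<bar> \<le> e / 2 * t"
        by metis
      \<comment> \<open>The inserted 1 keeps the set under \<open>Min\<close> nonempty.\<close>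
      define d0 where "d0 = Min (insert 1 (d ` W))"
      have d0: "d0 > 0" "\<And>w. w \<in> W \<Longrightarrow> d0 \<le> d w" using W(2) d(1) by (auto simp: d0_def)
      show "\<exists>d>0. \<forall>y. norm (y - x) < d \<longrightarrow> norm (f y - f x - f' (y - x)) \<le> e * norm (y - x)"
      proof (intro exI[of _ d0] conjI allI impI d0(1))
        fix y assume y: "norm (y - x) < d0"
        show "norm (f y - f x - f' (y - x)) \<le> e * norm (y - x)"
        proof (cases "y = x")
          case True
          then show ?thesis by (simp add: f'_def)
        next
          case False
          define t where "t = norm (y - x)"
          define u where "u = (1 / t) *\<^sub>R (y - x)"
          have t: "t > 0" using False by (simp add: t_def)
          have u: "norm u = 1" "y = x + t *\<^sub>R u" using t by (auto simp: u_def t_def)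
          then obtain w where w: "w \<in> W" "dist w u < \<eta>" using W(3) by (auto simp: subset_iff)
          have "\<bar>f y - f (x + t *\<^sub>R w)\<bar> \<le> L * dist y (x + t *\<^sub>R w)"
            using lipschitz_onD[OF lip, of y "x + t *\<^sub>R w"] by (simp add: dist_real_def)
          also have "dist y (x + t *\<^sub>R w) = t * dist w u"
            using t by (simp add: u(2) dist_norm scaleR_diff_right[symmetric] norm_minus_commute)
          also have "L * (t * dist w u) \<le> L * (t * \<eta>)"
            using w t L0 by (intro mult_left_mono) auto
          finally have 1: "\<bar>f y - f (x + t *\<^sub>R w)\<bar> \<le> L * (t * \<eta>)" .
          have "f' (y - x) - t * f' w = f' (t *\<^sub>R (u - w))"
            using u(2) by (simp add: linear_diff[OF bounded_linear.linear[OF bl]] linear_scale[OF bounded_linear.linear[OF bl]] right_diff_distrib)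
          then have "\<bar>f' (y - x) - t * f' w\<bar> \<le> norm (t *\<^sub>R (u - w)) * M" using M(2) by metis
          also have "\<dots> = t * dist w u * M" using t by (simp add: dist_norm norm_minus_commute)
          also have "\<dots> \<le> t * \<eta> * M" using w t M by (intro mult_right_mono mult_left_mono) auto
          finally have 2: "\<bar>f' (y - x) - t * f' w\<bar> \<le> M * (t * \<eta>)" by (simp add: algebra_simps)
          have 3: "\<bar>f (x + t *\<^sub>R w) - f x - t * f' w\<bar> \<le> e / 2 * t"
            using d(2)[OF w(1) t] d0(2)[OF w(1)] y by (simp add: t_def)
          have "\<bar>f y - f x - f' (y - x)\<bar> \<le> L * (t * \<eta>) + M * (t * \<eta>) + e / 2 * t"
            using 1 2 3 by linarith
          also have "\<dots> = ((L + M) * \<eta>) * t + e / 2 * t" by (simp add: algebra_simps)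
          also have "\<dots> \<le> e / 2 * t + e / 2 * t" using \<eta>(2) t by (intro add_mono mult_right_mono) auto
          finally show ?thesis by (simp add: t_def)
        qed
      qed
    qed
    then show ?thesis by (auto simp: differentiable_def)
  qed
  ultimately show ?thesis by blast
qed

section \<open>Partial derivatives and smoothness classes\<close>

text \<open>\<open>partial\<close> rests on the total operator \<open>deriv\<close>, whose value
  carries no information where the derivative fails to exist. This relation records existence as
  well.\<close>

definition has_partial :: "'n::finite \<Rightarrow> (real^'n \<Rightarrow> real) \<Rightarrow> real^'n \<Rightarrow> real \<Rightarrow> bool" where
  "has_partial i f x d \<longleftrightarrow> ((\<lambda>t. f (x + t *\<^sub>R axis i 1)) has_real_derivative d) (at 0)"

lemma has_partial_imp_partial: "has_partial i f x d \<Longrightarrow> partial i f x = d"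
  unfolding has_partial_def partial_def by (rule DERIV_imp_deriv)

lemma has_partial_iff_differentiable:
  "(\<lambda>t. f (x + t *\<^sub>R axis i 1)) differentiable (at 0) \<longleftrightarrow> has_partial i f x (partial i f x)"
  unfolding has_partial_def partial_def by (simp add: DERIV_deriv_iff_real_differentiable)

lemma eventually_axis_line:
  fixes x :: "real^'n::finite"
  assumes "open V" "x \<in> V"
  shows "\<forall>\<^sub>F t in nhds 0. x + t *\<^sub>R axis i 1 \<in> V"
proof -
  have "open ((\<lambda>t::real. x + t *\<^sub>R axis i 1) -` V)"
    by (rule open_vimage[OF assms(1)]) (intro continuous_intros)
  from eventually_nhds_in_open[OF this, of 0] assms(2) show ?thesis by simp
qed

lemma has_partial_cong:
  assumes "open V" "x \<in> V" "\<And>y. y \<in> V \<Longrightarrow> f y = g y"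
  shows "has_partial i f x d \<longleftrightarrow> has_partial i g x d"
  unfolding has_partial_def
  by (rule DERIV_cong_ev) (use eventually_axis_line[OF assms(1,2), of i] assms(3) in \<open>auto elim: eventually_mono\<close>)

lemma partial_cong:
  assumes "open V" "x \<in> V" "\<And>y. y \<in> V \<Longrightarrow> f y = g y"
  shows "partial i f x = partial i g x"
  unfolding partial_def
  by (rule deriv_cong_ev) (use eventually_axis_line[OF assms(1,2), of i] assms(3) in \<open>auto elim: eventually_mono\<close>)

lemma Ck_Suc_iff: "Ck (Suc k) U f \<longleftrightarrow> continuous_on U f \<and>
    (\<forall>i. \<forall>x\<in>U. has_partial i f x (partial i f x)) \<and> (\<forall>i. Ck k U (partial i f))"
  by (simp add: has_partial_iff_differentiable)

declare Ck.simps(2) [simp del]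

lemma Ck_cong:
  assumes "open U" "\<And>y. y \<in> U \<Longrightarrow> f y = g y"
  shows "Ck k U f \<longleftrightarrow> Ck k U g"
  using assms(2)
proof (induction k arbitrary: f g)
  case 0
  then show ?case by (simp cong: continuous_on_cong)
next
  case (Suc k)
  have c: "continuous_on U f \<longleftrightarrow> continuous_on U g" using Suc.prems by (simp cong: continuous_on_cong)
  have p: "partial i f x = partial i g x" if "x \<in> U" for i x
    using partial_cong[OF assms(1) that Suc.prems] .
  have h: "has_partial i f x d \<longleftrightarrow> has_partial i g x d" if "x \<in> U" for i x d
    by (rule has_partial_cong[OF assms(1) that Suc.prems])
  have "Ck k U (partial i f) \<longleftrightarrow> Ck k U (partial i g)" for i
    by (rule Suc.IH) (rule p)
  then show ?case unfolding Ck_Suc_iff using c p h by auto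
qed

lemma Ck_SucI:
  assumes "open U" "continuous_on U f" "\<And>i x. x \<in> U \<Longrightarrow> has_partial i f x (d i x)" "\<And>i. Ck k U (d i)"
  shows "Ck (Suc k) U f"
proof -
  have "Ck k U (partial i f)" for i
    using assms(4)[of i] has_partial_imp_partial[OF assms(3)] Ck_cong[OF assms(1), of "partial i f" "d i"] by simp
  then show ?thesis unfolding Ck_Suc_iff using assms(2,3) has_partial_imp_partial[OF assms(3)] by auto
qed

lemma Ck_SucD: "Ck (Suc k) U f \<Longrightarrow> Ck k U f"
proof (induction k arbitrary: f)
  case 0
  then show ?case by (simp add: Ck_Suc_iff)
next
  case (Suc k)
  then show ?case using Ck_Suc_iff[of "Suc k" U f] Ck_Suc_iff[of k U f] by blast
qed

lemma Ck_imp_continuous: "Ck k U f \<Longrightarrow> continuous_on U f"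
  by (cases k) (auto simp: Ck_Suc_iff)

lemma Ck_subset: "Ck k U f \<Longrightarrow> V \<subseteq> U \<Longrightarrow> Ck k V f"
proof (induction k arbitrary: f)
  case 0
  then show ?case by (simp add: continuous_on_subset)
next
  case (Suc k)
  then show ?case unfolding Ck_Suc_iff using continuous_on_subset by blast
qed

section \<open>Closure of the differentiability classes under algebraic operations\<close>

lemma has_partial_const: "has_partial i (\<lambda>x. c) x 0"
  unfolding has_partial_def by simp

lemma has_partial_add:
  "has_partial i f x a \<Longrightarrow> has_partial i g x b \<Longrightarrow> has_partial i (\<lambda>x. f x + g x) x (a + b)"
  unfolding has_partial_def by (rule DERIV_add)

lemma has_partial_mult:
  "has_partial i f x a \<Longrightarrow> has_partial i g x b \<Longrightarrow> has_partial i (\<lambda>x. f x * g x) x (a * g x + f x * b)"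
  unfolding has_partial_def by (auto intro!: derivative_eq_intros)

lemma has_partial_chain:
  "has_partial i f x a \<Longrightarrow> (h has_real_derivative b) (at (f x)) \<Longrightarrow> has_partial i (\<lambda>x. h (f x)) x (b * a)"
  unfolding has_partial_def by (rule DERIV_chain2[where g="\<lambda>t. f (x + t *\<^sub>R axis i 1)"]) auto

lemma Ck_const: "open U \<Longrightarrow> Ck k U (\<lambda>x. c)"
proof (induction k arbitrary: c)
  case (Suc k)
  show ?case by (rule Ck_SucI[where d="\<lambda>_ _. 0"]) (use Suc in \<open>auto intro: has_partial_const\<close>)
qed simp

lemma Ck_add:
  assumes U: "open U" shows "Ck k U f \<Longrightarrow> Ck k U g \<Longrightarrow> Ck k U (\<lambda>x. f x + g x)"
proof (induction k arbitrary: f g)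
  case (Suc k)
  show ?case
    by (rule Ck_SucI[OF U, where d="\<lambda>i x. partial i f x + partial i g x"])
      (use Suc in \<open>auto simp: Ck_Suc_iff intro!: continuous_intros has_partial_add\<close>)
qed (auto intro: continuous_intros)

lemma Ck_mult:
  assumes U: "open U" shows "Ck k U f \<Longrightarrow> Ck k U g \<Longrightarrow> Ck k U (\<lambda>x. f x * g x)"
proof (induction k arbitrary: f g)
  case (Suc k)
  show ?case
    by (rule Ck_SucI[OF U, where d="\<lambda>i x. partial i f x * g x + f x * partial i g x"])
      (use Suc Ck_SucD[OF Suc.prems(1)] Ck_SucD[OF Suc.prems(2)] in
        \<open>auto simp: Ck_Suc_iff intro!: continuous_intros has_partial_mult Ck_add U\<close>)
qed (auto intro: continuous_intros)

lemma Ck_cmult: "open U \<Longrightarrow> Ck k U f \<Longrightarrow> Ck k U (\<lambda>x. c * f x)"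
  by (intro Ck_mult Ck_const)

lemma Ck_minus: "open U \<Longrightarrow> Ck k U f \<Longrightarrow> Ck k U (\<lambda>x. - f x)"
  using Ck_cmult[of U k f "-1"] by simp

lemma Ck_diff: "open U \<Longrightarrow> Ck k U f \<Longrightarrow> Ck k U g \<Longrightarrow> Ck k U (\<lambda>x. f x - g x)"
  using Ck_add[of U k f "\<lambda>x. - g x"] Ck_minus[of U k g] by simp

lemma Ck_sum: "open U \<Longrightarrow> (\<And>a. a \<in> A \<Longrightarrow> Ck k U (f a)) \<Longrightarrow> Ck k U (\<lambda>x. \<Sum>a\<in>A. f a x)"
  by (induction A rule: infinite_finite_induct) (auto intro: Ck_const Ck_add)

lemma Ck_inverse:
  assumes U: "open U" shows "Ck k U f \<Longrightarrow> (\<And>x. x \<in> U \<Longrightarrow> f x \<noteq> 0) \<Longrightarrow> Ck k U (\<lambda>x. inverse (f x))"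
proof (induction k arbitrary: f)
  case (Suc k)
  show ?case
  proof (rule Ck_SucI[OF U, where d="\<lambda>i x. - (inverse (f x) * inverse (f x)) * partial i f x"])
    fix i x assume "x \<in> U"
    then show "has_partial i (\<lambda>x. inverse (f x)) x (- (inverse (f x) * inverse (f x)) * partial i f x)"
      using Suc.prems by (intro has_partial_chain DERIV_inverse'[OF DERIV_ident, THEN DERIV_cong]) (auto simp: Ck_Suc_iff)
  qed (use Suc Ck_SucD[OF Suc.prems(1)] in
        \<open>auto simp: Ck_Suc_iff intro!: continuous_intros Ck_mult Ck_minus U\<close>)
qed (auto intro: continuous_intros)

lemma Ck_ln:
  assumes U: "open U" and f: "Ck k U f" and pos: "\<And>x. x \<in> U \<Longrightarrow> f x > 0"
  shows "Ck k U (\<lambda>x. ln (f x))"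
proof (cases k)
  case 0
  have "\<forall>x\<in>U. f x \<noteq> 0" using pos by force
  with 0 f show ?thesis by (auto intro!: continuous_on_ln)
next
  case (Suc k')
  have nz: "f x \<noteq> 0" if "x \<in> U" for x using pos[OF that] by simp
  show ?thesis unfolding Suc
  proof (rule Ck_SucI[OF U, where d="\<lambda>i x. inverse (f x) * partial i f x"])
    show "continuous_on U (\<lambda>x. ln (f x))"
      using f nz by (intro continuous_on_ln) (auto dest: Ck_imp_continuous)
    show "Ck k' U (\<lambda>x. inverse (f x) * partial i f x)" for i
      using f Ck_SucD[of k' U f] unfolding Suc by (intro Ck_mult U Ck_inverse nz) (auto simp: Ck_Suc_iff)
    fix i x assume "x \<in> U"
    then show "has_partial i (\<lambda>x. ln (f x)) x (inverse (f x) * partial i f x)"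
      using f pos unfolding Suc by (intro has_partial_chain DERIV_ln) (auto simp: Ck_Suc_iff)
  qed
qed

lemma has_derivative_imp_line:
  fixes f :: "'a::real_normed_vector \<Rightarrow> real"
  assumes "(f has_derivative f') (at x)"
  shows "((\<lambda>t. f (x + t *\<^sub>R h)) has_real_derivative f' h) (at 0)"
proof -
  have "((\<lambda>t. x + t *\<^sub>R h) has_derivative (\<lambda>t. t *\<^sub>R h)) (at 0)"
    by (auto intro!: derivative_eq_intros)
  then have "((\<lambda>t. f (x + t *\<^sub>R h)) has_derivative (\<lambda>t. f' (t *\<^sub>R h))) (at 0)"
    by (rule has_derivative_compose) (use assms in simp)
  moreover have "f' (t *\<^sub>R h) = f' h * t" for t
    using linear_scale[OF has_derivative_linear[OF assms]] by simp
  ultimately show ?thesis unfolding has_field_derivative_def by simp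
qed

lemma has_derivative_has_partial:
  "(f has_derivative f') (at x) \<Longrightarrow> has_partial i f x (f' (axis i 1))"
  unfolding has_partial_def by (rule has_derivative_imp_line)

lemma has_partial_line:
  assumes "has_partial i f (y + s *\<^sub>R axis i 1) d"
  shows "((\<lambda>s. f (y + s *\<^sub>R axis i 1)) has_real_derivative d) (at s)"
  using assms DERIV_shift[of "\<lambda>s. f (y + s *\<^sub>R axis i 1)" d 0 s]
  unfolding has_partial_def by (simp add: algebra_simps)

lemma Ck_1I:
  fixes f :: "real^'n::finite \<Rightarrow> real"
  assumes "open U" "\<And>x. x \<in> U \<Longrightarrow> (f has_derivative f' x) (at x)"
    and "\<And>i. continuous_on U (\<lambda>x. f' x (axis i 1))"
  shows "Ck (Suc 0) U f"
proof (rule Ck_SucI[OF assms(1), where d="\<lambda>i x. f' x (axis i 1)"])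
  show "continuous_on U f"
    using assms(2) by (meson continuous_at_imp_continuous_on has_derivative_continuous)
qed (use assms in \<open>auto intro: has_derivative_has_partial\<close>)

text \<open>The coordinates are changed one at a time.\<close>
lemma Ck_1_has_derivative:
  fixes f :: "real^'n::finite \<Rightarrow> real"
  assumes V: "open V" and f: "Ck (Suc 0) V f" and x: "x \<in> V"
  shows "(f has_derivative (\<lambda>h. \<Sum>i\<in>UNIV. h $ i * partial i f x)) (at x)"
proof -
  define P where "P A h = (\<chi> i. if i \<in> A then h $ i else 0)" for A and h :: "real^'n"
  have main: "\<forall>e>0. \<exists>d>0. \<forall>h. norm h < d \<longrightarrow>
      \<bar>f (x + P A h) - f x - (\<Sum>i\<in>A. h $ i * partial i f x)\<bar> \<le> e * norm h" if "finite A" for A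
    using that
  proof (induction A rule: finite_induct)
    case empty
    have "P {} h = 0" for h by (simp add: P_def vec_eq_iff)
    then show ?case by (auto intro: exI[of _ 1])
  next
    case (insert i A)
    show ?case
    proof (intro allI impI)
      fix e :: real assume e: "e > 0"
      obtain d1 where d1: "d1 > 0" "\<And>h. norm h < d1 \<Longrightarrow>
          \<bar>f (x + P A h) - f x - (\<Sum>i\<in>A. h $ i * partial i f x)\<bar> \<le> e / 2 * norm h"
        using insert.IH[rule_format, of "e / 2"] e by auto
      have "continuous_on V (partial i f)" using f by (simp add: Ck_Suc_iff)
      then have "continuous (at x) (partial i f)" using V x by (simp add: continuous_on_eq_continuous_at)
      then obtain d2 where d2: "d2 > 0" "\<And>y. dist y x < d2 \<Longrightarrow> dist (partial i f y) (partial i f x) < e / 2"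
        unfolding continuous_at_eps_delta using e by (metis half_gt_zero)
      obtain d3 where d3: "d3 > 0" "ball x d3 \<subseteq> V" using V x open_contains_ball by blast
      show "\<exists>d>0. \<forall>h. norm h < d \<longrightarrow>
        \<bar>f (x + P (insert i A) h) - f x - (\<Sum>i\<in>insert i A. h $ i * partial i f x)\<bar> \<le> e * norm h"
      proof (intro exI[of _ "min d1 (min d2 d3)"] conjI allI impI)
        fix h :: "real^'n" assume h: "norm h < min d1 (min d2 d3)"
        define y where "y s = x + P A h + s *\<^sub>R axis i 1" for s :: real
        \<comment> \<open>As \<open>i \<notin> A\<close>, the vector \<open>P A h\<close> has no
          component along \<open>i\<close>, so no component of \<open>y s - x\<close> exceeds that
          of \<open>h\<close>.\<close>
        have near: "norm (y s - x) \<le> norm h" if "\<bar>s\<bar> \<le> \<bar>h $ i\<bar>" for s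
        proof -
          have "y s - x = P A h + s *\<^sub>R axis i 1" by (simp add: y_def)
          moreover have "norm (P A h + s *\<^sub>R axis i 1) \<le> norm h"
            by (rule norm_le_componentwise_cart) (use that insert.hyps(2) in \<open>auto simp: P_def axis_def\<close>)
          ultimately show ?thesis by simp
        qed
        have yV: "y s \<in> V" "\<bar>partial i f (y s) - partial i f x\<bar> \<le> e / 2" if "\<bar>s\<bar> \<le> \<bar>h $ i\<bar>" for s
        proof -
          have "dist (y s) x < min d2 d3" using near[OF that] h by (simp add: dist_norm)
          then show "y s \<in> V" "\<bar>partial i f (y s) - partial i f x\<bar> \<le> e / 2"
            using d2(2)[of "y s"] d3(2) by (auto simp: dist_commute[of x] dist_real_def subset_iff)
        qed
        let ?I = "{- \<bar>h $ i\<bar> .. \<bar>h $ i\<bar>}"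
        have "norm ((f (y (h $ i)) - partial i f x * h $ i) - (f (y 0) - partial i f x * 0))
            \<le> e / 2 * norm (h $ i - 0)"
        proof (rule field_differentiable_bound[where S="?I" and f'="\<lambda>s. partial i f (y s) - partial i f x"
              and f="\<lambda>s. f (y s) - partial i f x * s"])
          fix s assume "s \<in> ?I"
          then have s: "\<bar>s\<bar> \<le> \<bar>h $ i\<bar>" by auto
          have "has_partial i f (y s) (partial i f (y s))" using f yV(1)[OF s] by (simp add: Ck_Suc_iff)
          then have "((\<lambda>s. f (y s)) has_real_derivative partial i f (y s)) (at s)"
            unfolding y_def by (rule has_partial_line)
          then show "((\<lambda>s. f (y s) - partial i f x * s) has_real_derivative partial i f (y s) - partial i f x)
              (at s within ?I)"
            by (rule has_field_derivative_at_within[OF DERIV_diff[OF _ DERIV_cmult_Id]])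
          show "norm (partial i f (y s) - partial i f x) \<le> e / 2" using yV(2)[OF s] by simp
        qed auto
        then have 1: "\<bar>f (y (h $ i)) - f (y 0) - h $ i * partial i f x\<bar> \<le> e / 2 * \<bar>h $ i\<bar>"
          by (simp add: algebra_simps)
        have "y (h $ i) = x + P (insert i A) h"
          using insert.hyps(2) by (auto simp: y_def P_def vec_eq_iff axis_def)
        moreover have "y 0 = x + P A h" by (simp add: y_def)
        moreover have "\<bar>h $ i\<bar> \<le> norm h" by (rule component_le_norm_cart)
        then have "e / 2 * \<bar>h $ i\<bar> \<le> e / 2 * norm h" using e by simp
        ultimately have "\<bar>f (x + P (insert i A) h) - f (x + P A h) - h $ i * partial i f x\<bar> \<le> e / 2 * norm h"
          using 1 by simp
        moreover have "\<bar>f (x + P A h) - f x - (\<Sum>i\<in>A. h $ i * partial i f x)\<bar> \<le> e / 2 * norm h"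
          using d1(2) h by simp
        moreover have "(\<Sum>i\<in>insert i A. h $ i * partial i f x) = h $ i * partial i f x + (\<Sum>i\<in>A. h $ i * partial i f x)"
          using insert.hyps by simp
        ultimately show "\<bar>f (x + P (insert i A) h) - f x - (\<Sum>i\<in>insert i A. h $ i * partial i f x)\<bar> \<le> e * norm h"
          by linarith
      qed (use d1 d2 d3 in auto)
    qed
  qed
  have "P UNIV h = h" for h by (simp add: P_def vec_eq_iff)
  note main' = main[of UNIV, simplified this]
  show ?thesis
    unfolding has_derivative_at_alt
  proof (intro conjI allI impI)
    show "bounded_linear (\<lambda>h. \<Sum>i\<in>UNIV. h $ i * partial i f x)"
      by (intro bounded_linear_sum bounded_linear_mult_left[THEN bounded_linear_compose] bounded_linear_vec_nth)
    fix e :: real assume "e > 0"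
    then obtain d where d: "d > 0" "\<And>h. norm h < d \<Longrightarrow> \<bar>f (x + h) - f x - (\<Sum>i\<in>UNIV. h $ i * partial i f x)\<bar> \<le> e * norm h"
      using main' by auto
    show "\<exists>d>0. \<forall>y. norm (y - x) < d \<longrightarrow>
        norm (f y - f x - (\<Sum>i\<in>UNIV. (y - x) $ i * partial i f x)) \<le> e * norm (y - x)"
      using d(1) d(2)[of "_ - x"] by (intro exI[of _ d]) (auto simp del: vector_minus_component)
  qed
qed

lemma Ck_1_Un:
  assumes "open V" "open W" "Ck (Suc 0) V f" "Ck (Suc 0) W f"
  shows "Ck (Suc 0) (V \<union> W) f"
  using assms unfolding Ck_Suc_iff Ck.simps(1) by (auto intro: continuous_on_open_Un)

section \<open>Integration by parts against Lipschitz functions\<close>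

lemma lborel_integral_shift:
  fixes f :: "'a::euclidean_space \<Rightarrow> real"
  assumes "f \<in> borel_measurable borel"
  shows "(\<integral>x. f (x + c) \<partial>lborel) = (\<integral>x. f x \<partial>lborel)"
proof -
  have "(\<integral>x. f x \<partial>lborel) = (\<integral>x. f x \<partial>(distr lborel borel ((+) c)))"
    by (simp add: lborel_distr_plus)
  also have "\<dots> = (\<integral>x. f (c + x) \<partial>lborel)"
    by (rule integral_distr) (use assms in auto)
  finally show ?thesis by (simp add: add.commute)
qed

lemma integrable_indicator_cball:
  "integrable lborel (\<lambda>x. c * indicator (cball (a::'a::euclidean_space) R) x :: real)"
  by (intro integrable_mult_right integrable_real_indicator emeasure_bounded_finite) auto

lemma integrable_lborel_compact_support:
  fixes f :: "'a::euclidean_space \<Rightarrow> real"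
  assumes "f \<in> borel_measurable borel" "\<And>x. \<bar>f x\<bar> \<le> B" "\<And>x. norm x > R \<Longrightarrow> f x = 0"
  shows "integrable lborel f"
proof (rule Bochner_Integration.integrable_bound)
  show "integrable lborel (\<lambda>x. B * indicator (cball (0::'a) R) x)"
    by (rule integrable_indicator_cball)
  show "AE x in lborel. norm (f x) \<le> norm (B * indicator (cball (0::'a) R) x)"
  proof (rule AE_I2)
    fix x
    have "B \<ge> 0" using assms(2)[of x] by linarith
    then show "norm (f x) \<le> norm (B * indicator (cball (0::'a) R) x)"
      using assms(2,3)[of x] by (cases "norm x \<le> R") (auto simp: indicator_def)
  qed
qed (use assms in auto)

text \<open>Compact support bounds \<open>f\<close> and its continuous partial derivatives; the sum
  of these bounds is a single constant, later used both for Lipschitz estimates and in dominating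
  functions.\<close>

lemma Ck_1_compact_support_lipschitz:
  fixes f :: "real^'n::finite \<Rightarrow> real"
  assumes f: "Ck (Suc 0) UNIV f" and supp: "\<And>x. norm x > R \<Longrightarrow> f x = 0"
  shows "\<exists>C\<ge>0. C-lipschitz_on UNIV f \<and> (\<forall>x. \<bar>f x\<bar> \<le> C) \<and> (\<forall>i x. \<bar>partial i f x\<bar> \<le> C)
      \<and> (\<forall>i x. norm x > R \<longrightarrow> partial i f x = 0)"
proof -
  have p0: "partial i f x = 0" if "norm x > R" for i x
  proof -
    have "partial i f x = partial i (\<lambda>x. 0) x"
      by (rule partial_cong[of "{x. norm x > R}"]) (use that supp in \<open>auto intro!: open_Collect_less continuous_intros\<close>)
    then show ?thesis using has_partial_imp_partial[OF has_partial_const[of i 0 x]] by simp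
  qed
  have bdd: "\<exists>B. \<forall>x. \<bar>h x\<bar> \<le> B" if "continuous_on UNIV h" "\<And>x. norm x > R \<Longrightarrow> h x = 0"
    for h :: "real^'n \<Rightarrow> real"
  proof -
    have "compact (h ` cball 0 R)"
      by (intro compact_continuous_image continuous_on_subset[OF that(1)]) auto
    then obtain B where B: "\<forall>y\<in>h ` cball 0 R. norm y \<le> B"
      using compact_imp_bounded bounded_iff by metis
    have "\<bar>h x\<bar> \<le> max B 0" for x
    proof (cases "norm x \<le> R")
      case True
      then have "norm (h x) \<le> B" using B by auto
      then show ?thesis by simp
    qed (simp add: that(2))
    then show ?thesis by blast
  qed
  have cont: "continuous_on UNIV f" "\<And>i. continuous_on UNIV (partial i f)"
    using f by (auto simp: Ck_Suc_iff)
  obtain B0 where B0: "\<And>x. \<bar>f x\<bar> \<le> B0" using bdd[OF cont(1) supp] by blast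
  have "\<forall>i. \<exists>B. \<forall>x. \<bar>partial i f x\<bar> \<le> B" using bdd[OF cont(2) p0] by blast
  then obtain B where B: "\<And>i x. \<bar>partial i f x\<bar> \<le> B i" by metis
  have Bpos: "B i \<ge> 0" "B0 \<ge> 0" for i using B[of i 0] B0[of 0] by linarith+
  define C where "C = B0 + (\<Sum>i\<in>UNIV. B i)"
  have BC: "B i \<le> C" for i
    unfolding C_def using Bpos member_le_sum[of i UNIV B] by (simp add: add_increasing)
  have BsC: "(\<Sum>i\<in>UNIV. B i) \<le> C" "B0 \<le> C" unfolding C_def using Bpos by (auto intro: sum_nonneg)
  have "C \<ge> 0" using BsC(2) Bpos(2) by linarith
  moreover have "C-lipschitz_on UNIV f"
  proof (rule lipschitz_onI)
    fix x y :: "real^'n"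
    have "norm (f x - f y) \<le> C * norm (x - y)"
    proof (rule differentiable_bound[OF convex_UNIV])
      fix z :: "real^'n"
      show "(f has_derivative (\<lambda>h. \<Sum>i\<in>UNIV. h $ i * partial i f z)) (at z within UNIV)"
        using Ck_1_has_derivative[OF open_UNIV f] by simp
      show "onorm (\<lambda>h. \<Sum>i\<in>UNIV. h $ i * partial i f z) \<le> C"
      proof (rule onorm_le)
        fix h :: "real^'n"
        have "\<bar>\<Sum>i\<in>UNIV. h $ i * partial i f z\<bar> \<le> (\<Sum>i\<in>UNIV. norm h * B i)"
          by (rule order_trans[OF sum_abs])
            (auto simp: abs_mult intro!: sum_mono mult_mono component_le_norm_cart B)
        also have "\<dots> \<le> C * norm h"
          unfolding mult.commute[of "norm h"] sum_distrib_right[symmetric] using BsC(1) by (rule mult_right_mono) simp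
        finally show "norm (\<Sum>i\<in>UNIV. h $ i * partial i f z) \<le> C * norm h" by simp
      qed
    qed auto
    then show "dist (f x) (f y) \<le> C * dist x y" by (simp add: dist_norm)
  qed (use \<open>C \<ge> 0\<close> in auto)
  ultimately show ?thesis using B0 B BC BsC p0 by (meson order_trans)
qed

lemma has_derivative_lipschitz_bound:
  fixes f :: "'a::real_normed_vector \<Rightarrow> real"
  assumes lip: "L-lipschitz_on UNIV f" and d: "(f has_derivative f') (at x)"
  shows "\<bar>f' h\<bar> \<le> L * norm h"
proof -
  have "((\<lambda>t. f (x + t *\<^sub>R h)) has_real_derivative f' h) (at 0)"
    by (rule has_derivative_imp_line[OF d])
  then have "(\<lambda>t. (f (x + t *\<^sub>R h) - f x) / t) \<midarrow>0\<rightarrow> f' h" unfolding DERIV_def by simp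
  then have "(\<lambda>t. \<bar>(f (x + t *\<^sub>R h) - f x) / t\<bar>) \<midarrow>0\<rightarrow> \<bar>f' h\<bar>" by (rule tendsto_rabs)
  moreover have "\<forall>\<^sub>F t in at (0::real). \<bar>(f (x + t *\<^sub>R h) - f x) / t\<bar> \<le> L * norm h"
  proof -
    have "\<bar>(f (x + t *\<^sub>R h) - f x) / t\<bar> \<le> L * norm h" if "t \<noteq> 0" for t
      using lipschitz_onD[OF lip, of "x + t *\<^sub>R h" x] that
      by (simp add: dist_norm field_simps)
    then show ?thesis by (auto simp: eventually_at_filter)
  qed
  ultimately show ?thesis by (rule tendsto_upperbound) simp
qed

text \<open>The factor \<open>c\<close> serves to carry a sign: forward quotients for the field, and
  the backward quotients that translation produces for the test function.\<close>

lemma has_derivative_sequence: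
  fixes f :: "'a::real_normed_vector \<Rightarrow> real"
  assumes d: "(f has_derivative f') (at x)"
  shows "(\<lambda>k. (f (x + (c / real (Suc k)) *\<^sub>R h) - f x) * real (Suc k)) \<longlonglongrightarrow> f' (c *\<^sub>R h)"
proof -
  have "((\<lambda>t. f (x + t *\<^sub>R (c *\<^sub>R h))) has_real_derivative f' (c *\<^sub>R h)) (at 0)"
    by (rule has_derivative_imp_line[OF d])
  then have "(\<lambda>t. (f (x + t *\<^sub>R (c *\<^sub>R h)) - f x) / t) \<midarrow>0\<rightarrow> f' (c *\<^sub>R h)" unfolding DERIV_def by simp
  moreover have "filterlim (\<lambda>k. 1 / real (Suc k)) (at 0) sequentially"
    unfolding filterlim_at using LIMSEQ_Suc[OF lim_1_over_n[where 'a=real]] by simp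
  ultimately have "(\<lambda>k. (f (x + (1 / real (Suc k)) *\<^sub>R (c *\<^sub>R h)) - f x) / (1 / real (Suc k))) \<longlonglongrightarrow> f' (c *\<^sub>R h)"
    by (rule filterlim_compose)
  then show ?thesis by (simp add: field_simps)
qed

text \<open>Integration by parts: the difference quotients are moved from \<open>F\<close> to \<open>\<phi>\<close> by translation invariance.\<close>
lemma lipschitz_divergence_bound:
  fixes F :: "real^'n::finite \<Rightarrow> real^'n" and \<phi> :: "real^'n \<Rightarrow> real"
  assumes F: "\<And>i. Ck (Suc 0) UNIV (\<lambda>x. F x $ i)" and supp: "\<And>x. norm x > R \<Longrightarrow> F x = 0"
    and lip: "L-lipschitz_on UNIV \<phi>" and bd: "\<And>x. \<bar>\<phi> x\<bar> \<le> B"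
    and N: "N \<in> null_sets lborel"
    and dchi: "\<And>x. x \<notin> N \<Longrightarrow> \<exists>\<phi>'. (\<phi> has_derivative \<phi>') (at x) \<and> \<bar>\<phi>' (F x)\<bar> \<le> K * indicator S x"
    and S: "S \<in> sets borel" "emeasure lborel S < \<infinity>"
  shows "\<bar>\<integral>x. \<phi> x * divg F x \<partial>lborel\<bar> \<le> K * measure lborel S"
proof -
  have "\<forall>i. \<exists>C\<ge>0. C-lipschitz_on UNIV (\<lambda>x. F x $ i) \<and> (\<forall>x. \<bar>F x $ i\<bar> \<le> C) \<and>
      (\<forall>j x. \<bar>partial j (\<lambda>x. F x $ i) x\<bar> \<le> C) \<and> (\<forall>j x. norm x > R \<longrightarrow> partial j (\<lambda>x. F x $ i) x = 0)"
    by (intro allI Ck_1_compact_support_lipschitz[OF F]) (simp add: supp)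
  then obtain C where C: "\<And>i. C i \<ge> 0" "\<And>i. (C i)-lipschitz_on UNIV (\<lambda>x. F x $ i)" "\<And>i x. \<bar>F x $ i\<bar> \<le> C i"
    "\<And>i j x. \<bar>partial j (\<lambda>x. F x $ i) x\<bar> \<le> C i" "\<And>i j x. norm x > R \<Longrightarrow> partial j (\<lambda>x. F x $ i) x = 0"
    by metis
  have contF: "continuous_on UNIV (\<lambda>x. F x $ i)" for i using F[of i] by (rule Ck_imp_continuous)
  have contP: "continuous_on UNIV (partial j (\<lambda>x. F x $ i))" for i j using F[of i] by (simp add: Ck_Suc_iff)
  have contX: "continuous_on UNIV \<phi>" by (rule lipschitz_on_continuous_on[OF lip])
  have [measurable]: "(\<lambda>x. F x $ i) \<in> borel_measurable borel" for i
    by (intro borel_measurable_continuous_onI contF)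
  have [measurable]: "partial j (\<lambda>x. F x $ i) \<in> borel_measurable borel" for i j
    by (intro borel_measurable_continuous_onI contP)
  have [measurable]: "\<phi> \<in> borel_measurable borel"
    by (intro borel_measurable_continuous_onI contX)
  have B0: "B \<ge> 0" using bd[of 0] by linarith
  have L0: "L \<ge> 0" by (rule lipschitz_on_nonneg[OF lip])
  define m where "m k = real (Suc k)" for k
  have m: "m k > 0" "m k \<ge> 1" for k by (auto simp: m_def)
  define e :: "nat \<Rightarrow> 'n \<Rightarrow> real^'n" where "e k i = (1 / m k) *\<^sub>R axis i 1" for k i
  have ne: "norm (e k i) = 1 / m k" for k i using m(1)[of k] by (simp add: e_def)
  have ne1: "norm (e k i) \<le> 1" for k i using m(1,2)[of k] by (simp add: ne)
  \<comment> \<open>A discrete version of \<open>- F x \<bullet> grad \<phi> x\<close>. The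
    quotients of \<open>\<phi>\<close> are backward because translating the integral moves the shift
    by \<open>e k i\<close> from \<open>F\<close> to \<open>\<phi>\<close> with opposite
    sign.\<close>
  define q where "q k x = (\<Sum>i\<in>UNIV. F x $ i * ((\<phi> (x - e k i) - \<phi> x) * m k))" for k x
  have [measurable]: "q k \<in> borel_measurable borel" for k unfolding q_def by measurable
  have swap: "(\<Sum>i\<in>UNIV. \<integral>x. \<phi> x * ((F (x + e k i) $ i - F x $ i) * m k) \<partial>lborel) = (\<integral>x. q k x \<partial>lborel)" for k
  proof -
    have "(\<integral>x. \<phi> x * ((F (x + e k i) $ i - F x $ i) * m k) \<partial>lborel) =
        (\<integral>x. F x $ i * ((\<phi> (x - e k i) - \<phi> x) * m k) \<partial>lborel)" for i
    proof -
      have BC: "\<bar>\<phi> x * F y $ i\<bar> \<le> B * C i" for x y unfolding abs_mult by (intro mult_mono bd C B0) auto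
      have i1: "integrable lborel (\<lambda>x. \<phi> x * F (x + e k i) $ i)"
      proof (rule integrable_lborel_compact_support[OF _ BC])
        fix x :: "real^'n" assume "norm x > R + 1"
        then have "norm (x + e k i) > R" using ne1[of k i] norm_triangle_ineq4[of "x + e k i" "e k i"] by simp
        then show "\<phi> x * F (x + e k i) $ i = 0" using supp by simp
      qed measurable
      have i2: "integrable lborel (\<lambda>x. \<phi> x * F x $ i)"
        by (rule integrable_lborel_compact_support[OF _ BC, where R=R]) (auto simp: supp)
      have i3: "integrable lborel (\<lambda>x. \<phi> (x - e k i) * F x $ i)"
        by (rule integrable_lborel_compact_support[OF _ BC, where R=R]) (auto simp: supp)
      have "(\<integral>x. \<phi> x * F (x + e k i) $ i \<partial>lborel) = (\<integral>x. \<phi> (x - e k i) * F x $ i \<partial>lborel)"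
        using lborel_integral_shift[of "\<lambda>x. \<phi> (x - e k i) * F x $ i" "e k i"] by simp
      then have "(\<integral>x. (\<phi> x * F (x + e k i) $ i - \<phi> x * F x $ i) * m k \<partial>lborel) =
          (\<integral>x. (\<phi> (x - e k i) * F x $ i - \<phi> x * F x $ i) * m k \<partial>lborel)"
        by (simp add: Bochner_Integration.integral_diff[OF i1 i2] Bochner_Integration.integral_diff[OF i3 i2])
      then show ?thesis by (simp add: algebra_simps)
    qed
    moreover have "(\<integral>x. q k x \<partial>lborel) = (\<Sum>i\<in>UNIV. \<integral>x. F x $ i * ((\<phi> (x - e k i) - \<phi> x) * m k) \<partial>lborel)"
      unfolding q_def
    proof (rule Bochner_Integration.integral_sum)
      fix i
      show "integrable lborel (\<lambda>x. F x $ i * ((\<phi> (x - e k i) - \<phi> x) * m k))"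
      proof (rule integrable_lborel_compact_support[where B="C i * ((B + B) * m k)" and R=R])
        fix x
        show "\<bar>F x $ i * ((\<phi> (x - e k i) - \<phi> x) * m k)\<bar> \<le> C i * ((B + B) * m k)"
          unfolding abs_mult using bd[of "x - e k i"] bd[of x] m(1)[of k]
          by (intro mult_mono C) auto
      qed (auto simp: supp)
    qed
    ultimately show ?thesis by simp
  qed
  \<comment> \<open>The shifts have norm at most 1, so every quotient vanishes outside radius
    \<open>R + 1\<close>; the Lipschitz constant \<open>C i\<close> bounds it inside.\<close>
  have limL: "(\<lambda>k. \<integral>x. \<phi> x * ((F (x + e k i) $ i - F x $ i) * m k) \<partial>lborel) \<longlonglongrightarrow>
      (\<integral>x. \<phi> x * partial i (\<lambda>x. F x $ i) x \<partial>lborel)" for i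
  proof (rule integral_dominated_convergence[where w="\<lambda>x. B * C i * indicator (cball (0::real^'n) (R + 1)) x"])
    show "integrable lborel (\<lambda>x. B * C i * indicator (cball (0::real^'n) (R + 1)) x)"
      by (rule integrable_indicator_cball)
    show "AE x in lborel. (\<lambda>k. \<phi> x * ((F (x + e k i) $ i - F x $ i) * m k)) \<longlonglongrightarrow> \<phi> x * partial i (\<lambda>x. F x $ i) x"
    proof (rule AE_I2, rule tendsto_mult_left)
      fix x
      show "(\<lambda>k. (F (x + e k i) $ i - F x $ i) * m k) \<longlonglongrightarrow> partial i (\<lambda>x. F x $ i) x"
        using has_derivative_sequence[OF Ck_1_has_derivative[OF open_UNIV F[of i], of x], of 1 "axis i 1"]
        by (simp add: e_def m_def axis_def if_distrib[of "\<lambda>z. z * _"] cong: if_cong)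
    qed
    fix k
    show "AE x in lborel. norm (\<phi> x * ((F (x + e k i) $ i - F x $ i) * m k)) \<le> B * C i * indicator (cball (0::real^'n) (R + 1)) x"
    proof (rule AE_I2)
      fix x
      show "norm (\<phi> x * ((F (x + e k i) $ i - F x $ i) * m k)) \<le> B * C i * indicator (cball (0::real^'n) (R + 1)) x"
      proof (cases "norm x \<le> R + 1")
        case True
        have "\<bar>F (x + e k i) $ i - F x $ i\<bar> \<le> C i * (1 / m k)"
          using lipschitz_onD[OF C(2)[of i], of "x + e k i" x] by (simp add: dist_norm ne)
        then have "\<bar>F (x + e k i) $ i - F x $ i\<bar> * m k \<le> C i" using m(1)[of k] by (simp add: field_simps)
        then have "\<bar>\<phi> x\<bar> * (\<bar>F (x + e k i) $ i - F x $ i\<bar> * m k) \<le> B * C i"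
          using bd[of x] B0 m(1)[of k] by (intro mult_mono) auto
        then show ?thesis using True m(1)[of k] by (simp add: abs_mult)
      next
        case False
        then have "norm (x + e k i) > R" "norm x > R"
          using ne1[of k i] norm_triangle_ineq4[of "x + e k i" "e k i"] by simp_all
        then show ?thesis using False by (simp add: supp)
      qed
    qed
  qed measurable
  have "(\<lambda>k. \<Sum>i\<in>UNIV. \<integral>x. \<phi> x * ((F (x + e k i) $ i - F x $ i) * m k) \<partial>lborel) \<longlonglongrightarrow>
      (\<Sum>i\<in>UNIV. \<integral>x. \<phi> x * partial i (\<lambda>x. F x $ i) x \<partial>lborel)"
    by (intro tendsto_sum limL)
  moreover have "(\<Sum>i\<in>UNIV. \<integral>x. \<phi> x * partial i (\<lambda>x. F x $ i) x \<partial>lborel) = (\<integral>x. \<phi> x * divg F x \<partial>lborel)"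
    unfolding divg_def sum_distrib_left
  proof (rule Bochner_Integration.integral_sum[symmetric])
    fix i
    show "integrable lborel (\<lambda>x. \<phi> x * partial i (\<lambda>y. F y $ i) x)"
    proof (rule integrable_lborel_compact_support[where B="B * C i" and R=R])
      fix x
      show "\<bar>\<phi> x * partial i (\<lambda>y. F y $ i) x\<bar> \<le> B * C i"
        unfolding abs_mult using bd[of x] B0 by (intro mult_mono C) auto
    qed (auto simp: C)
  qed
  ultimately have lim1: "(\<lambda>k. \<integral>x. q k x \<partial>lborel) \<longlonglongrightarrow> (\<integral>x. \<phi> x * divg F x \<partial>lborel)"
    using swap by simp
  \<comment> \<open>\<open>lim\<close> is total, so \<open>w\<close> is Borel on the whole space
    although convergence to it is known only outside \<open>N\<close>.\<close>
  define w where "w x = lim (\<lambda>k. q k x)" for x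
  have [measurable]: "w \<in> borel_measurable borel" unfolding w_def by measurable
  have qlim: "\<exists>z. (\<lambda>k. q k x) \<longlonglongrightarrow> z \<and> \<bar>z\<bar> \<le> K * indicator S x" if xN: "x \<notin> N" for x
  proof -
    obtain \<phi>' where d: "(\<phi> has_derivative \<phi>') (at x)" "\<bar>\<phi>' (F x)\<bar> \<le> K * indicator S x"
      using dchi[OF xN] by blast
    have lin: "linear \<phi>'" by (rule has_derivative_linear[OF d(1)])
    have "(\<lambda>k. (\<phi> (x - e k i) - \<phi> x) * m k) \<longlonglongrightarrow> - \<phi>' (axis i 1)" for i
      using has_derivative_sequence[OF d(1), of "-1" "axis i 1"]
      by (simp add: e_def m_def linear_neg[OF lin])
    then have "(\<lambda>k. q k x) \<longlonglongrightarrow> (\<Sum>i\<in>UNIV. F x $ i * (- \<phi>' (axis i 1)))"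
      unfolding q_def by (intro tendsto_sum tendsto_mult_left)
    moreover have "\<phi>' (F x) = (\<Sum>i\<in>UNIV. F x $ i * \<phi>' (axis i 1))"
    proof -
      have "F x = (\<Sum>i\<in>UNIV. F x $ i *\<^sub>R axis i 1)"
        using basis_expansion[of "F x"] by (simp add: scalar_mult_eq_scaleR)
      then have "\<phi>' (F x) = \<phi>' (\<Sum>i\<in>UNIV. F x $ i *\<^sub>R axis i 1)" by simp
      then show ?thesis by (simp add: linear_sum[OF lin] linear_scale[OF lin])
    qed
    then have "(\<Sum>i\<in>UNIV. F x $ i * (- \<phi>' (axis i 1))) = - \<phi>' (F x)" by (simp add: sum_negf)
    ultimately show ?thesis using d(2) by (intro exI[of _ "- \<phi>' (F x)"]) simp
  qed
  have AEN: "AE x in lborel. x \<notin> N" using N by (rule AE_not_in)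
  have wlim: "AE x in lborel. (\<lambda>k. q k x) \<longlonglongrightarrow> w x"
    using AEN by eventually_elim (use qlim limI in \<open>auto simp: w_def\<close>)
  have wbd: "AE x in lborel. \<bar>w x\<bar> \<le> K * indicator S x"
    using AEN by eventually_elim (use qlim limI in \<open>auto simp: w_def\<close>)
  define D where "D = (\<Sum>i\<in>UNIV. C i * L)"
  have lim2: "(\<lambda>k. \<integral>x. q k x \<partial>lborel) \<longlonglongrightarrow> (\<integral>x. w x \<partial>lborel)"
  proof (rule integral_dominated_convergence[where w="\<lambda>x. D * indicator (cball (0::real^'n) R) x"])
    show "integrable lborel (\<lambda>x. D * indicator (cball (0::real^'n) R) x)"
      by (rule integrable_indicator_cball)
    show "AE x in lborel. (\<lambda>k. q k x) \<longlonglongrightarrow> w x" by (rule wlim)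
    fix k
    show "AE x in lborel. norm (q k x) \<le> D * indicator (cball (0::real^'n) R) x"
    proof (rule AE_I2)
      fix x
      show "norm (q k x) \<le> D * indicator (cball (0::real^'n) R) x"
      proof (cases "norm x \<le> R")
        case True
        have "norm (q k x) \<le> D" unfolding q_def D_def
        proof (rule sum_norm_le)
          fix i :: 'n
          have "\<bar>\<phi> (x - e k i) - \<phi> x\<bar> \<le> L * (1 / m k)"
            using lipschitz_onD[OF lip, of "x - e k i" x] by (simp add: dist_norm ne)
          then have "\<bar>\<phi> (x - e k i) - \<phi> x\<bar> * m k \<le> L" using m(1)[of k] by (simp add: field_simps)
          then show "norm (F x $ i * ((\<phi> (x - e k i) - \<phi> x) * m k)) \<le> C i * L"
            using C(1)[of i] C(3)[of x i] m(1)[of k] by (simp add: abs_mult mult_mono)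
        qed
        then show ?thesis using True by simp
      next
        case False
        then show ?thesis by (simp add: q_def supp)
      qed
    qed
  qed measurable
  have "(\<integral>x. \<phi> x * divg F x \<partial>lborel) = (\<integral>x. w x \<partial>lborel)"
    by (rule LIMSEQ_unique[OF lim1 lim2])
  moreover have "\<bar>\<integral>x. w x \<partial>lborel\<bar> \<le> K * measure lborel S"
  proof -
    have iS: "integrable lborel (\<lambda>x. K * indicator S x)"
      by (intro integrable_mult_right integrable_real_indicator) (use S in auto)
    have iw: "integrable lborel w"
      by (rule Bochner_Integration.integrable_bound[OF iS]) (use wbd in \<open>auto elim!: eventually_mono\<close>)
    have "\<bar>\<integral>x. w x \<partial>lborel\<bar> \<le> (\<integral>x. \<bar>w x\<bar> \<partial>lborel)" by (rule integral_abs_bound)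
    also have "\<dots> \<le> (\<integral>x. K * indicator S x \<partial>lborel)"
      by (rule integral_mono_AE) (use iw iS wbd in auto)
    also have "\<dots> = K * measure lborel S" using S by simp
    finally show ?thesis .
  qed
  ultimately show ?thesis by simp
qed

section \<open>The divergence theorem below a Lipschitz graph\<close>

lemma DERIV_max_0_square: "((\<lambda>s. (max 0 s)\<^sup>2) has_real_derivative 2 * max 0 s) (at s)"
proof (cases s "0::real" rule: linorder_cases)
  case less
  have "((\<lambda>s. 0) has_real_derivative 2 * max 0 s) (at s)" using less by simp
  then show ?thesis
    by (rule has_field_derivative_transform_within_open[of _ _ _ "{..<0}"]) (use less in auto)
next
  case greater
  have "((\<lambda>s. s\<^sup>2) has_real_derivative 2 * max 0 s) (at s)"
    using greater by (auto intro!: derivative_eq_intros)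
  then show ?thesis
    by (rule has_field_derivative_transform_within_open[of _ _ _ "{0<..}"]) (use greater in auto)
next
  case equal
  have "(\<lambda>h. (max 0 h)\<^sup>2 / h) \<midarrow>0\<rightarrow> (0::real)"
  proof (rule Lim_null_comparison)
    have "\<bar>(max 0 h)\<^sup>2 / h\<bar> \<le> \<bar>h\<bar>" for h :: real
      by (cases "h \<le> 0") (auto simp: power2_eq_square)
    then show "\<forall>\<^sub>F h in at 0. norm ((max 0 h)\<^sup>2 / h) \<le> \<bar>h::real\<bar>" by (simp add: always_eventually)
    show "(\<lambda>h. \<bar>h::real\<bar>) \<midarrow>0\<rightarrow> 0" by (intro tendsto_rabs_zero tendsto_ident_at)
  qed
  then show ?thesis using equal by (simp add: DERIV_def)
qed

text \<open>Between 0 and 1 this is \<open>1 - (1 - s\<^sup>2)\<^sup>2\<close>. The squared positive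
  parts make it exactly 0 to the left and exactly 1 to the right, with continuous derivative at both
  joints.\<close>

definition smooth_step :: "real \<Rightarrow> real" where
  "smooth_step s = 1 - (max 0 (1 - (max 0 s)\<^sup>2))\<^sup>2"

definition smooth_step' :: "real \<Rightarrow> real" where
  "smooth_step' s = 4 * max 0 (1 - (max 0 s)\<^sup>2) * max 0 s"

lemma DERIV_smooth_step: "(smooth_step has_real_derivative smooth_step' s) (at s)"
proof -
  have 1: "((\<lambda>s. 1 - (max 0 s)\<^sup>2) has_real_derivative - (2 * max 0 s)) (at s)"
    using DERIV_diff[OF DERIV_const DERIV_max_0_square, of 1 s] by simp
  have "((\<lambda>s. (max 0 (1 - (max 0 s)\<^sup>2))\<^sup>2) has_real_derivative 2 * max 0 (1 - (max 0 s)\<^sup>2) * - (2 * max 0 s)) (at s)"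
    by (rule DERIV_chain2[OF DERIV_max_0_square 1])
  from DERIV_diff[OF DERIV_const this, of 1] show ?thesis
    unfolding smooth_step_def[abs_def] smooth_step'_def by (simp add: algebra_simps)
qed

lemma smooth_step_le_0: "s \<le> 0 \<Longrightarrow> smooth_step s = 0"
  by (simp add: smooth_step_def)

lemma one_minus_square_neg: "1 \<le> s \<Longrightarrow> 1 - s\<^sup>2 \<le> (0::real)"
  using one_le_power[of s 2] by simp

lemma smooth_step_ge_1: "s \<ge> 1 \<Longrightarrow> smooth_step s = 1"
  using one_minus_square_neg[of s] by (simp add: smooth_step_def)

lemma smooth_step_bounds: "0 \<le> smooth_step s" "smooth_step s \<le> 1"
proof -
  have "(max 0 (1 - (max 0 s)\<^sup>2))\<^sup>2 \<le> 1"
    by (rule power_le_one) auto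
  then show "0 \<le> smooth_step s" "smooth_step s \<le> 1" by (auto simp: smooth_step_def)
qed

lemma smooth_step'_outside: "s \<le> 0 \<or> 1 \<le> s \<Longrightarrow> smooth_step' s = 0"
  using one_minus_square_neg[of s] by (auto simp: smooth_step'_def)

lemma smooth_step'_bounds: "\<bar>smooth_step' s\<bar> \<le> 4"
proof (cases "s \<le> 0 \<or> 1 \<le> s")
  case False
  then have "max 0 (1 - (max 0 s)\<^sup>2) * max 0 s \<le> 1 * 1" by (intro mult_mono) auto
  moreover have "max 0 (1 - (max 0 s)\<^sup>2) * max 0 s \<ge> 0" by simp
  ultimately show ?thesis by (simp add: smooth_step'_def abs_mult mult.assoc)
qed (simp add: smooth_step'_outside)

lemma continuous_on_smooth_step': "continuous_on A smooth_step'"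
  unfolding smooth_step'_def[abs_def] by (intro continuous_intros)

lemma smooth_step_lipschitz: "\<bar>smooth_step s - smooth_step t\<bar> \<le> 4 * \<bar>s - t\<bar>"
proof -
  have "norm (smooth_step s - smooth_step t) \<le> 4 * norm (s - t)"
    by (rule field_differentiable_bound[where S=UNIV and f'=smooth_step'])
      (auto simp: smooth_step'_bounds intro: DERIV_smooth_step)
  then show ?thesis by simp
qed

text \<open>The squared distance keeps the function differentiable at the centre, and the factor 2
  lets the step reach 1 before the distance falls to half of \<open>\<rho>\<close>.\<close>

definition cutoff :: "real^'n::finite \<Rightarrow> real \<Rightarrow> real^'n \<Rightarrow> real" where
  "cutoff x0 \<rho> y = smooth_step (2 * (\<rho>\<^sup>2 - (y - x0) \<bullet> (y - x0)) / \<rho>\<^sup>2)"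

lemma cutoff_Ck_1:
  fixes x0 :: "real^'n::finite"
  shows "Ck (Suc 0) UNIV (cutoff x0 \<rho>)"
proof (rule Ck_1I)
  fix y :: "real^'n"
  let ?u = "\<lambda>y. 2 * (\<rho>\<^sup>2 - (y - x0) \<bullet> (y - x0)) / \<rho>\<^sup>2"
  have "(?u has_derivative (\<lambda>h. 2 * - ((y - x0) \<bullet> h + h \<bullet> (y - x0)) / \<rho>\<^sup>2)) (at y)"
    by (auto intro!: derivative_eq_intros simp: divide_inverse)
  moreover have "(smooth_step has_derivative (\<lambda>t. smooth_step' (?u y) * t)) (at (?u y))"
    using DERIV_smooth_step by (simp add: has_field_derivative_def)
  ultimately show "(cutoff x0 \<rho> has_derivative
      (\<lambda>h. smooth_step' (?u y) * (2 * - ((y - x0) \<bullet> h + h \<bullet> (y - x0)) / \<rho>\<^sup>2))) (at y)"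
    unfolding cutoff_def[abs_def] by (rule has_derivative_compose)
next
  fix i
  show "continuous_on UNIV (\<lambda>y. smooth_step' (2 * (\<rho>\<^sup>2 - (y - x0) \<bullet> (y - x0)) / \<rho>\<^sup>2) *
      (2 * - ((y - x0) \<bullet> axis i 1 + axis i 1 \<bullet> (y - x0)) / \<rho>\<^sup>2))"
    unfolding divide_inverse
    by (intro continuous_intros continuous_on_compose2[OF continuous_on_smooth_step'[of UNIV]]) auto
qed auto

lemma cutoff_eq_1: "\<rho> > 0 \<Longrightarrow> dist x0 y < \<rho> / 2 \<Longrightarrow> cutoff x0 \<rho> y = 1"
proof -
  assume \<rho>: "\<rho> > 0" "dist x0 y < \<rho> / 2"
  then have "(dist y x0)\<^sup>2 \<le> (\<rho> / 2)\<^sup>2" by (intro power_mono) (auto simp: dist_commute)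
  then have "4 * ((y - x0) \<bullet> (y - x0)) \<le> \<rho>\<^sup>2"
    by (simp add: dist_norm power2_norm_eq_inner power_divide)
  then have "2 * ((y - x0) \<bullet> (y - x0)) \<le> \<rho>\<^sup>2"
    using inner_ge_zero[of "y - x0"] by linarith
  then show ?thesis using \<rho>(1) unfolding cutoff_def by (intro smooth_step_ge_1) (simp add: pos_le_divide_eq)
qed

lemma cutoff_eq_0: "\<rho> > 0 \<Longrightarrow> dist x0 y \<ge> \<rho> \<Longrightarrow> cutoff x0 \<rho> y = 0"
proof -
  assume \<rho>: "\<rho> > 0" "dist x0 y \<ge> \<rho>"
  then have "\<rho>\<^sup>2 \<le> (dist y x0)\<^sup>2" by (intro power_mono) (auto simp: dist_commute)
  then have "\<rho>\<^sup>2 \<le> (y - x0) \<bullet> (y - x0)"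
    by (simp add: dist_norm power2_norm_eq_inner)
  then show ?thesis unfolding cutoff_def by (intro smooth_step_le_0) (simp add: divide_nonpos_nonneg)
qed

text \<open>The gradient \<open>m = e - a\<close> of the defining function
  \<open>y \<bullet> e - g y\<close> satisfies \<open>e \<bullet> m = 1\<close>, because
  \<open>g\<close> is constant along \<open>e\<close>; so \<open>m\<close> is nonzero and can be
  normalized to \<open>\<nu>\<close>. The first-order expansion of \<open>g\<close> at
  \<open>z\<close> turns the sign of the defining function into the two cone conditions. The factor
  \<open>c\<close> is recorded so that \<open>\<nu> \<bullet> F = 0\<close> can be read as
  \<open>F \<bullet> e = g' F\<close>.\<close>

lemma graph_outward_normal:
  fixes \<Omega> :: "(real^'n::finite) set"
  assumes chart: "\<Omega> \<inter> ball x0 r = {y \<in> ball x0 r. y \<bullet> e < g y}" and e: "norm e = 1"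
    and inv: "\<And>y t. g (y + t *\<^sub>R e) = g y"
    and z: "z \<in> ball x0 r" "z \<bullet> e = g z" and dg: "(g has_derivative g') (at z)"
  shows "\<exists>\<nu> c. outward_normal \<Omega> z \<nu> \<and> (\<forall>h. h \<bullet> e - g' h = c * (\<nu> \<bullet> h))"
proof -
  have mem: "y \<in> \<Omega> \<longleftrightarrow> y \<bullet> e < g y" if "y \<in> ball x0 r" for y
    using chart that by blast
  have lin: "linear g'" by (rule has_derivative_linear[OF dg])
  have "g' e = 0"
    using LIMSEQ_unique[OF has_derivative_sequence[OF dg, of 1 e], of 0] by (simp add: inv)
  define a where "a = (\<Sum>b\<in>Basis. g' b *\<^sub>R b)"
  have a: "g' h = h \<bullet> a" for h
  proof -
    have "g' h = g' (\<Sum>b\<in>Basis. (h \<bullet> b) *\<^sub>R b)" by (simp add: euclidean_representation)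
    also have "\<dots> = (\<Sum>b\<in>Basis. (h \<bullet> b) * g' b)" by (simp add: linear_sum[OF lin] linear_scale[OF lin])
    also have "\<dots> = h \<bullet> a" by (simp add: a_def inner_sum_right mult.commute)
    finally show ?thesis .
  qed
  define m where "m = e - a"
  have hm: "h \<bullet> m = h \<bullet> e - g' h" for h by (simp add: m_def a inner_diff_right)
  have "e \<bullet> m = 1" using \<open>g' e = 0\<close> e by (simp add: hm norm_eq_1)
  then have m0: "m \<noteq> 0" by auto
  define c where "c = norm m"
  have c: "c > 0" using m0 by (simp add: c_def)
  define \<nu> where "\<nu> = (1 / c) *\<^sub>R m"
  have \<nu>m: "h \<bullet> m = c * (h \<bullet> \<nu>)" for h using c by (simp add: \<nu>_def)
  obtain \<delta> where \<delta>: "\<delta> > 0" "ball z \<delta> \<subseteq> ball x0 r"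
    by (rule openE[OF open_ball z(1)])
  have "z \<in> frontier \<Omega>"
  proof -
    have "z \<notin> \<Omega>" using mem z by simp
    moreover have "z \<in> closure \<Omega>"
      unfolding closure_approachable
    proof (intro allI impI)
      fix \<epsilon> :: real assume \<epsilon>: "\<epsilon> > 0"
      define s where "s = min \<epsilon> \<delta> / 2"
      have s: "s > 0" "s < \<epsilon>" "s < \<delta>" using \<epsilon> \<delta>(1) by (auto simp: s_def)
      \<comment> \<open>Moving down along \<open>e\<close> leaves \<open>g\<close> unchanged, so the
        equality at \<open>z\<close> becomes the strict inequality that describes
        \<open>\<Omega>\<close>.\<close>
      define y where "y = z + (- s) *\<^sub>R e"
      have d: "dist y z = s" using s e by (simp add: y_def dist_norm)
      then have "y \<in> ball z \<delta>" using s by (simp add: dist_commute)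
      then have "y \<in> ball x0 r" using \<delta>(2) by blast
      moreover have "y \<bullet> e < g y"
        using s z(2) e unfolding y_def inv by (simp add: inner_diff_left norm_eq_1)
      ultimately have "y \<in> \<Omega>" using mem by simp
      then show "\<exists>y\<in>\<Omega>. dist y z < \<epsilon>" using d s by auto
    qed
    ultimately show ?thesis unfolding frontier_def using interior_subset by blast
  qed
  moreover have "norm \<nu> = 1" using c by (simp add: \<nu>_def c_def)
  moreover have "\<exists>\<rho>>0. \<forall>y\<in>ball z \<rho>. ((y - z) \<bullet> \<nu> < - \<epsilon> * norm (y - z) \<longrightarrow> y \<in> \<Omega>) \<and>
        ((y - z) \<bullet> \<nu> > \<epsilon> * norm (y - z) \<longrightarrow> y \<notin> \<Omega>)" if \<epsilon>: "\<epsilon> > 0" for \<epsilon>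
  proof -
    \<comment> \<open>The tolerance carries \<open>c\<close> because
      \<open>y \<bullet> e - g y\<close> is \<open>c\<close> times the normal component of
      \<open>y - z\<close>, up to the error of \<open>g\<close>.\<close>
    obtain d where d: "d > 0" "\<And>y. norm (y - z) < d \<Longrightarrow> \<bar>g y - g z - g' (y - z)\<bar> \<le> \<epsilon> * c * norm (y - z)"
      using dg[unfolded has_derivative_at_alt] \<epsilon> c mult_pos_pos by (metis real_norm_def)
    show ?thesis
    proof (intro exI[of _ "min d \<delta>"] conjI ballI)
      fix y assume y: "y \<in> ball z (min d \<delta>)"
      then have "y \<in> ball z \<delta>" by simp
      then have yb: "y \<in> ball x0 r" using \<delta>(2) by blast
      have b: "\<bar>g y - g z - g' (y - z)\<bar> \<le> \<epsilon> * c * norm (y - z)"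
        using d(2)[of y] y by (simp add: dist_norm norm_minus_commute)
      have eq: "y \<bullet> e - g y = c * ((y - z) \<bullet> \<nu>) - (g y - g z - g' (y - z))"
        using z(2) \<nu>m[of "y - z"] hm[of "y - z"] by (simp add: inner_diff_left)
      show "(y - z) \<bullet> \<nu> < - \<epsilon> * norm (y - z) \<longrightarrow> y \<in> \<Omega>"
      proof
        assume "(y - z) \<bullet> \<nu> < - \<epsilon> * norm (y - z)"
        then have "c * ((y - z) \<bullet> \<nu>) < c * (- \<epsilon> * norm (y - z))" using c by (rule mult_strict_left_mono)
        then have "y \<bullet> e < g y" using b eq by (simp add: algebra_simps)
        then show "y \<in> \<Omega>" using mem[OF yb] by simp
      qed
      show "(y - z) \<bullet> \<nu> > \<epsilon> * norm (y - z) \<longrightarrow> y \<notin> \<Omega>"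
      proof
        assume "(y - z) \<bullet> \<nu> > \<epsilon> * norm (y - z)"
        then have "c * ((y - z) \<bullet> \<nu>) > c * (\<epsilon> * norm (y - z))" using c by (rule mult_strict_left_mono)
        then have "\<not> y \<bullet> e < g y" using b eq by (simp add: algebra_simps)
        then show "y \<notin> \<Omega>" using mem[OF yb] by simp
      qed
    qed (use d \<delta> in auto)
  qed
  ultimately have "outward_normal \<Omega> z \<nu>" unfolding outward_normal_def by blast
  moreover have "\<forall>h. h \<bullet> e - g' h = c * (\<nu> \<bullet> h)" using hm \<nu>m by (simp add: inner_commute)
  ultimately show ?thesis by blast
qed

lemma divg_eq_0_outside:
  assumes "open V" "x \<in> V" "\<And>y. y \<in> V \<Longrightarrow> F y = 0"
  shows "divg F x = 0"
proof -
  have "partial i (\<lambda>y. F y $ i) x = 0" for i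
    using partial_cong[OF assms(1,2), of "\<lambda>y. F y $ i" "\<lambda>y. 0" i] assms(3)
      has_partial_imp_partial[OF has_partial_const[of i 0 x]] by simp
  then show ?thesis by (simp add: divg_def)
qed

lemma divg_cong:
  assumes "open V" "x \<in> V" "\<And>y. y \<in> V \<Longrightarrow> F y = G y"
  shows "divg F x = divg G x"
  unfolding divg_def by (intro sum.cong refl partial_cong[OF assms(1,2)]) (simp add: assms(3))

text \<open>The indicator of \<open>\<Omega>\<close> is approximated by \<open>smooth_step (k (g x - x \<bullet> e))\<close>.  Its gradient is of size \<open>k\<close> on a strip
  of width \<open>1 / k\<close> along the boundary, and there \<open>F\<close> is tangential up to \<open>O(1 / k)\<close> wherever \<open>g\<close> is differentiable.
  So the boundary term is bounded by the measure of the strip, and no surface measure is needed.\<close>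
lemma local_graph_divergence:
  fixes F :: "real^'n::finite \<Rightarrow> real^'n" and \<Omega> :: "(real^'n) set"
  assumes F: "\<And>i. Ck (Suc 0) UNIV (\<lambda>x. F x $ i)" and supp: "\<And>x. dist x0 x > r' \<Longrightarrow> F x = 0"
    and r: "r' < r" and chart: "\<Omega> \<inter> ball x0 r = {y \<in> ball x0 r. y \<bullet> e < g y}" and e: "norm e = 1"
    and inv: "\<And>y t. g (y + t *\<^sub>R e) = g y" and lip: "L-lipschitz_on UNIV g"
    and tang: "\<And>x \<nu>. outward_normal \<Omega> x \<nu> \<Longrightarrow> \<nu> \<bullet> F x = 0"
  shows "(\<integral>x. indicator \<Omega> x * divg F x \<partial>lborel) = 0"
proof -
  define R where "R = norm x0 + r'"
  have suppR: "F x = 0" if "norm x > R" for x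
    using supp[of x] that norm_triangle_ineq2[of x x0] by (simp add: R_def dist_norm norm_minus_commute)
  have div0: "divg F x = 0" if "dist x0 x > r'" for x
    by (rule divg_eq_0_outside[of "- cball x0 r'"]) (use that supp in auto)
  have div0R: "divg F x = 0" if "norm x > R" for x
    using div0[of x] that norm_triangle_ineq2[of x x0] by (simp add: R_def dist_norm norm_minus_commute)
  have "\<forall>i. \<exists>C\<ge>0. C-lipschitz_on UNIV (\<lambda>x. F x $ i) \<and> (\<forall>x. \<bar>F x $ i\<bar> \<le> C) \<and>
      (\<forall>j x. \<bar>partial j (\<lambda>x. F x $ i) x\<bar> \<le> C) \<and> (\<forall>j x. norm x > R \<longrightarrow> partial j (\<lambda>x. F x $ i) x = 0)"
    by (intro allI Ck_1_compact_support_lipschitz[OF F]) (simp add: suppR)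
  then obtain Ci where Ci: "\<And>i. Ci i \<ge> 0" "\<And>i. (Ci i)-lipschitz_on UNIV (\<lambda>x. F x $ i)"
    "\<And>i j x. \<bar>partial j (\<lambda>x. F x $ i) x\<bar> \<le> Ci i" by metis
  define C where "C = (\<Sum>i\<in>UNIV. Ci i)"
  have C0: "C \<ge> 0" unfolding C_def by (intro sum_nonneg Ci)
  have CF: "norm (F x - F y) \<le> C * norm (x - y)" for x y
  proof -
    have "norm (F x - F y) \<le> (\<Sum>i\<in>UNIV. \<bar>(F x - F y) $ i\<bar>)" by (rule norm_le_l1_cart)
    also have "\<dots> \<le> (\<Sum>i\<in>UNIV. Ci i * norm (x - y))"
    proof (rule sum_mono)
      fix i
      show "\<bar>(F x - F y) $ i\<bar> \<le> Ci i * norm (x - y)"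
        using lipschitz_onD[OF Ci(2)[of i], of x y] by (simp add: dist_norm)
    qed
    finally show ?thesis by (simp add: C_def sum_distrib_right)
  qed
  have divC: "\<bar>divg F x\<bar> \<le> C" for x
    unfolding divg_def C_def by (rule order_trans[OF sum_abs]) (intro sum_mono Ci)
  have L0: "L \<ge> 0" by (rule lipschitz_on_nonneg[OF lip])
  have contg: "continuous_on UNIV g" by (rule lipschitz_on_continuous_on[OF lip])
  have contD: "continuous_on UNIV (divg F)"
    unfolding divg_def[abs_def] using F by (intro continuous_on_sum) (auto simp: Ck_Suc_iff)
  have [measurable]: "divg F \<in> borel_measurable borel" by (intro borel_measurable_continuous_onI contD)
  define u where "u x = g x - x \<bullet> e" for x
  have contu: "continuous_on UNIV u" unfolding u_def by (intro continuous_intros contg)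
  have [measurable]: "u \<in> borel_measurable borel" by (intro borel_measurable_continuous_onI contu)
  have lipu: "\<bar>u x - u y\<bar> \<le> (L + 1) * norm (x - y)" for x y
  proof -
    have "\<bar>g x - g y\<bar> \<le> L * norm (x - y)" using lipschitz_onD[OF lip, of x y] by (simp add: dist_norm)
    moreover have "\<bar>(x - y) \<bullet> e\<bar> \<le> norm (x - y)" using Cauchy_Schwarz_ineq2[of "x - y" e] e by simp
    ultimately show ?thesis by (simp add: u_def inner_diff_left algebra_simps abs_le_iff)
  qed
  define \<phi> where "\<phi> k x = smooth_step (real (Suc k) * u x)" for k x
  have cont\<phi>: "(4 * (real (Suc k) * (L + 1)))-lipschitz_on UNIV (\<phi> k)" for k
  proof (rule lipschitz_onI)
    fix x y
    have "\<bar>\<phi> k x - \<phi> k y\<bar> \<le> 4 * \<bar>real (Suc k) * u x - real (Suc k) * u y\<bar>"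
      unfolding \<phi>_def by (rule smooth_step_lipschitz)
    also have "\<bar>real (Suc k) * u x - real (Suc k) * u y\<bar> = real (Suc k) * \<bar>u x - u y\<bar>"
      by (simp add: right_diff_distrib[symmetric] abs_mult)
    also have "4 * (real (Suc k) * \<bar>u x - u y\<bar>) \<le> 4 * (real (Suc k) * ((L + 1) * norm (x - y)))"
      by (intro mult_left_mono lipu) auto
    finally show "dist (\<phi> k x) (\<phi> k y) \<le> 4 * (real (Suc k) * (L + 1)) * dist x y"
      by (simp add: dist_norm mult.assoc)
  qed (use L0 in simp)
  have [measurable]: "\<phi> k \<in> borel_measurable borel" for k
    by (intro borel_measurable_continuous_onI lipschitz_on_continuous_on[OF cont\<phi>])
  \<comment> \<open>The strip that carries the boundary term: outside it either the slope of the
    step or the field \<open>F\<close> is zero.\<close>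
  define S where "S k = {x \<in> cball x0 r'. 0 < u x \<and> real (Suc k) * u x < 1}" for k
  have Sb: "S k \<in> sets borel" for k
  proof -
    have "S k = cball x0 r' \<inter> ({x. 0 < u x} \<inter> {x. real (Suc k) * u x < 1})" by (auto simp: S_def)
    moreover have "open ({x. 0 < u x} \<inter> {x. real (Suc k) * u x < 1})"
      by (intro open_Int open_Collect_less continuous_intros contu)
    ultimately show ?thesis by auto
  qed
  have Sfin: "emeasure lborel (S k) < \<infinity>" for k
    by (rule emeasure_bounded_finite) (rule bounded_subset[OF bounded_cball[of x0 r']], auto simp: S_def)
  \<comment> \<open>Here 4 bounds the slope of the step, \<open>L + 1\<close> bounds the functional
    mapping \<open>h\<close> to \<open>g' h - h \<bullet> e\<close>, and \<open>C\<close> is a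
    Lipschitz constant of \<open>F\<close>. The steepness of the step cancels against the width of
    the strip.\<close>
  define K where "K = 4 * (L + 1) * C"
  have K0: "K \<ge> 0" using L0 C0 by (simp add: K_def)
  \<comment> \<open>From \<open>k0\<close> on the strip is thinner than \<open>r - r'\<close>, so
    the graph point above a point of the strip still lies in the chart ball.\<close>
  obtain k0 where k0: "inverse (real (Suc k0)) < r - r'" using reals_Archimedean r by (metis diff_gt_0_iff_gt)
  obtain N where N: "N \<in> null_sets lborel" "\<And>x. x \<notin> N \<Longrightarrow> g differentiable (at x)"
    using rademacher[OF lip] by blast
  have bound: "\<bar>\<integral>x. \<phi> k x * divg F x \<partial>lborel\<bar> \<le> K * measure lborel (S k)" if k: "k \<ge> k0" for k
  proof (rule lipschitz_divergence_bound[OF F suppR cont\<phi>, where B=1 and N=N])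
    fix x
    show "\<bar>\<phi> k x\<bar> \<le> 1" unfolding \<phi>_def using smooth_step_bounds by (simp add: abs_le_iff)
    assume "x \<notin> N"
    then obtain g' where g': "(g has_derivative g') (at x)" using N(2) by (auto simp: differentiable_def)
    define m where "m = real (Suc k)"
    have m: "m > 0" by (simp add: m_def)
    let ?\<phi>' = "\<lambda>h. smooth_step' (m * u x) * (m * (g' h - h \<bullet> e))"
    have "((\<lambda>x. m * u x) has_derivative (\<lambda>h. m * (g' h - h \<bullet> e))) (at x)"
      unfolding u_def by (intro derivative_intros g')
    moreover have "(smooth_step has_derivative (\<lambda>t. smooth_step' (m * u x) * t)) (at (m * u x))"
      using DERIV_smooth_step by (simp add: has_field_derivative_def)
    ultimately have "(\<phi> k has_derivative ?\<phi>') (at x)"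
      unfolding \<phi>_def[abs_def] m_def by (rule has_derivative_compose)
    moreover have "\<bar>?\<phi>' (F x)\<bar> \<le> K * indicator (S k) x"
    proof (cases "x \<in> S k")
      case False
      show ?thesis
      proof (cases "x \<in> cball x0 r'")
        case True
        then have "m * u x \<le> 0 \<or> 1 \<le> m * u x"
          using False m by (auto simp: S_def m_def not_less mult_le_0_iff)
        then show ?thesis using False by (simp add: smooth_step'_outside)
      next
        case F: False
        then have "F x = 0" using supp by simp
        then show ?thesis using False linear_0[OF has_derivative_linear[OF g']] by simp
      qed
    next
      case True
      then have ux: "0 < u x" "m * u x < 1" "x \<in> cball x0 r'" by (auto simp: S_def m_def)
      \<comment> \<open>The graph point reached from \<open>x\<close> along \<open>e\<close>. As
        \<open>g\<close> is constant along \<open>e\<close>, it is differentiable at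
        \<open>x'\<close> with the same derivative as at \<open>x\<close>; a null exceptional set in
        the full space is therefore enough, although the graph itself has measure zero.\<close>
      define x' where "x' = x + u x *\<^sub>R e"
      have dx: "norm (x - x') = u x" using ux(1) e by (simp add: x'_def)
      have "inverse (real (Suc k)) \<le> inverse (real (Suc k0))" using k by (simp add: field_simps)
      moreover have "u x < inverse m" using ux(2) m by (simp add: field_simps)
      ultimately have "u x < r - r'" using k0 unfolding m_def by linarith
      moreover have "dist x0 x' \<le> dist x0 x + u x" using dist_triangle[of x0 x' x] dx by (simp add: dist_norm)
      ultimately have x'b: "x' \<in> ball x0 r" using ux(3) by simp
      have gx': "g x' = g x" by (simp add: x'_def inv)
      have x'e: "x' \<bullet> e = g x'"
        unfolding gx' using e by (simp add: x'_def u_def inner_add_left norm_eq_1)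
      have "((\<lambda>y. g (y + (- u x) *\<^sub>R e)) has_derivative g') (at x')"
      proof -
        have "((\<lambda>y. y + (- u x) *\<^sub>R e) has_derivative (\<lambda>h. h)) (at x')"
          by (auto intro!: derivative_eq_intros)
        moreover have "(g has_derivative g') (at (x' + (- u x) *\<^sub>R e))" using g' by (simp add: x'_def)
        ultimately show ?thesis by (rule has_derivative_compose)
      qed
      then have g'x': "(g has_derivative g') (at x')" by (simp only: inv)
      obtain \<nu> c where \<nu>: "outward_normal \<Omega> x' \<nu>" "\<And>h. h \<bullet> e - g' h = c * (\<nu> \<bullet> h)"
        using graph_outward_normal[OF chart e inv x'b x'e g'x'] by blast
      have F': "g' (F x') - F x' \<bullet> e = 0" using \<nu>(2)[of "F x'"] tang[OF \<nu>(1)] by simp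
      have lin: "linear g'" by (rule has_derivative_linear[OF g'])
      define w where "w = F x - F x'"
      have "g' (F x) - F x \<bullet> e = g' w - w \<bullet> e"
        using F' by (simp add: w_def linear_diff[OF lin] inner_diff_left)
      moreover have "\<bar>g' w\<bar> \<le> L * norm w" by (rule has_derivative_lipschitz_bound[OF lip g'])
      moreover have "\<bar>w \<bullet> e\<bar> \<le> norm w" using Cauchy_Schwarz_ineq2[of w e] e by simp
      ultimately have "\<bar>g' (F x) - F x \<bullet> e\<bar> \<le> (L + 1) * norm w" by (simp add: algebra_simps)
      also have "\<dots> \<le> (L + 1) * (C * u x)" using CF[of x x'] dx L0 by (intro mult_left_mono) (auto simp: w_def)
      finally have 1: "\<bar>g' (F x) - F x \<bullet> e\<bar> \<le> (L + 1) * (C * u x)" .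
      have "\<bar>?\<phi>' (F x)\<bar> = \<bar>smooth_step' (m * u x)\<bar> * (m * \<bar>g' (F x) - F x \<bullet> e\<bar>)"
        using m by (simp add: abs_mult)
      also have "\<dots> \<le> 4 * (m * ((L + 1) * (C * u x)))"
        using 1 m by (intro mult_mono mult_left_mono smooth_step'_bounds) auto
      also have "\<dots> = K * (m * u x)" by (simp add: K_def)
      also have "\<dots> \<le> K * 1" using ux(2) K0 by (intro mult_left_mono) auto
      finally show ?thesis using True by simp
    qed
    ultimately show "\<exists>\<phi>'. (\<phi> k has_derivative \<phi>') (at x) \<and> \<bar>\<phi>' (F x)\<bar> \<le> K * indicator (S k) x"
      by blast
  qed (use N Sb Sfin in auto)
  have "(\<lambda>k. measure lborel (S k)) \<longlonglongrightarrow> measure lborel (\<Inter>k. S k)"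
  proof (rule Lim_measure_decseq)
    show "range S \<subseteq> sets lborel" using Sb by auto
    show "decseq S"
    proof (rule decseq_SucI)
      fix k
      show "S (Suc k) \<le> S k"
      proof
        fix x assume x: "x \<in> S (Suc k)"
        then have "real (Suc k) * u x \<le> real (Suc (Suc k)) * u x"
          by (intro mult_right_mono) (auto simp: S_def)
        then show "x \<in> S k" using x unfolding S_def mem_Collect_eq by linarith
      qed
    qed
    show "emeasure lborel (S k) \<noteq> \<infinity>" for k using Sfin[of k] by auto
  qed
  moreover have "(\<Inter>k. S k) = {}"
  proof (rule ccontr)
    assume "(\<Inter>k. S k) \<noteq> {}"
    then obtain x where x: "\<And>k. x \<in> S k" by auto
    then have "u x > 0" by (auto simp: S_def)
    then obtain k where "inverse (real (Suc k)) < u x" using reals_Archimedean by blast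
    then have "1 < real (Suc k) * u x" by (simp add: field_simps)
    then show False using x[of k] unfolding S_def mem_Collect_eq by linarith
  qed
  ultimately have S0: "(\<lambda>k. measure lborel (S k)) \<longlonglongrightarrow> 0" by simp
  have lim: "(\<lambda>k. \<integral>x. \<phi> k x * divg F x \<partial>lborel) \<longlonglongrightarrow> (\<integral>x. indicator {x. 0 < u x} x * divg F x \<partial>lborel)"
  proof (rule integral_dominated_convergence[where w="\<lambda>x. C * indicator (cball (0::real^'n) R) x"])
    show "integrable lborel (\<lambda>x. C * indicator (cball (0::real^'n) R) x)" by (rule integrable_indicator_cball)
    show "AE x in lborel. (\<lambda>k. \<phi> k x * divg F x) \<longlonglongrightarrow> indicator {x. 0 < u x} x * divg F x"
    proof (rule AE_I2, rule tendsto_mult_right)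
      fix x
      show "(\<lambda>k. \<phi> k x) \<longlonglongrightarrow> indicator {x. 0 < u x} x"
      proof (cases "u x > 0")
        case True
        then obtain k1 where k1: "inverse (real (Suc k1)) < u x" using reals_Archimedean by blast
        have "\<phi> k x = 1" if "k \<ge> k1" for k
        proof -
          have "real (Suc k1) * u x \<le> real (Suc k) * u x" using that True by (intro mult_right_mono) auto
          moreover have "1 < real (Suc k1) * u x" using k1 by (simp add: field_simps)
          ultimately show ?thesis unfolding \<phi>_def by (intro smooth_step_ge_1) linarith
        qed
        then have "\<forall>\<^sub>F k in sequentially. \<phi> k x = 1" by (auto simp: eventually_sequentially)
        then show ?thesis using True by (simp add: tendsto_eventually)
      next
        case False
        then have "\<phi> k x = 0" for k unfolding \<phi>_def
          by (intro smooth_step_le_0) (auto simp: mult_le_0_iff)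
        then show ?thesis using False by simp
      qed
    qed
    fix k
    show "AE x in lborel. norm (\<phi> k x * divg F x) \<le> C * indicator (cball (0::real^'n) R) x"
    proof (rule AE_I2)
      fix x
      show "norm (\<phi> k x * divg F x) \<le> C * indicator (cball (0::real^'n) R) x"
      proof (cases "norm x \<le> R")
        case True
        have "\<bar>\<phi> k x\<bar> * \<bar>divg F x\<bar> \<le> 1 * C"
          by (intro mult_mono divC) (use smooth_step_bounds in \<open>auto simp: \<phi>_def abs_le_iff\<close>)
        then show ?thesis using True by (simp add: abs_mult)
      qed (simp add: div0R)
    qed
  qed measurable
  have eq: "indicator {x. 0 < u x} x * divg F x = indicator \<Omega> x * divg F x" for x
  proof (cases "dist x0 x > r'")
    case False
    then have "x \<in> ball x0 r" using r by simp
    then have "x \<in> \<Omega> \<longleftrightarrow> x \<bullet> e < g x" using chart by blast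
    then have "x \<in> \<Omega> \<longleftrightarrow> 0 < u x" by (simp add: u_def)
    then show ?thesis by (simp add: indicator_def)
  qed (simp add: div0)
  have "(\<lambda>k. \<bar>\<integral>x. \<phi> k x * divg F x \<partial>lborel\<bar>) \<longlonglongrightarrow> \<bar>\<integral>x. indicator \<Omega> x * divg F x \<partial>lborel\<bar>"
    using tendsto_rabs[OF lim] by (simp add: eq)
  moreover have "(\<lambda>k. K * measure lborel (S k)) \<longlonglongrightarrow> K * 0" by (intro tendsto_intros S0)
  ultimately have "\<bar>\<integral>x. indicator \<Omega> x * divg F x \<partial>lborel\<bar> \<le> K * 0"
    by (rule LIMSEQ_le) (use bound in blast)
  then show ?thesis by simp
qed

section \<open>The divergence theorem for tangential fields\<close>

definition tangential :: "(real^'n::finite) set \<Rightarrow> (real^'n \<Rightarrow> real^'n) \<Rightarrow> bool" where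
  "tangential \<Omega> F \<longleftrightarrow> (\<forall>x \<nu>. outward_normal \<Omega> x \<nu> \<longrightarrow> \<nu> \<bullet> F x = 0)"

lemma tangential_scaleR: "tangential \<Omega> F \<Longrightarrow> tangential \<Omega> (\<lambda>x. c x *\<^sub>R F x)"
  by (simp add: tangential_def)

text \<open>The radius depends on \<open>x0\<close> but not on the field, because the global
  argument applies the result to fields already multiplied by earlier cutoffs. It is small enough
  for the support to lie in \<open>V\<close> and inside either \<open>\<Omega>\<close> or one
  chart.\<close>

lemma divergence_localized:
  fixes \<Omega> :: "(real^'n::finite) set"
  assumes dom: "lipschitz_domain \<Omega>" and V: "open V" "closure \<Omega> \<subseteq> V" and x0: "x0 \<in> closure \<Omega>"
  shows "\<exists>\<rho>>0. \<forall>F. (\<forall>i. Ck (Suc 0) V (\<lambda>x. F x $ i)) \<longrightarrow> tangential \<Omega> F \<longrightarrow>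
    (\<integral>x. indicator \<Omega> x * divg (\<lambda>y. cutoff x0 \<rho> y *\<^sub>R F y) x \<partial>lborel) = 0"
proof -
  have open\<Omega>: "open \<Omega>" using dom by (simp add: lipschitz_domain_def)
  have \<Omega>V: "\<Omega> \<subseteq> V" using V(2) closure_subset by blast
  obtain rV where rV: "rV > 0" "cball x0 rV \<subseteq> V" using V x0 open_contains_cball by blast
  have "\<exists>r>0. ball x0 r \<subseteq> \<Omega> \<or> (\<exists>e g L. norm e = 1 \<and> L-lipschitz_on UNIV g \<and>
        (\<forall>y t. g (y + t *\<^sub>R e) = g y) \<and> \<Omega> \<inter> ball x0 r = {y \<in> ball x0 r. y \<bullet> e < g y})"
  proof (cases "x0 \<in> \<Omega>")
    case True
    then show ?thesis using open\<Omega> open_contains_ball by blast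
  next
    case False
    then have "x0 \<in> frontier \<Omega>" using x0 open\<Omega> by (simp add: frontier_def interior_open)
    then show ?thesis using dom unfolding lipschitz_domain_def by meson
  qed
  then obtain r where r: "r > 0" "ball x0 r \<subseteq> \<Omega> \<or> (\<exists>e g L. norm e = 1 \<and> L-lipschitz_on UNIV g \<and>
        (\<forall>y t. g (y + t *\<^sub>R e) = g y) \<and> \<Omega> \<inter> ball x0 r = {y \<in> ball x0 r. y \<bullet> e < g y})" by blast
  define \<rho> where "\<rho> = min rV (r / 2)"
  have \<rho>: "\<rho> > 0" "\<rho> < r" "cball x0 \<rho> \<subseteq> V" using rV r(1) by (auto simp: \<rho>_def)
  have "(\<integral>x. indicator \<Omega> x * divg (\<lambda>y. cutoff x0 \<rho> y *\<^sub>R F y) x \<partial>lborel) = 0"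
    if F: "\<forall>i. Ck (Suc 0) V (\<lambda>x. F x $ i)" and tang: "tangential \<Omega> F" for F
  proof -
    \<comment> \<open>Extension by zero: \<open>V\<close> and the complement of the closed ball
      cover the space, and \<open>G\<close> is continuously differentiable on each of these open
      sets.\<close>
    define G where "G y = (if y \<in> V then cutoff x0 \<rho> y *\<^sub>R F y else 0)" for y
    have G0: "G y = 0" if "dist x0 y > \<rho>" for y
      using cutoff_eq_0[OF \<rho>(1), of x0 y] that by (simp add: G_def)
    have GC: "Ck (Suc 0) UNIV (\<lambda>x. G x $ i)" for i
    proof -
      have "Ck (Suc 0) V (\<lambda>x. cutoff x0 \<rho> x * F x $ i)"
        by (rule Ck_mult[OF V(1) Ck_subset[OF cutoff_Ck_1]]) (use F in auto)
      then have 1: "Ck (Suc 0) V (\<lambda>x. G x $ i)"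
        by (subst Ck_cong[OF V(1), where g="\<lambda>x. cutoff x0 \<rho> x * F x $ i"]) (auto simp: G_def)
      have o: "open (- cball x0 \<rho>)" by (simp add: open_Compl)
      then have 2: "Ck (Suc 0) (- cball x0 \<rho>) (\<lambda>x. G x $ i)"
        by (subst Ck_cong[where g="\<lambda>x. 0"]) (auto simp: G0 intro: Ck_const)
      have "V \<union> - cball x0 \<rho> = UNIV" using \<rho>(3) by auto
      then show ?thesis using Ck_1_Un[OF V(1) o 1 2] by simp
    qed
    have tangG: "\<nu> \<bullet> G x = 0" if "outward_normal \<Omega> x \<nu>" for x \<nu>
      using tang that by (simp add: G_def tangential_def)
    have eq: "divg (\<lambda>y. cutoff x0 \<rho> y *\<^sub>R F y) x = divg G x" if "x \<in> \<Omega>" for x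
      by (rule divg_cong[OF V(1)]) (use that \<Omega>V in \<open>auto simp: G_def\<close>)
    have "(\<integral>x. indicator \<Omega> x * divg G x \<partial>lborel) = 0"
      using r(2)
    proof
      assume b: "ball x0 r \<subseteq> \<Omega>"
      have suppR: "G x = 0" if "norm x > norm x0 + \<rho>" for x
        using G0[of x] that norm_triangle_ineq2[of x x0] by (simp add: dist_norm norm_minus_commute)
      \<comment> \<open>In the interior case the test function is the constant 1; its derivative is
        zero, so the bound holds with \<open>K = 0\<close>.\<close>
      have "\<bar>\<integral>x. 1 * divg G x \<partial>lborel\<bar> \<le> 0 * measure lborel ({} :: (real^'n) set)"
      proof (rule lipschitz_divergence_bound[OF GC suppR, where L=0 and B=1 and N="{}"])
        show "0-lipschitz_on UNIV (\<lambda>x::real^'n. 1::real)" by (rule lipschitz_onI) auto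
        fix x :: "real^'n"
        show "\<exists>\<phi>'. ((\<lambda>x. 1::real) has_derivative \<phi>') (at x) \<and> \<bar>\<phi>' (G x)\<bar> \<le> 0 * indicator {} x"
          by (intro exI[of _ "\<lambda>h. 0"]) simp
      qed auto
      moreover have e: "1 * divg G x = indicator \<Omega> x * divg G x" for x
      proof (cases "x \<in> \<Omega>")
        case False
        then have "dist x0 x > \<rho>" using b \<rho>(2) by (meson linorder_not_le mem_ball order.strict_trans1 subsetD)
        then have "divg G x = 0"
          by (intro divg_eq_0_outside[of "- cball x0 \<rho>"]) (auto simp: G0 open_Compl)
        then show ?thesis by simp
      qed simp
      ultimately show ?thesis unfolding e by simp
    next
      assume "\<exists>e g L. norm e = 1 \<and> L-lipschitz_on UNIV g \<and>
        (\<forall>y t. g (y + t *\<^sub>R e) = g y) \<and> \<Omega> \<inter> ball x0 r = {y \<in> ball x0 r. y \<bullet> e < g y}"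
      then obtain e g L where c: "norm e = 1" "L-lipschitz_on UNIV g" "\<And>y t. g (y + t *\<^sub>R e) = g y"
        "\<Omega> \<inter> ball x0 r = {y \<in> ball x0 r. y \<bullet> e < g y}" by blast
      show ?thesis by (rule local_graph_divergence[OF GC G0 \<rho>(2) c(4,1,3,2) tangG])
    qed
    moreover have e: "indicator \<Omega> x * divg (\<lambda>y. cutoff x0 \<rho> y *\<^sub>R F y) x = indicator \<Omega> x * divg G x" for x
      using eq[of x] by (cases "x \<in> \<Omega>") auto
    ultimately show ?thesis unfolding e by simp
  qed
  then show ?thesis using \<rho>(1) by blast
qed

lemma integrable_indicator_continuous:
  fixes f :: "'a::euclidean_space \<Rightarrow> real"
  assumes "open \<Omega>" "bounded \<Omega>" "continuous_on (closure \<Omega>) f"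
  shows "integrable lborel (\<lambda>x. indicator \<Omega> x * f x)"
proof -
  have "integrable lborel (\<lambda>x. indicator (closure \<Omega>) x *\<^sub>R f x)"
    by (rule borel_integrable_compact) (use assms in auto)
  then have "integrable lborel (\<lambda>x. indicator \<Omega> x *\<^sub>R (indicator (closure \<Omega>) x *\<^sub>R f x))"
    by (rule integrable_mult_indicator[rotated]) (use assms in auto)
  moreover have "(\<lambda>x. indicator \<Omega> x *\<^sub>R (indicator (closure \<Omega>) x *\<^sub>R f x)) = (\<lambda>x. indicator \<Omega> x * f x)"
    using closure_subset[of \<Omega>] by (auto simp: indicator_def fun_eq_iff)
  ultimately show ?thesis by simp
qed

lemma integral_eq_lborel_indicator:
  fixes f :: "'a::euclidean_space \<Rightarrow> real"
  assumes "open \<Omega>" "bounded \<Omega>" "continuous_on (closure \<Omega>) f"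
  shows "f integrable_on \<Omega>" "integral \<Omega> f = (\<integral>x. indicator \<Omega> x * f x \<partial>lborel)"
proof -
  have "set_integrable lborel \<Omega> f"
    using integrable_indicator_continuous[OF assms] by (simp add: set_integrable_def)
  from set_borel_integral_eq_integral[OF this]
  show "f integrable_on \<Omega>" "integral \<Omega> f = (\<integral>x. indicator \<Omega> x * f x \<partial>lborel)"
    by (simp_all add: set_lebesgue_integral_def)
qed

lemma continuous_on_divg:
  "(\<And>i. Ck (Suc 0) V (\<lambda>x. F x $ i)) \<Longrightarrow> continuous_on V (divg F)"
  unfolding divg_def[abs_def] by (intro continuous_on_sum) (simp add: Ck_Suc_iff)

lemma divg_add:
  assumes "\<And>i. Ck (Suc 0) V (\<lambda>x. F x $ i)" "\<And>i. Ck (Suc 0) V (\<lambda>x. G x $ i)" "x \<in> V"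
  shows "divg (\<lambda>y. F y + G y) x = divg F x + divg G x"
  unfolding divg_def sum.distrib[symmetric]
proof (rule sum.cong[OF refl])
  fix i
  have "has_partial i (\<lambda>y. F y $ i + G y $ i) x (partial i (\<lambda>y. F y $ i) x + partial i (\<lambda>y. G y $ i) x)"
    using assms by (intro has_partial_add) (auto simp: Ck_Suc_iff)
  then show "partial i (\<lambda>y. (F y + G y) $ i) x = partial i (\<lambda>y. F y $ i) x + partial i (\<lambda>y. G y $ i) x"
    by (simp add: has_partial_imp_partial)
qed

text \<open>Partition of unity in product form: passing from \<open>F\<close> to \<open>(1 - c) F\<close> for a cutoff \<open>c\<close> does not change the
  integral, and finitely many such steps annihilate \<open>F\<close> on \<open>\<Omega>\<close>.\<close>
theorem divergence_tangential:
  fixes \<Omega> :: "(real^'n::finite) set"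
  assumes dom: "lipschitz_domain \<Omega>" and V: "open V" "closure \<Omega> \<subseteq> V"
    and F: "\<And>i. Ck (Suc 0) V (\<lambda>x. F x $ i)" and tang: "tangential \<Omega> F"
  shows "divg F integrable_on \<Omega>" "integral \<Omega> (divg F) = 0"
proof -
  have \<Omega>: "open \<Omega>" "bounded \<Omega>" using dom by (auto simp: lipschitz_domain_def)
  have \<Omega>V: "\<Omega> \<subseteq> V" using V(2) closure_subset by blast
  define adm where "adm F \<longleftrightarrow> (\<forall>i. Ck (Suc 0) V (\<lambda>x. F x $ i)) \<and> tangential \<Omega> F" for F
  define T where "T F = (\<integral>x. indicator \<Omega> x * divg F x \<partial>lborel)" for F
  have cont: "continuous_on (closure \<Omega>) (divg F)" if "adm F" for F
    using that continuous_on_divg[of V F] V(2) continuous_on_subset unfolding adm_def by blast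
  have T_add: "T (\<lambda>x. F x + G x) = T F + T G" if a: "adm F" "adm G" for F G
  proof -
    have "indicator \<Omega> x * divg (\<lambda>x. F x + G x) x = indicator \<Omega> x * divg F x + indicator \<Omega> x * divg G x" for x
      using divg_add[of V F G x] a \<Omega>V by (cases "x \<in> \<Omega>") (auto simp: adm_def)
    then show ?thesis unfolding T_def
      by (simp add: Bochner_Integration.integral_add integrable_indicator_continuous[OF \<Omega>] cont a)
  qed
  have adm_scale: "adm (\<lambda>x. c x *\<^sub>R F x)" if "Ck (Suc 0) UNIV c" "adm F" for c F
  proof -
    have "Ck (Suc 0) V (\<lambda>x. c x * F x $ i)" for i
      by (rule Ck_mult[OF V(1) Ck_subset[OF that(1)]]) (use that(2) in \<open>auto simp: adm_def\<close>)
    then show ?thesis using that(2) by (simp add: adm_def tangential_scaleR)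
  qed
  have "\<forall>x\<in>closure \<Omega>. \<exists>\<rho>>0. \<forall>F. adm F \<longrightarrow> T (\<lambda>y. cutoff x \<rho> y *\<^sub>R F y) = 0"
    using divergence_localized[OF dom V] unfolding adm_def T_def by blast
  then obtain \<rho> where \<rho>: "\<And>x. x \<in> closure \<Omega> \<Longrightarrow> \<rho> x > 0"
    "\<And>x F. x \<in> closure \<Omega> \<Longrightarrow> adm F \<Longrightarrow> T (\<lambda>y. cutoff x (\<rho> x) y *\<^sub>R F y) = 0" by metis
  have cp: "compact (closure \<Omega>)" using \<Omega>(2) by simp
  have cov: "closure \<Omega> \<subseteq> (\<Union>x\<in>closure \<Omega>. ball x (\<rho> x / 2))" using \<rho>(1) by fastforce
  obtain X where X: "X \<subseteq> closure \<Omega>" "finite X" "closure \<Omega> \<subseteq> (\<Union>x\<in>X. ball x (\<rho> x / 2))"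
    by (rule compactE_image[OF cp open_ball cov])
  have "\<exists>\<eta>. Ck (Suc 0) UNIV \<eta> \<and> (\<forall>x\<in>X. \<forall>y\<in>ball x (\<rho> x / 2). \<eta> y = 0) \<and>
      (\<forall>F. adm F \<longrightarrow> T F = T (\<lambda>y. \<eta> y *\<^sub>R F y))"
    using X(2,1)
  proof (induction X rule: finite_induct)
    case empty
    show ?case by (intro exI[of _ "\<lambda>x. 1"]) (simp add: Ck_const)
  next
    case (insert x X)
    then obtain \<eta> where \<eta>: "Ck (Suc 0) UNIV \<eta>" "\<And>x y. x \<in> X \<Longrightarrow> y \<in> ball x (\<rho> x / 2) \<Longrightarrow> \<eta> y = 0"
      "\<And>F. adm F \<Longrightarrow> T F = T (\<lambda>y. \<eta> y *\<^sub>R F y)" by auto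
    have x: "x \<in> closure \<Omega>" using insert.prems by simp
    let ?c = "cutoff x (\<rho> x)"
    have c: "Ck (Suc 0) UNIV (\<lambda>y. 1 - ?c y)" by (intro Ck_diff Ck_const cutoff_Ck_1) auto
    show ?case
    proof (intro exI[of _ "\<lambda>y. (1 - ?c y) * \<eta> y"] conjI ballI allI impI)
      show "Ck (Suc 0) UNIV (\<lambda>y. (1 - ?c y) * \<eta> y)" by (rule Ck_mult[OF open_UNIV c \<eta>(1)])
      fix z y assume "z \<in> insert x X" "y \<in> ball z (\<rho> z / 2)"
      then show "(1 - ?c y) * \<eta> y = 0"
        using \<eta>(2)[of z y] cutoff_eq_1[OF \<rho>(1)[OF x], of x y] by auto
    next
      fix F assume a: "adm F"
      have a1: "adm (\<lambda>y. \<eta> y *\<^sub>R F y)" by (rule adm_scale[OF \<eta>(1) a])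
      have "T F = T (\<lambda>y. \<eta> y *\<^sub>R F y)" by (rule \<eta>(3)[OF a])
      also have "\<dots> = T (\<lambda>y. ?c y *\<^sub>R (\<eta> y *\<^sub>R F y) + (1 - ?c y) *\<^sub>R (\<eta> y *\<^sub>R F y))"
        by (simp add: scaleR_add_left[symmetric] del: scaleR_scaleR)
      also have "\<dots> = T (\<lambda>y. ?c y *\<^sub>R (\<eta> y *\<^sub>R F y)) + T (\<lambda>y. (1 - ?c y) *\<^sub>R (\<eta> y *\<^sub>R F y))"
        by (rule T_add[OF adm_scale[OF cutoff_Ck_1 a1] adm_scale[OF c a1]])
      also have "T (\<lambda>y. ?c y *\<^sub>R (\<eta> y *\<^sub>R F y)) = 0" by (rule \<rho>(2)[OF x a1])
      finally show "T F = T (\<lambda>y. ((1 - ?c y) * \<eta> y) *\<^sub>R F y)" by simp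
    qed
  qed
  then obtain \<eta> where \<eta>: "\<And>x y. x \<in> X \<Longrightarrow> y \<in> ball x (\<rho> x / 2) \<Longrightarrow> \<eta> y = 0"
    "\<And>F. adm F \<Longrightarrow> T F = T (\<lambda>y. \<eta> y *\<^sub>R F y)" by blast
  have a: "adm F" using F tang by (simp add: adm_def)
  have "divg (\<lambda>y. \<eta> y *\<^sub>R F y) x = 0" if "x \<in> \<Omega>" for x
  proof (rule divg_eq_0_outside[OF \<Omega>(1) that])
    fix y assume "y \<in> \<Omega>"
    then have "\<eta> y = 0" using X(3) closure_subset \<eta>(1) by blast
    then show "\<eta> y *\<^sub>R F y = 0" by simp
  qed
  then have e: "indicator \<Omega> x * divg (\<lambda>y. \<eta> y *\<^sub>R F y) x = 0" for x by (cases "x \<in> \<Omega>") auto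
  have "T F = 0" using \<eta>(2)[OF a] unfolding T_def e by simp
  then show "divg F integrable_on \<Omega>" "integral \<Omega> (divg F) = 0"
    using integral_eq_lborel_indicator[OF \<Omega> cont[OF a]] unfolding T_def by simp_all
qed

section \<open>Calculus of smooth fields\<close>

text \<open>The mean value theorem is used along \<open>i\<close> for a difference in direction
  \<open>j\<close>, and then along \<open>j\<close> for \<open>partial i f\<close>. The second
  difference on the left is symmetric in \<open>i\<close> and \<open>j\<close>, which is what makes
  the mixed derivatives agree in the limit.\<close>

lemma mixed_difference:
  fixes f :: "real^'n::finite \<Rightarrow> real"
  assumes f: "Ck (Suc (Suc 0)) U f" and h: "h > 0"
    and U: "\<And>s t. 0 \<le> s \<Longrightarrow> s \<le> h \<Longrightarrow> 0 \<le> t \<Longrightarrow> t \<le> h \<Longrightarrow> x + s *\<^sub>R axis i 1 + t *\<^sub>R axis j 1 \<in> U"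
  shows "\<exists>\<sigma> \<tau>. 0 < \<sigma> \<and> \<sigma> < h \<and> 0 < \<tau> \<and> \<tau> < h \<and>
    f (x + h *\<^sub>R axis i 1 + h *\<^sub>R axis j 1) - f (x + h *\<^sub>R axis i 1) - f (x + h *\<^sub>R axis j 1) + f x
      = h * h * partial j (partial i f) (x + \<sigma> *\<^sub>R axis i 1 + \<tau> *\<^sub>R axis j 1)"
proof -
  have p1: "has_partial i f y (partial i f y)" "has_partial j (partial i f) y (partial j (partial i f) y)"
    if "y \<in> U" for y using f that by (auto simp: Ck_Suc_iff)
  have comm: "x + t *\<^sub>R axis j 1 + s *\<^sub>R axis i 1 = x + s *\<^sub>R axis i 1 + t *\<^sub>R axis j 1" for s t
    by simp
  let ?g = "\<lambda>s. f (x + h *\<^sub>R axis j 1 + s *\<^sub>R axis i 1) - f (x + s *\<^sub>R axis i 1)"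
  let ?g' = "\<lambda>s. partial i f (x + h *\<^sub>R axis j 1 + s *\<^sub>R axis i 1) - partial i f (x + s *\<^sub>R axis i 1)"
  have "\<exists>\<sigma>>0. \<sigma> < h \<and> ?g h - ?g 0 = (h - 0) * ?g' \<sigma>"
  proof (rule MVT2[OF h])
    fix s assume s: "0 \<le> s" "s \<le> h"
    have "x + h *\<^sub>R axis j 1 + s *\<^sub>R axis i 1 \<in> U" "x + s *\<^sub>R axis i 1 \<in> U"
      using U[of s h] U[of s 0] s h by (simp_all add: comm)
    then show "(?g has_real_derivative ?g' s) (at s)"
      by (intro DERIV_diff has_partial_line p1)
  qed
  then obtain \<sigma> where \<sigma>: "0 < \<sigma>" "\<sigma> < h" "?g h - ?g 0 = h * ?g' \<sigma>" by auto
  have "\<exists>\<tau>>0. \<tau> < h \<and> partial i f (x + \<sigma> *\<^sub>R axis i 1 + h *\<^sub>R axis j 1) - partial i f (x + \<sigma> *\<^sub>R axis i 1 + 0 *\<^sub>R axis j 1)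
      = (h - 0) * partial j (partial i f) (x + \<sigma> *\<^sub>R axis i 1 + \<tau> *\<^sub>R axis j 1)"
  proof (rule MVT2[OF h])
    fix t assume t: "0 \<le> t" "t \<le> h"
    have "x + \<sigma> *\<^sub>R axis i 1 + t *\<^sub>R axis j 1 \<in> U" using U[of \<sigma> t] \<sigma> t by simp
    then show "((\<lambda>t. partial i f (x + \<sigma> *\<^sub>R axis i 1 + t *\<^sub>R axis j 1)) has_real_derivative
        partial j (partial i f) (x + \<sigma> *\<^sub>R axis i 1 + t *\<^sub>R axis j 1)) (at t)"
      by (intro has_partial_line p1)
  qed
  then obtain \<tau> where \<tau>: "0 < \<tau>" "\<tau> < h"
    "?g' \<sigma> = h * partial j (partial i f) (x + \<sigma> *\<^sub>R axis i 1 + \<tau> *\<^sub>R axis j 1)"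
    by (auto simp: comm)
  show ?thesis
    using \<sigma> \<tau> by (intro exI[of _ \<sigma>] exI[of _ \<tau>]) (simp add: comm)
qed

lemma partial_commute:
  fixes f :: "real^'n::finite \<Rightarrow> real"
  assumes U: "open U" and f: "Ck (Suc (Suc 0)) U f" and x: "x \<in> U"
  shows "partial i (partial j f) x = partial j (partial i f) x"
proof (rule ccontr)
  define A where "A = partial j (partial i f)"
  define B where "B = partial i (partial j f)"
  assume "partial i (partial j f) x \<noteq> partial j (partial i f) x"
  then have e: "\<bar>A x - B x\<bar> / 2 > 0" by (simp add: A_def B_def)
  have cont: "continuous (at x) A" "continuous (at x) B"
    using f U x by (auto simp: A_def B_def Ck_Suc_iff continuous_on_eq_continuous_at)
  obtain d1 where d1: "d1 > 0" "\<And>y. dist y x < d1 \<Longrightarrow> dist (A y) (A x) < \<bar>A x - B x\<bar> / 2"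
    using cont(1) e unfolding continuous_at_eps_delta by metis
  obtain d2 where d2: "d2 > 0" "\<And>y. dist y x < d2 \<Longrightarrow> dist (B y) (B x) < \<bar>A x - B x\<bar> / 2"
    using cont(2) e unfolding continuous_at_eps_delta by metis
  obtain d3 where d3: "d3 > 0" "ball x d3 \<subseteq> U" using U x open_contains_ball by blast
  \<comment> \<open>A third leaves room for two steps of length \<open>h\<close> within all three
    radii.\<close>
  define h where "h = min d1 (min d2 d3) / 3"
  have h: "h > 0" "2 * h < d1" "2 * h < d2" "2 * h < d3" using d1 d2 d3 by (auto simp: h_def)
  have near: "dist (x + s *\<^sub>R axis k 1 + t *\<^sub>R axis l 1) x \<le> 2 * h"
    if "0 \<le> s" "s \<le> h" "0 \<le> t" "t \<le> h" for s t and k l :: 'n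
    using that norm_triangle_ineq[of "s *\<^sub>R axis k (1::real)" "t *\<^sub>R axis l 1"] by (simp add: dist_norm add.assoc)
  have inU: "x + s *\<^sub>R axis k 1 + t *\<^sub>R axis l 1 \<in> U"
    if "0 \<le> s" "s \<le> h" "0 \<le> t" "t \<le> h" for s t and k l :: 'n
    using near[OF that, of k l] h(4) d3(2) by (auto simp: dist_commute)
  obtain \<sigma> \<tau> where 1: "0 < \<sigma>" "\<sigma> < h" "0 < \<tau>" "\<tau> < h"
    "f (x + h *\<^sub>R axis i 1 + h *\<^sub>R axis j 1) - f (x + h *\<^sub>R axis i 1) - f (x + h *\<^sub>R axis j 1) + f x
      = h * h * A (x + \<sigma> *\<^sub>R axis i 1 + \<tau> *\<^sub>R axis j 1)"
    using mixed_difference[OF f h(1) inU, of i j] unfolding A_def by blast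
  obtain \<sigma>' \<tau>' where 2: "0 < \<sigma>'" "\<sigma>' < h" "0 < \<tau>'" "\<tau>' < h"
    "f (x + h *\<^sub>R axis j 1 + h *\<^sub>R axis i 1) - f (x + h *\<^sub>R axis j 1) - f (x + h *\<^sub>R axis i 1) + f x
      = h * h * B (x + \<sigma>' *\<^sub>R axis j 1 + \<tau>' *\<^sub>R axis i 1)"
    using mixed_difference[OF f h(1) inU, of j i] unfolding B_def by blast
  have c: "x + h *\<^sub>R axis j 1 + h *\<^sub>R axis i 1 = x + h *\<^sub>R axis i 1 + h *\<^sub>R axis j 1" by simp
  have "h * h * A (x + \<sigma> *\<^sub>R axis i 1 + \<tau> *\<^sub>R axis j 1) = h * h * B (x + \<sigma>' *\<^sub>R axis j 1 + \<tau>' *\<^sub>R axis i 1)"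
    using 1(5) 2(5) unfolding c by linarith
  then have eq: "A (x + \<sigma> *\<^sub>R axis i 1 + \<tau> *\<^sub>R axis j 1) = B (x + \<sigma>' *\<^sub>R axis j 1 + \<tau>' *\<^sub>R axis i 1)"
    using h(1) by simp
  have "dist (A (x + \<sigma> *\<^sub>R axis i 1 + \<tau> *\<^sub>R axis j 1)) (A x) < \<bar>A x - B x\<bar> / 2"
    using d1(2) near[of \<sigma> \<tau> i j] 1 h by simp
  moreover have "dist (B (x + \<sigma>' *\<^sub>R axis j 1 + \<tau>' *\<^sub>R axis i 1)) (B x) < \<bar>A x - B x\<bar> / 2"
    using d2(2) near[of \<sigma>' \<tau>' j i] 2 h by simp
  ultimately show False
    using dist_triangle2[of "A x" "B x" "B (x + \<sigma>' *\<^sub>R axis j 1 + \<tau>' *\<^sub>R axis i 1)"]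
    unfolding eq dist_real_def by (simp add: abs_minus_commute)
qed

section \<open>Smooth scalar and vector fields and their divergences\<close>

lemma smooth_onD: "smooth_on U f \<Longrightarrow> Ck k U f"
  by (simp add: smooth_on_def)

lemma smooth_on_subset: "smooth_on U f \<Longrightarrow> V \<subseteq> U \<Longrightarrow> smooth_on V f"
  by (auto simp: smooth_on_def intro: Ck_subset)

lemma smooth_on_continuous: "smooth_on U f \<Longrightarrow> continuous_on U f"
  using smooth_onD[of U f 0] by simp

lemma smooth_on_has_partial: "smooth_on U f \<Longrightarrow> x \<in> U \<Longrightarrow> has_partial i f x (partial i f x)"
  using smooth_onD[of U f "Suc 0"] by (simp add: Ck_Suc_iff)

lemma smooth_on_partial: "smooth_on U f \<Longrightarrow> smooth_on U (partial i f)"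
  unfolding smooth_on_def using Ck_Suc_iff by blast

lemma smooth_on_const: "open U \<Longrightarrow> smooth_on U (\<lambda>x. c)"
  by (simp add: smooth_on_def Ck_const)

lemma smooth_on_add: "open U \<Longrightarrow> smooth_on U f \<Longrightarrow> smooth_on U g \<Longrightarrow> smooth_on U (\<lambda>x. f x + g x)"
  by (simp add: smooth_on_def Ck_add)

lemma smooth_on_diff: "open U \<Longrightarrow> smooth_on U f \<Longrightarrow> smooth_on U g \<Longrightarrow> smooth_on U (\<lambda>x. f x - g x)"
  by (simp add: smooth_on_def Ck_diff)

lemma smooth_on_minus: "open U \<Longrightarrow> smooth_on U f \<Longrightarrow> smooth_on U (\<lambda>x. - f x)"
  by (simp add: smooth_on_def Ck_minus)

lemma smooth_on_mult: "open U \<Longrightarrow> smooth_on U f \<Longrightarrow> smooth_on U g \<Longrightarrow> smooth_on U (\<lambda>x. f x * g x)"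
  by (simp add: smooth_on_def Ck_mult)

lemma smooth_on_power: "open U \<Longrightarrow> smooth_on U f \<Longrightarrow> smooth_on U (\<lambda>x. f x ^ n)"
  by (induction n) (auto intro: smooth_on_const smooth_on_mult)

lemma smooth_on_sum: "open U \<Longrightarrow> (\<And>a. a \<in> A \<Longrightarrow> smooth_on U (f a)) \<Longrightarrow> smooth_on U (\<lambda>x. \<Sum>a\<in>A. f a x)"
  by (simp add: smooth_on_def Ck_sum)

lemma smooth_on_inverse:
  "open U \<Longrightarrow> smooth_on U f \<Longrightarrow> (\<And>x. x \<in> U \<Longrightarrow> f x \<noteq> 0) \<Longrightarrow> smooth_on U (\<lambda>x. inverse (f x))"
  by (simp add: smooth_on_def Ck_inverse)

lemma smooth_on_divide_const: "open U \<Longrightarrow> smooth_on U f \<Longrightarrow> smooth_on U (\<lambda>x. f x / c)"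
  using smooth_on_mult[of U f "\<lambda>x. inverse c"] smooth_on_const[of U "inverse c"]
  by (simp add: divide_inverse)

lemma smooth_on_ln:
  "open U \<Longrightarrow> smooth_on U f \<Longrightarrow> (\<And>x. x \<in> U \<Longrightarrow> f x > 0) \<Longrightarrow> smooth_on U (\<lambda>x. ln (f x))"
  by (simp add: smooth_on_def Ck_ln)

lemmas smooth_intros = smooth_on_const smooth_on_add smooth_on_diff smooth_on_minus smooth_on_mult
  smooth_on_power smooth_on_sum smooth_on_divide_const smooth_on_partial

lemma grad_nth: "grad f x $ i = partial i f x"
  by (simp add: grad_def)

lemma divg_grad: "divg (grad f) x = lap f x"
  unfolding divg_def lap_def by (simp add: grad_nth)

lemma divg_scaleR:
  assumes "smooth_on U f" "smooth_vec_on U X" "x \<in> U"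
  shows "divg (\<lambda>y. f y *\<^sub>R X y) x = grad f x \<bullet> X x + f x * divg X x"
proof -
  have "partial i (\<lambda>y. (f y *\<^sub>R X y) $ i) x = partial i f x * X x $ i + f x * partial i (\<lambda>y. X y $ i) x" for i
  proof -
    have "has_partial i (\<lambda>y. f y * X y $ i) x (partial i f x * X x $ i + f x * partial i (\<lambda>y. X y $ i) x)"
      using assms by (intro has_partial_mult smooth_on_has_partial[where U=U]) (auto simp: smooth_vec_on_def)
    then show ?thesis by (simp add: has_partial_imp_partial)
  qed
  then show ?thesis
    unfolding divg_def by (simp add: sum.distrib sum_distrib_left inner_vec_def grad_nth)
qed

lemma smooth_vec_on_grad: "smooth_on U f \<Longrightarrow> smooth_vec_on U (grad f)"
  unfolding smooth_vec_on_def by (simp add: grad_nth smooth_on_partial)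

lemma smooth_vec_on_scaleR:
  "open U \<Longrightarrow> smooth_on U f \<Longrightarrow> smooth_vec_on U X \<Longrightarrow> smooth_vec_on U (\<lambda>x. f x *\<^sub>R X x)"
  unfolding smooth_vec_on_def by (simp add: smooth_on_mult)

lemma smooth_vec_on_add:
  "open U \<Longrightarrow> smooth_vec_on U X \<Longrightarrow> smooth_vec_on U Y \<Longrightarrow> smooth_vec_on U (\<lambda>x. X x + Y x)"
  unfolding smooth_vec_on_def by (simp add: smooth_on_add)

lemma smooth_vec_on_subset: "smooth_vec_on U X \<Longrightarrow> V \<subseteq> U \<Longrightarrow> smooth_vec_on V X"
  unfolding smooth_vec_on_def using smooth_on_subset by blast

lemma smooth_on_inner:
  "open U \<Longrightarrow> smooth_vec_on U X \<Longrightarrow> smooth_vec_on U Y \<Longrightarrow> smooth_on U (\<lambda>x. X x \<bullet> Y x)"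
  unfolding smooth_vec_on_def inner_vec_def by (auto intro!: smooth_on_sum smooth_on_mult)

lemma divg_add_smooth:
  "smooth_vec_on U F \<Longrightarrow> smooth_vec_on U G \<Longrightarrow> x \<in> U \<Longrightarrow> divg (\<lambda>y. F y + G y) x = divg F x + divg G x"
  by (rule divg_add[of U]) (auto simp: smooth_vec_on_def smooth_on_def)

lemma divg_cmult:
  assumes "open U" "smooth_vec_on U X" "x \<in> U"
  shows "divg (\<lambda>y. c *\<^sub>R X y) x = c * divg X x"
proof -
  have "grad (\<lambda>y. c) x = 0"
    by (simp add: grad_def vec_eq_iff has_partial_imp_partial[OF has_partial_const])
  then show ?thesis using divg_scaleR[OF smooth_on_const[OF assms(1)] assms(2,3), of c] by simp
qed

lemma has_partial_sum:
  "(\<And>a. a \<in> A \<Longrightarrow> has_partial i (f a) x (d a)) \<Longrightarrow> has_partial i (\<lambda>x. \<Sum>a\<in>A. f a x) x (\<Sum>a\<in>A. d a)"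
  by (induction A rule: infinite_finite_induct) (auto intro: has_partial_const has_partial_add)

text \<open>The Hessian term \<open>v \<cdot> (\<nabla>\<^sup>2 f) \<nabla>f\<close>, written so that it matches both the derivative of
  \<open>v \<cdot> \<nabla>f\<close> along \<open>\<nabla>f\<close> and, after exchanging partial derivatives, that of \<open>\<bar>\<nabla>f\<bar>\<^sup>2 / 2\<close> along \<open>v\<close>.\<close>
definition hess_form :: "(real^'n::finite \<Rightarrow> real) \<Rightarrow> real^'n \<Rightarrow> real^'n \<Rightarrow> real^'n \<Rightarrow> real" where
  "hess_form f x a b = (\<Sum>j\<in>UNIV. \<Sum>i\<in>UNIV. a $ j * (b $ i * partial j (partial i f) x))"

lemma hess_form_commute:
  assumes "open U" "smooth_on U f" "x \<in> U"
  shows "hess_form f x a b = hess_form f x b a"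
proof -
  have "partial j (partial i f) x = partial i (partial j f) x" for i j
    by (rule partial_commute[OF assms(1) smooth_onD[OF assms(2)] assms(3)])
  then show ?thesis unfolding hess_form_def by (subst sum.swap) (simp add: mult_ac)
qed

text \<open>The product rule; the order in \<open>outer (grad f x) a\<close> follows
  \<open>jac\<close>, whose second index is the direction of differentiation.\<close>

lemma grad_inner_grad:
  assumes U: "open U" and f: "smooth_on U f" and v: "smooth_vec_on U v" and x: "x \<in> U"
  shows "grad (\<lambda>y. v y \<bullet> grad f y) x \<bullet> a
    = ddot (outer (grad f x) a) (jac v x) + hess_form f x a (v x)"
proof -
  have "partial j (\<lambda>y. v y \<bullet> grad f y) x =
      (\<Sum>i\<in>UNIV. partial j (\<lambda>y. v y $ i) x * partial i f x + v x $ i * partial j (partial i f) x)" for j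
    unfolding inner_vec_def inner_real_def grad_nth
    using f v x by (intro has_partial_imp_partial has_partial_sum has_partial_mult smooth_on_has_partial[where U=U] smooth_on_partial)
      (auto simp: smooth_vec_on_def)
  then have "grad (\<lambda>y. v y \<bullet> grad f y) x \<bullet> a = (\<Sum>j\<in>UNIV. (\<Sum>i\<in>UNIV. partial j (\<lambda>y. v y $ i) x * partial i f x +
      v x $ i * partial j (partial i f) x) * a $ j)"
    by (simp add: inner_vec_def grad_nth)
  also have "\<dots> = (\<Sum>j\<in>UNIV. \<Sum>i\<in>UNIV. partial i f x * a $ j * partial j (\<lambda>y. v y $ i) x)
      + (\<Sum>j\<in>UNIV. \<Sum>i\<in>UNIV. a $ j * (v x $ i * partial j (partial i f) x))"
    unfolding sum.distrib[symmetric] sum_distrib_right by (intro sum.cong refl) (simp add: algebra_simps)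
  also have "(\<Sum>j\<in>UNIV. \<Sum>i\<in>UNIV. partial i f x * a $ j * partial j (\<lambda>y. v y $ i) x)
      = ddot (outer (grad f x) a) (jac v x)"
    unfolding ddot_def outer_def jac_def by (subst sum.swap) (simp add: grad_nth)
  finally show ?thesis by (simp add: hess_form_def)
qed

lemma has_partial_norm_grad_square:
  assumes f: "smooth_on U f" and x: "x \<in> U"
  shows "has_partial j (\<lambda>y. (norm (grad f y))\<^sup>2) x (2 * (\<Sum>i\<in>UNIV. partial i f x * partial j (partial i f) x))"
proof -
  have "has_partial j (\<lambda>y. \<Sum>i\<in>UNIV. partial i f y * partial i f y) x
     (\<Sum>i\<in>UNIV. partial j (partial i f) x * partial i f x + partial i f x * partial j (partial i f) x)"
    using f x by (intro has_partial_sum has_partial_mult smooth_on_has_partial[where U=U] smooth_on_partial)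
  then show ?thesis
    unfolding power2_norm_eq_inner inner_vec_def inner_real_def grad_nth
    by (simp add: sum.distrib sum_distrib_left[symmetric] mult.commute)
qed

section \<open>The entropy balance\<close>

text \<open>The scalar identities behind the entropy balance.  Variables starting with \<open>i\<close> stand for inverses, so that
  everything is polynomial.  In terms of the scheme, with \<open>\<psi>\<close> at the new level: \<open>ft\<close>, \<open>vf\<close>, \<open>vT\<close>, \<open>vd\<close> are \<open>\<psi>\<^sub>t\<close>, \<open>v \<bullet> \<nabla>\<psi>\<close>, \<open>v \<bullet> \<nabla>T\<close>,
  \<open>v \<bullet> \<nabla>\<delta>\<close>; \<open>D\<close> is the divergence of \<open>mob \<nabla>\<mu>\<^sub>c\<close>; \<open>N\<close> and \<open>Q\<close> contract \<open>\<nabla>\<psi> \<otimes> \<nabla>\<psi>\<close> with \<open>\<nabla>v\<close> and the Hessian of \<open>\<psi>\<close> with \<open>v\<close> and \<open>\<nabla>\<psi>\<close>;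
  \<open>Y\<close> is the divergence of \<open>(\<psi>\<^sub>t + v \<bullet> \<nabla>\<psi>) \<nabla>\<psi>\<close>.\<close>
lemma energy_reduction:
  fixes Ec :: real
  assumes phase: "ft + (vf + f * dv) = iPe * D" and divc: "dv = al * iPe * D"
    and E: "RC * Tt + RC * vT = - divq + src"
    and divq: "divq = - divH - Ec * iPe * (mob * u + mu * D) - Ec * iWe * lu * eps * Y"
    and mu: "mu = mz + al * p" and mz: "mz = Fp + iWe * lf * (dWf * ieps - eps * Lap)"
    and src: "src = - Ec * Up * ft - Ec * (Fp + T * G) * vf + Ec * (- p * dv - iWe * lf * eps * N - mz * f * dv)
        + Ec * tt - Ec * T * s * dv - Ec * iWe * lu * dbar - Ec * iWe * lu * vd + cor"
    and Fp: "Fp = Up * (1 - l)"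
    and Y: "Y = (a1 - a01) * idt + N + Q + (ft + vf) * Lap"
    and vd: "vd = dWf * ieps * vf + eps * Q"
    and dbar: "dbar = ieps * (W1 - W0) * idt + eps * (a1 - a0) * idt / 2"
    and cor: "cor = Ec * iWe * lf * (ieps * sq * idt / 8) - Ec * iWe * lf * (eps * (a1 - 2 * a01 + a0) * idt / 2) + cor2"
    and ft: "ft = df * idt" and lu: "lu = lf + ls * T"
  shows "RC * Tt = - RC * vT + divH + Ec * (iPe * mob * u) - Ec * (Up * l * ft) - Ec * T * (G * vf) + Ec * tt - Ec * T * (s * dv)
      + Ec * iWe * (ls * T * (eps * Y - vd) - ls * T * dbar + lf * (ieps * idt * (dWf * df + sq / 8 - W1 + W0))) + cor2"
proof -
  \<comment> \<open>\<open>mu\<close> splits into \<open>mz\<close> and \<open>al * p\<close>: the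
    phase equation evaluates the product of the first with \<open>D\<close>, the constraint that of
    the second.\<close>
  have 1: "iPe * (mu * D) = mz * (ft + (vf + f * dv)) + p * dv"
  proof -
    have "mz * (ft + (vf + f * dv)) + p * dv = mz * (iPe * D) + p * (al * iPe * D)"
      unfolding phase using divc by simp
    then show ?thesis unfolding mu by (simp add: algebra_simps)
  qed
  have "Ec * iPe * (mob * u + mu * D) = Ec * (iPe * mob * u) + Ec * (iPe * (mu * D))" by (simp add: algebra_simps)
  then have "divq = - divH - (Ec * (iPe * mob * u) + Ec * (mz * (ft + (vf + f * dv)) + p * dv)) - Ec * iWe * lu * eps * Y"
    unfolding divq 1 by simp
  then have 2: "RC * Tt = - RC * vT + divH + Ec * (iPe * mob * u) + Ec * (mz * (ft + (vf + f * dv)) + p * dv)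
      + Ec * iWe * lu * eps * Y + src"
    using E by linarith
  \<comment> \<open>The work terms \<open>p * dv\<close> and \<open>mz * f * dv\<close> cancel
    against the isotropic stress work contained in \<open>src\<close>.\<close>
  have 3: "RC * Tt = - RC * vT + divH + Ec * (iPe * mob * u) + Ec * (mz * (ft + vf)) - Ec * (Up * ft) - Ec * ((Fp + T * G) * vf)
      + Ec * tt - Ec * T * (s * dv) + Ec * iWe * (lu * eps * Y - lf * eps * N - lu * dbar - lu * vd) + cor"
    unfolding 2 src by (simp add: algebra_simps)
  have 4: "mz * (ft + vf) = Up * ft - Up * l * ft + Fp * vf + iWe * (lf * ((dWf * ieps - eps * Lap) * (ft + vf)))"
    unfolding mz Fp by (simp add: algebra_simps)
  \<comment> \<open>With \<open>lu = lf + ls * T\<close>, the \<open>lf\<close> terms in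
    \<open>Lap\<close>, \<open>N\<close> and \<open>Q\<close> cancel; so do the gradient squares,
    because \<open>a1 - a01\<close> is half of \<open>a1 - a0\<close> plus half of
    \<open>a1 - 2 * a01 + a0\<close>. Only the double-well remainder keeps the factor
    \<open>lf\<close>.\<close>
  have 5: "lf * ((dWf * ieps - eps * Lap) * (ft + vf)) + (lu * eps * Y - lf * eps * N - lu * dbar - lu * vd)
      + (lf * (ieps * sq * idt / 8) - lf * (eps * (a1 - 2 * a01 + a0) * idt / 2))
      = ls * T * (eps * Y - vd) - ls * T * dbar + lf * (ieps * idt * (dWf * df + sq / 8 - W1 + W0))"
    unfolding lu vd Y dbar ft by (simp add: field_simps)
  show ?thesis unfolding 3 4 cor using arg_cong[OF 5, of "\<lambda>z. Ec * iWe * z"] by (simp add: algebra_simps)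
qed

text \<open>The reduced equation is divided by \<open>Ec * T\<close>. Up to a common factor the
  conduction flux leaves \<open>(b01 + b0) / 2\<close> and the correction adds
  \<open>(b1 - b0) / 4\<close>; the sum \<open>(b1 + 2 * b01 + b0) / 4\<close> is a quarter of the
  squared norm of the summed temperature gradients. Exchanging \<open>dT\<close> for
  \<open>T * (l1 - l)\<close> produces the logarithmic part of the residual.\<close>

lemma entropy_balance_algebra:
  fixes Ec :: real
  assumes RC: "RC * Tt = - RC * vT + divH + Ec * (iPe * mob * u) - Ec * (Up * l * ft) - Ec * T * (G * vf) + Ec * tt - Ec * T * (s * dv)
      + Ec * iWe * (ls * T * (eps * Y - vd) - ls * T * dbar + lf * (ieps * idt * (dWf * df + sq / 8 - W1 + W0))) + cor2"
    and cor2: "cor2 = RC * T * (sT * iTm / 2) * idt + kp * (b1 - b0) * iPT * iT / 4"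
    and Up: "Up = iEc * A * T" and ft: "ft = df * idt" and Tt: "Tt = dT * idt"
    and RCd: "RC - RC0 = A * df"
    and Ec: "Ec * iEc = 1" and T: "T * iT = 1"
    and dPsi: "dPsi = - (kp * iPT / 2 * (b01 + b0)) * iEc * iT * iT + divH * iEc * iT + ls * eps * iWe * Y
        - (G * vf + RC * iEc * iT * vT + ls * iWe * vd + s * dv)"
  shows "(iEc * RC * l1 - iEc * RC0 * l) * idt + iWe * ls * dbar =
     kp * iEc * iPT * (b1 + 2 * b01 + b0) * iT * iT / 4 + tt * iT + mob * iPe * u * iT
     + (lf * iWe * ieps * iT * idt * (sq / 8 + dWf * df - W1 + W0)
        + RC * iEc * iT * idt * (T * sT * iTm / 2 - (dT - T * (l1 - l)))) + dPsi"
proof -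
  have "(RC * Tt) * (iEc * iT) = RC * iEc * iT * dT * idt" unfolding Tt by (simp add: algebra_simps)
  moreover have "(RC * Tt) * (iEc * iT) = - RC * iEc * iT * vT + divH * iEc * iT + (Ec * iEc) * (iPe * mob * u) * iT
      - (Ec * iEc) * ((T * iT) * (iEc * A * l * ft)) - (Ec * iEc) * (T * iT) * (G * vf) + (Ec * iEc) * tt * iT
      - (Ec * iEc) * (T * iT) * (s * dv)
      + (Ec * iEc) * iWe * (ls * (T * iT) * (eps * Y - vd) - ls * (T * iT) * dbar + lf * iT * (ieps * idt * (dWf * df + sq / 8 - W1 + W0)))
      + RC * (T * iT) * iEc * (sT * iTm / 2) * idt + kp * (b1 - b0) * iPT * iEc * iT * iT / 4"
    unfolding RC cor2 Up by (simp add: algebra_simps)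
  ultimately have 1: "RC * iEc * iT * dT * idt = - RC * iEc * iT * vT + divH * iEc * iT + (iPe * mob * u) * iT
      - (iEc * A * l * ft) - (G * vf) + tt * iT - (s * dv)
      + iWe * (ls * (eps * Y - vd) - ls * dbar + lf * iT * (ieps * idt * (dWf * df + sq / 8 - W1 + W0)))
      + RC * iEc * (sT * iTm / 2) * idt + kp * (b1 - b0) * iPT * iEc * iT * iT / 4"
    by (simp add: Ec T)
  \<comment> \<open>The discrete product rule \<open>RCd\<close> turns the phase term into the
    change of heat capacity, the part of the entropy increment not caused by the logarithm.\<close>
  have 2: "iEc * A * l * ft = iEc * l * (RC - RC0) * idt" unfolding RCd ft by simp
  have 3: "RC * iEc * iT * idt * (T * sT * iTm / 2 - (dT - T * (l1 - l)))
     = RC * iEc * (T * iT) * (sT * iTm / 2) * idt - RC * iEc * iT * dT * idt + RC * iEc * (T * iT) * idt * (l1 - l)"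
    by (simp add: algebra_simps)
  show ?thesis unfolding dPsi 3 T using 1 unfolding 2
    by (simp add: algebra_simps add_divide_distrib diff_divide_distrib)
qed

section \<open>Regularity and gradients of the constitutive functions\<close>

lemma smooth_on_rho: "open V \<Longrightarrow> smooth_on V psi \<Longrightarrow> smooth_on V (rho P psi)"
  unfolding rho_def[abs_def] lam_def by (intro smooth_intros)

lemma smooth_on_Ch: "open V \<Longrightarrow> smooth_on V psi \<Longrightarrow> smooth_on V (Ch P psi)"
  unfolding Ch_def[abs_def] lam_def by (intro smooth_intros)

lemma smooth_on_kap: "open V \<Longrightarrow> smooth_on V psi \<Longrightarrow> smooth_on V (kap P psi)"
  unfolding kap_def[abs_def] lam_def by (intro smooth_intros)

lemma smooth_on_delta: "open V \<Longrightarrow> smooth_on V psi \<Longrightarrow> smooth_on V (delta P psi)"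
  unfolding delta_def[abs_def] Wf_def power2_norm_eq_inner
  by (intro smooth_intros smooth_on_inner smooth_vec_on_grad)

lemma smooth_on_ln_ratio:
  assumes "open V" "smooth_on V T" "\<And>x. x \<in> V \<Longrightarrow> T x > 0" "c > 0"
  shows "smooth_on V (\<lambda>x. ln (T x / c))"
  by (intro smooth_on_ln smooth_intros) (use assms in auto)

lemma smooth_on_shat:
  assumes "open V" "smooth_on V psi" "smooth_on V T" "\<And>x. x \<in> V \<Longrightarrow> T x > 0" "pT0 P > 0"
  shows "smooth_on V (shat P psi T)"
  unfolding shat_def[abs_def]
  by (intro smooth_intros smooth_on_rho smooth_on_Ch smooth_on_delta smooth_on_ln_ratio assms)

lemma stil_eq_shat: "stil P psi T = shat P psi T"
  by (simp add: fun_eq_iff stil_def shat_def Stil_def)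

lemma smooth_on_muc:
  assumes "open V" "smooth_on V psi0" "smooth_on V psi1" "smooth_on V T" "smooth_on V p"
    "\<And>x. x \<in> V \<Longrightarrow> T x > 0" "pT0 P > 0"
  shows "smooth_on V (muc P psi0 psi1 T p)"
  unfolding muc_def[abs_def] mu0_def Fpsi_def wchem_def lam_f_def dW_def lap_def
  by (intro smooth_intros smooth_on_rho smooth_on_Ch smooth_on_ln_ratio assms)

lemma has_partial_cmult: "has_partial i f x d \<Longrightarrow> has_partial i (\<lambda>x. c * f x) x (c * d)"
  unfolding has_partial_def by (rule DERIV_cmult)

lemma has_partial_lam: "has_partial i f x d \<Longrightarrow> has_partial i (\<lambda>x. lam z (f x)) x ((1 - z) * d)"
  unfolding has_partial_def lam_def by (auto intro!: derivative_eq_intros simp: algebra_simps)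

lemma has_partial_delta:
  assumes psi: "smooth_on V psi" and x: "x \<in> V"
  shows "has_partial j (delta P psi) x (dW (psi x) / peps P * partial j psi x +
      peps P * (\<Sum>i\<in>UNIV. partial i psi x * partial j (partial i psi) x))"
proof -
  have "(Wf has_real_derivative dW s) (at s)" for s
    unfolding Wf_def[abs_def] dW_def
    by (auto intro!: derivative_eq_intros simp: power2_eq_square field_simps)
  then have 1: "has_partial j (\<lambda>y. Wf (psi y)) x (dW (psi x) * partial j psi x)"
    by (intro has_partial_chain smooth_on_has_partial[OF psi x])
  have "delta P psi = (\<lambda>y. inverse (peps P) * Wf (psi y) + peps P / 2 * (norm (grad psi y))\<^sup>2)"
    by (rule ext) (simp add: delta_def inverse_eq_divide)
  then have "has_partial j (delta P psi) x (inverse (peps P) * (dW (psi x) * partial j psi x) +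
      peps P / 2 * (2 * (\<Sum>i\<in>UNIV. partial i psi x * partial j (partial i psi) x)))"
    by (simp only:) (intro has_partial_add has_partial_cmult 1 has_partial_norm_grad_square[OF psi x])
  then show ?thesis by (simp add: inverse_eq_divide)
qed

lemma inner_grad_delta:
  assumes psi: "smooth_on V psi" and x: "x \<in> V"
  shows "v \<bullet> grad (delta P psi) x = dW (psi x) / peps P * (v \<bullet> grad psi x) + peps P * hess_form psi x v (grad psi x)"
proof -
  have "partial j (delta P psi) x = dW (psi x) / peps P * partial j psi x +
      peps P * (\<Sum>i\<in>UNIV. partial i psi x * partial j (partial i psi) x)" for j
    by (rule has_partial_imp_partial[OF has_partial_delta[OF psi x]])
  then show ?thesis
    by (simp add: inner_vec_def grad_nth hess_form_def distrib_left sum.distrib sum_distrib_left mult_ac)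
qed

text \<open>\<open>Gf\<close> takes both material factors at the new level because the product rule
  here is spatial; the mixed levels in \<open>Fpsi\<close> stem from a difference in time.
  \<open>Util\<close> exchanges one for the other in the convective term.\<close>

lemma inner_grad_stil:
  assumes psi: "smooth_on V psi1" and T: "smooth_on V Tn" and V: "open V" and x: "x \<in> V"
    and pos: "Tn x > 0" "pT0 P > 0"
  shows "v \<bullet> grad (stil P psi1 Tn) x = Gf P psi1 Tn x * (v \<bullet> grad psi1 x)
     + rho P psi1 x * Ch P psi1 x * inverse (pEc P) * inverse (Tn x) * (v \<bullet> grad Tn x)
     + lam_s P * inverse (pWe P) * (v \<bullet> grad (delta P psi1) x)"
proof -
  have "partial j (stil P psi1 Tn) x = Gf P psi1 Tn x * partial j psi1 x
     + rho P psi1 x * Ch P psi1 x * inverse (pEc P) * inverse (Tn x) * partial j Tn x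
     + lam_s P * inverse (pWe P) * partial j (delta P psi1) x" for j
  proof (rule has_partial_imp_partial)
    have 1: "has_partial j psi1 x (partial j psi1 x)" "has_partial j Tn x (partial j Tn x)"
      "has_partial j (delta P psi1) x (partial j (delta P psi1) x)"
      using assms by (auto intro: smooth_on_has_partial smooth_on_delta)
    have 2: "has_partial j (\<lambda>y. ln (Tn y / pT0 P)) x (inverse (Tn x) * partial j Tn x)"
    proof (rule has_partial_chain[OF 1(2)])
      show "((\<lambda>t. ln (t / pT0 P)) has_real_derivative inverse (Tn x)) (at (Tn x))"
        using pos by (auto intro!: derivative_eq_intros simp: field_simps)
    qed
    have "stil P psi1 Tn = (\<lambda>y. inverse (pEc P) * ((lam (zrho P) (psi1 y) * lam (zCh P) (psi1 y)) * ln (Tn y / pT0 P))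
        + (lam_s P * inverse (pWe P)) * delta P psi1 y)"
      by (simp add: fun_eq_iff stil_def Stil_def rho_def Ch_def divide_inverse)
    then have "has_partial j (stil P psi1 Tn) x
      (inverse (pEc P) * (((1 - zrho P) * partial j psi1 x * lam (zCh P) (psi1 x) + lam (zrho P) (psi1 x) * ((1 - zCh P) * partial j psi1 x))
         * ln (Tn x / pT0 P) + lam (zrho P) (psi1 x) * lam (zCh P) (psi1 x) * (inverse (Tn x) * partial j Tn x))
       + (lam_s P * inverse (pWe P)) * partial j (delta P psi1) x)"
      by (simp only:) (intro has_partial_add has_partial_cmult has_partial_mult has_partial_lam 1 2)
    moreover have "inverse (pEc P) * (((1 - zrho P) * partial j psi1 x * lam (zCh P) (psi1 x) + lam (zrho P) (psi1 x) * ((1 - zCh P) * partial j psi1 x))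
         * ln (Tn x / pT0 P) + lam (zrho P) (psi1 x) * lam (zCh P) (psi1 x) * (inverse (Tn x) * partial j Tn x))
       = Gf P psi1 Tn x * partial j psi1 x
     + rho P psi1 x * Ch P psi1 x * inverse (pEc P) * inverse (Tn x) * partial j Tn x"
      by (simp add: Gf_def rho_def Ch_def divide_inverse algebra_simps)
    ultimately show "has_partial j (stil P psi1 Tn) x (Gf P psi1 Tn x * partial j psi1 x
     + rho P psi1 x * Ch P psi1 x * inverse (pEc P) * inverse (Tn x) * partial j Tn x
     + lam_s P * inverse (pWe P) * partial j (delta P psi1) x)" by simp
  qed
  then show ?thesis
    by (simp add: inner_vec_def grad_nth distrib_left sum.distrib sum_distrib_left mult_ac)
qed

section \<open>Contractions of the stress with the velocity gradient\<close>

lemma ddot_diff_left: "ddot (A - B) C = ddot A C - ddot B C"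
  by (simp add: ddot_def sum_subtractf left_diff_distrib)

lemma ddot_minus_left: "ddot (- A) C = - ddot A C"
  by (simp add: ddot_def sum_negf)

lemma ddot_scaleR_left: "ddot (c *\<^sub>R A) C = c * ddot A C"
  by (simp add: ddot_def sum_distrib_left mult.assoc)

lemma ddot_mat_1_jac: "ddot (mat 1) (jac v x) = divg v x"
proof -
  have "(\<Sum>j\<in>UNIV. (mat 1 :: real^'a^'a) $ i $ j * jac v x $ i $ j) = partial i (\<lambda>y. v y $ i) x" for i
    by (simp add: mat_def jac_def if_distrib[of "\<lambda>z. z * _"] cong: if_cong)
  then show ?thesis by (simp add: ddot_def divg_def)
qed

lemma ddot_Mten:
  "ddot (Mten P psi0 psi1 Tn p x) (jac v x) = - p x * divg v x
    - inverse (pWe P) * lam_f P (Tn x) * peps P * ddot (outer (grad psi1 x) (grad psi1 x)) (jac v x)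
    - mu0 P psi0 psi1 Tn x * psi1 x * divg v x"
  by (simp add: Mten_def ddot_diff_left ddot_minus_left ddot_scaleR_left ddot_mat_1_jac divide_inverse)

lemma outer_mult_vec: "outer a b *v v = (b \<bullet> v) *\<^sub>R a"
  by (simp add: vec_eq_iff matrix_vector_mult_def outer_def inner_vec_def sum_distrib_left mult_ac)

text \<open>Total entropy flux: conduction, the capillary flux of the phase field and convection.  It involves
  neither \<open>\<mu>\<^sub>c\<close> nor the viscous stress.\<close>
definition entropy_flux :: "prm \<Rightarrow> (real^'n::finite \<Rightarrow> real^'n) \<Rightarrow> (real^'n \<Rightarrow> real) \<Rightarrow> (real^'n \<Rightarrow> real)
     \<Rightarrow> (real^'n \<Rightarrow> real) \<Rightarrow> (real^'n \<Rightarrow> real) \<Rightarrow> real^'n \<Rightarrow> real^'n" where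
  "entropy_flux P v0 psi0 psi1 Tn Tn1 y =
     (inverse (pEc P) * inverse (Tn y)) *\<^sub>R ((kap P psi1 y / (2 * pPeT P)) *\<^sub>R (grad Tn1 y + grad Tn y))
   + ((lam_s P * peps P * inverse (pWe P)) *\<^sub>R ((tbar P psi1 psi0 y + v0 y \<bullet> grad psi1 y) *\<^sub>R grad psi1 y)
   + (- stil P psi1 Tn y) *\<^sub>R v0 y)"

lemma smooth_vec_on_entropy_flux:
  assumes "open V" "smooth_vec_on V v0" "smooth_on V psi0" "smooth_on V psi1" "smooth_on V Tn" "smooth_on V Tn1"
    "\<And>x. x \<in> V \<Longrightarrow> Tn x > 0" "pT0 P > 0"
  shows "smooth_vec_on V (entropy_flux P v0 psi0 psi1 Tn Tn1)"
proof -
  have "Tn x \<noteq> 0" if "x \<in> V" for x using assms(7)[OF that] by simp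
  then show ?thesis
    unfolding entropy_flux_def[abs_def] tbar_def stil_eq_shat
    by (intro smooth_vec_on_add smooth_vec_on_scaleR smooth_vec_on_grad smooth_intros smooth_on_inverse
        smooth_on_kap smooth_on_inner smooth_on_shat assms)
qed

text \<open>The divergences of \<open>qE\<close> and of \<open>entropy_flux\<close> share the
  conductive part \<open>divg H x\<close> and the capillary part \<open>Y\<close>. Once both are
  expanded in these two, the claim is a scalar identity.\<close>

theorem entropy_balance_pointwise:
  fixes x :: "real^'n::finite"
  assumes pos: "params_pos P" and V: "open V" and \<Omega>: "open \<Omega>" "\<Omega> \<subseteq> V" "x \<in> \<Omega>"
    and v0: "smooth_vec_on V v0" and p: "smooth_on V p" and psi0: "smooth_on V psi0"
    and psi1: "smooth_on V psi1" and Tn: "smooth_on V Tn" and Tn1: "smooth_on V Tn1"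
    and Tpos: "\<And>y. y \<in> V \<Longrightarrow> Tn y > 0" "\<And>y. y \<in> V \<Longrightarrow> Tn1 y > 0"
    and range: "\<And>y. y \<in> \<Omega> \<Longrightarrow> 0 \<le> psi0 y \<and> psi0 y \<le> 1"
    and divc: "divg v0 x = alph P / pPepsi P * divg (\<lambda>y. mpsi psi0 y *\<^sub>R grad (muc P psi0 psi1 Tn p) y) x"
    and phase: "tbar P psi1 psi0 x + divg (\<lambda>y. psi1 y *\<^sub>R v0 y) x = 1 / pPepsi P *
        divg (\<lambda>y. mpsi psi0 y *\<^sub>R grad (muc P psi0 psi1 Tn p) y) x"
    and energy: "rho P psi1 x * Ch P psi1 x * tbar P Tn1 Tn x
        + rho P psi1 x * Ch P psi1 x * (v0 x \<bullet> grad Tn x)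
        = - divg (qE P v0 psi0 psi1 Tn Tn1 p) x + hs P v0 v1 psi0 psi1 Tn Tn1 p x"
  shows "(shat P psi1 Tn1 x - shat P psi0 Tn x) / pdt P =
    prod_density P v1 psi0 psi1 Tn Tn1 p x + divg (entropy_flux P v0 psi0 psi1 Tn Tn1) x"
proof -
  note pos' = pos[unfolded params_pos_def]
  have xV: "x \<in> V" using \<Omega> by blast
  have T0: "pT0 P > 0" using pos' by simp
  have Tx: "Tn x > 0" "Tn1 x > 0" using Tpos xV by auto
  have nz: "pEc P \<noteq> 0" "pWe P \<noteq> 0" "pPepsi P \<noteq> 0" "pPeT P \<noteq> 0" "peps P \<noteq> 0" "pdt P \<noteq> 0" "pRe P \<noteq> 0"
    "pTmin P \<noteq> 0" "Tn x \<noteq> 0" using pos' Tx by auto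
  define \<mu> where "\<mu> = muc P psi0 psi1 Tn p"
  have \<mu>: "smooth_on V \<mu>" unfolding \<mu>_def by (rule smooth_on_muc) (use assms T0 in auto)
  \<comment> \<open>The mobility without its absolute value is smooth on \<open>V\<close> and agrees
    with \<open>mpsi\<close> on the open set \<open>\<Omega>\<close>, so divergences there are
    unchanged.\<close>
  define m where "m y = psi0 y * (1 - psi0 y)" for y
  have m: "smooth_on V m" unfolding m_def by (intro smooth_intros V psi0)
  have mm: "mpsi psi0 y = m y" if "y \<in> \<Omega>" for y
    using range[OF that] by (simp add: mpsi_def m_def)
  define D where "D = divg (\<lambda>y. m y *\<^sub>R grad \<mu> y) x"
  have D: "divg (\<lambda>y. mpsi psi0 y *\<^sub>R grad (muc P psi0 psi1 Tn p) y) x = D"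
    unfolding D_def by (rule divg_cong[OF \<Omega>(1,3)]) (simp add: mm \<mu>_def)
  define Z where "Z y = tbar P psi1 psi0 y + v0 y \<bullet> grad psi1 y" for y
  have tb: "smooth_on V (tbar P psi1 psi0)"
    unfolding tbar_def[abs_def] by (intro smooth_intros V psi0 psi1)
  have vg: "smooth_on V (\<lambda>y. v0 y \<bullet> grad psi1 y)"
    by (intro smooth_on_inner V v0 smooth_vec_on_grad psi1)
  have Z: "smooth_on V Z" unfolding Z_def by (intro smooth_intros V tb vg)
  define H where "H y = (kap P psi1 y / (2 * pPeT P)) *\<^sub>R (grad Tn1 y + grad Tn y)" for y
  have H: "smooth_vec_on V H" unfolding H_def
    by (intro smooth_vec_on_scaleR smooth_vec_on_add smooth_vec_on_grad smooth_intros smooth_on_kap V psi1 Tn Tn1)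
  define Y where "Y = divg (\<lambda>y. Z y *\<^sub>R grad psi1 y) x"
  have ZG: "smooth_vec_on V (\<lambda>y. Z y *\<^sub>R grad psi1 y)"
    by (intro smooth_vec_on_scaleR smooth_vec_on_grad V Z psi1)
  have mG: "smooth_vec_on V (\<lambda>y. m y *\<^sub>R grad \<mu> y)"
    by (intro smooth_vec_on_scaleR smooth_vec_on_grad V m \<mu>)
  define Gp where "Gp = grad psi1 x"
  let ?RC = "rho P psi1 x * Ch P psi1 x" and ?ft = "tbar P psi1 psi0 x" and ?vf = "v0 x \<bullet> Gp" and
    ?vT = "v0 x \<bullet> grad Tn x" and ?vd = "v0 x \<bullet> grad (delta P psi1) x" and
    ?dbar = "tbar P (delta P psi1) (delta P psi0) x" and
    ?visc = "inverse (pRe P) * ddot (tau P psi0 v1 x) (jac v1 x)" and ?s = "stil P psi1 Tn x" and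
    ?dv = "divg v0 x" and ?ll = "ln (Tn1 x / pT0 P)" and ?l = "ln (Tn x / pT0 P)" and ?iE = "inverse (pEc P)" and
    ?iT = "inverse (Tn x)" and ?iW = "inverse (pWe P)" and ?idt = "inverse (pdt P)" and ?ieps = "inverse (peps P)" and
    ?iPe = "inverse (pPepsi P)" and ?iPT = "inverse (pPeT P)" and ?iTm = "inverse ((pTmin P)\<^sup>2)" and
    ?lf = "lam_f P (Tn x)" and ?G = "Gf P psi1 Tn x" and ?Up = "Upsi P psi0 psi1 Tn x" and
    ?Fp = "Fpsi P psi0 psi1 Tn x" and ?mz = "mu0 P psi0 psi1 Tn x" and ?w = "dW (psi1 x)" and
    ?q = "qE P v0 psi0 psi1 Tn Tn1 p" and ?flux = "entropy_flux P v0 psi0 psi1 Tn Tn1" and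
    ?bm = "grad Tn x \<bullet> grad Tn1 x" and ?bo = "grad Tn x \<bullet> grad Tn x" and
    ?bn = "grad Tn1 x \<bullet> grad Tn1 x" and ?am = "grad psi0 x \<bullet> Gp" and ?an = "Gp \<bullet> Gp" and
    ?df = "psi1 x - psi0 x" and ?dT = "Tn1 x - Tn x"
  define N where "N = ddot (outer Gp Gp) (jac v0 x)"
  define Q where "Q = hess_form psi1 x Gp (v0 x)"
  define u where "u = (norm (grad \<mu> x))\<^sup>2"
  have Yeq: "Y = (?an - ?am) * ?idt + N + Q
      + (?ft + ?vf) * lap psi1 x"
  proof -
    have "grad (tbar P psi1 psi0) x = ?idt *\<^sub>R (Gp - grad psi0 x)"
    proof -
      have "partial i (tbar P psi1 psi0) x = ?idt * (partial i psi1 x - partial i psi0 x)" for i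
      proof (rule has_partial_imp_partial)
        show "has_partial i (tbar P psi1 psi0) x (?idt * (partial i psi1 x - partial i psi0 x))"
          using smooth_on_has_partial[OF psi0 xV, of i] smooth_on_has_partial[OF psi1 xV, of i]
          unfolding has_partial_def tbar_def
          by (auto intro!: derivative_eq_intros simp: divide_inverse)
      qed
      then show ?thesis by (simp add: vec_eq_iff grad_nth Gp_def)
    qed
    moreover have "grad Z x = grad (tbar P psi1 psi0) x + grad (\<lambda>y. v0 y \<bullet> grad psi1 y) x"
      unfolding Z_def[abs_def] vec_eq_iff vector_add_component grad_nth
      by (intro allI has_partial_imp_partial has_partial_add smooth_on_has_partial[OF tb xV] smooth_on_has_partial[OF vg xV])
    ultimately have "grad Z x \<bullet> Gp = (?an - ?am) * ?idt + (N + Q)"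
      using grad_inner_grad[OF V psi1 v0 xV, of Gp]
      by (simp add: inner_add_left inner_diff_left N_def Q_def Gp_def mult.commute)
    then show ?thesis
      unfolding Y_def divg_scaleR[OF Z smooth_vec_on_grad[OF psi1] xV] divg_grad
      by (simp add: Z_def Gp_def)
  qed
  have qeq: "divg ?q x = - divg H x - pEc P * ?iPe * (m x * u + \<mu> x * D)
      - pEc P * ?iW * lam_u P * peps P * Y"
  proof -
    have "divg ?q x = divg (\<lambda>y. (-1) *\<^sub>R H y +
        ((- (pEc P * ?iPe)) *\<^sub>R (\<mu> y *\<^sub>R (m y *\<^sub>R grad \<mu> y)) +
         (- (pEc P * ?iW * lam_u P * peps P)) *\<^sub>R (Z y *\<^sub>R grad psi1 y))) x"
    proof (rule divg_cong[OF \<Omega>(1,3)])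
      fix y assume "y \<in> \<Omega>"
      have e3: "tbar P psi1 psi0 y *\<^sub>R grad psi1 y + (grad psi1 y \<bullet> v0 y) *\<^sub>R grad psi1 y = Z y *\<^sub>R grad psi1 y"
        by (simp add: Z_def scaleR_add_left inner_commute)
      have e2: "pEc P / pPepsi P * m y * \<mu> y = (pEc P * ?iPe) * (\<mu> y * m y)"
        "pEc P / pWe P * lam_u P * peps P = pEc P * ?iW * lam_u P * peps P"
        by (simp_all add: divide_inverse)
      show "?q y = (-1) *\<^sub>R H y +
        ((- (pEc P * ?iPe)) *\<^sub>R (\<mu> y *\<^sub>R (m y *\<^sub>R grad \<mu> y)) +
         (- (pEc P * ?iW * lam_u P * peps P)) *\<^sub>R (Z y *\<^sub>R grad psi1 y))"
        unfolding qE_def outer_mult_vec H_def mm[OF \<open>y \<in> \<Omega>\<close>] \<mu>_def[symmetric] e3 e2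
        by simp
    qed
    also have "\<dots> = - divg H x + (- (pEc P * ?iPe) * divg (\<lambda>y. \<mu> y *\<^sub>R (m y *\<^sub>R grad \<mu> y)) x
       + - (pEc P * ?iW * lam_u P * peps P) * Y)"
      unfolding Y_def
      by (simp only: divg_add_smooth[of V] divg_cmult[of V] smooth_vec_on_add smooth_vec_on_scaleR smooth_on_const
          V H \<mu> mG ZG xV mult_minus_left mult_1_left)
    also have "divg (\<lambda>y. \<mu> y *\<^sub>R (m y *\<^sub>R grad \<mu> y)) x = m x * u + \<mu> x * D"
      unfolding divg_scaleR[OF \<mu> mG xV] D_def u_def power2_norm_eq_inner by simp
    finally show ?thesis by simp
  qed
  have fluxeq: "divg ?flux x =
      - (kap P psi1 x * ?iPT / 2 * (?bm + ?bo)) * ?iE * ?iT * ?iT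
      + divg H x * ?iE * ?iT + lam_s P * peps P * ?iW * Y
      - (?G * (?vf) + ?RC * ?iE * ?iT * (?vT)
         + lam_s P * ?iW * (?vd) + ?s * ?dv)"
  proof -
    have iT: "smooth_on V (\<lambda>y. ?iE * inverse (Tn y))"
      by (intro smooth_intros smooth_on_inverse V Tn) (use Tpos in force)
    have st: "smooth_on V (\<lambda>y. - stil P psi1 Tn y)"
      unfolding stil_eq_shat by (intro smooth_intros V smooth_on_shat psi1 Tn Tpos T0)
    have "divg ?flux x =
       divg (\<lambda>y. (?iE * inverse (Tn y)) *\<^sub>R H y) x + (lam_s P * peps P * ?iW * Y
        + divg (\<lambda>y. (- stil P psi1 Tn y) *\<^sub>R v0 y) x)"
      unfolding entropy_flux_def[abs_def] Y_def H_def[symmetric] Z_def[symmetric]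
      by (simp only: divg_add_smooth[of V] divg_cmult[of V] smooth_vec_on_add smooth_vec_on_scaleR smooth_on_const
          V H ZG xV iT st v0)
    also have "divg (\<lambda>y. (- stil P psi1 Tn y) *\<^sub>R v0 y) x = - (v0 x \<bullet> grad (stil P psi1 Tn) x) - ?s * ?dv"
    proof -
      have "grad (\<lambda>y. - stil P psi1 Tn y) x = - grad (stil P psi1 Tn) x"
        unfolding vec_eq_iff vector_uminus_component grad_nth
      proof (intro allI has_partial_imp_partial)
        fix i
        have "has_partial i (stil P psi1 Tn) x (partial i (stil P psi1 Tn) x)"
          by (rule smooth_on_has_partial[OF _ xV]) (use smooth_on_minus[OF V st] in simp)
        then show "has_partial i (\<lambda>y. - stil P psi1 Tn y) x (- partial i (stil P psi1 Tn) x)"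
          unfolding has_partial_def by (rule DERIV_minus)
      qed
      then show ?thesis unfolding divg_scaleR[OF st v0 xV] by (simp add: inner_commute)
    qed
    also have "divg (\<lambda>y. (?iE * inverse (Tn y)) *\<^sub>R H y) x =
        - (?iE * (?iT * ?iT)) * (grad Tn x \<bullet> H x) + ?iE * ?iT * divg H x"
    proof -
      have "partial i (\<lambda>y. ?iE * inverse (Tn y)) x = - (?iE * (?iT * ?iT)) * partial i Tn x" for i
      proof (rule has_partial_imp_partial)
        show "has_partial i (\<lambda>y. ?iE * inverse (Tn y)) x (- (?iE * (?iT * ?iT)) * partial i Tn x)"
          using smooth_on_has_partial[OF Tn xV, of i] Tx(1) unfolding has_partial_def
          by (auto intro!: derivative_eq_intros)
      qed
      then have "grad (\<lambda>y. ?iE * inverse (Tn y)) x = (- (?iE * (?iT * ?iT))) *\<^sub>R grad Tn x"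
        by (simp add: vec_eq_iff grad_nth)
      then show ?thesis unfolding divg_scaleR[OF iT H xV] by simp
    qed
    also have "grad Tn x \<bullet> H x = kap P psi1 x * ?iPT / 2 * (?bm + ?bo)"
      unfolding H_def inner_add_right inner_scaleR_right by (simp add: inverse_eq_divide algebra_simps)
    finally show ?thesis
      unfolding inner_grad_stil[OF psi1 Tn V xV Tx(1) T0] Gp_def by (simp add: algebra_simps)
  qed
  have vd: "?vd = ?w * ?ieps * (?vf) + peps P * Q"
    unfolding inner_grad_delta[OF psi1 xV] Q_def Gp_def hess_form_commute[OF V psi1 xV, of "v0 x"]
    by (simp add: divide_inverse)
  define cor2 where "cor2 = ?RC * Tn x * (?dT\<^sup>2 * ?iTm / 2) * ?idt
     + kap P psi1 x * (?bn - ?bo) * ?iPT * ?iT / 4"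
  have RCT: "?RC * tbar P Tn1 Tn x = - ?RC * (?vT) + divg H x
      + pEc P * (?iPe * m x * u)
      - pEc P * (?Up * ?l * ?ft)
      - pEc P * Tn x * (?G * (?vf))
      + pEc P * ?visc - pEc P * Tn x * (?s * ?dv)
      + pEc P * ?iW * (lam_s P * Tn x * (peps P * Y - ?vd)
          - lam_s P * Tn x * ?dbar
          + ?lf * (?ieps * ?idt * (?w * ?df
              + ?df\<^sup>2 / 8 - Wf (psi1 x) + Wf (psi0 x)))) + cor2"
  proof (rule energy_reduction[OF _ _ _ qeq])
    show "?ft + (?vf + psi1 x * ?dv) = ?iPe * D"
      using phase unfolding D divg_scaleR[OF psi1 v0 xV] Gp_def by (simp add: divide_inverse inner_commute)
    show "?dv = alph P * ?iPe * D" using divc unfolding D by (simp add: divide_inverse)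
    show "?RC * tbar P Tn1 Tn x + ?RC * (?vT)
        = - divg ?q x + hs P v0 v1 psi0 psi1 Tn Tn1 p x" by (rule energy)
    show "\<mu> x = ?mz + alph P * p x" by (simp add: \<mu>_def muc_def)
    show "?mz = ?Fp + ?iW * ?lf *
        (?w * ?ieps - peps P * lap psi1 x)"
      by (simp add: mu0_def wchem_def divide_inverse)
    show "hs P v0 v1 psi0 psi1 Tn Tn1 p x = - pEc P * ?Up * ?ft
        - pEc P * (?Fp + Tn x * ?G) * (?vf)
        + pEc P * (- p x * ?dv - ?iW * ?lf * peps P * N - ?mz * psi1 x * ?dv)
        + pEc P * ?visc - pEc P * Tn x * ?s * ?dv
        - pEc P * ?iW * lam_u P * ?dbar
        - pEc P * ?iW * lam_u P * (?vd) + corr P psi0 psi1 Tn Tn1 x"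
      unfolding hs_def ddot_Mten Util_def N_def Gp_def by (simp add: divide_inverse)
    show "?Fp = ?Up * (1 - ?l)" by (simp add: Fpsi_def Upsi_def)
    show "Y = (?an - ?am) * ?idt + N + Q
      + (?ft + ?vf) * lap psi1 x" by (rule Yeq)
    show "?vd = ?w * ?ieps * (?vf) + peps P * Q" by (rule vd)
    show "?dbar = ?ieps * (Wf (psi1 x) - Wf (psi0 x)) * ?idt
        + peps P * (?an - grad psi0 x \<bullet> grad psi0 x) * ?idt / 2"
      unfolding tbar_def delta_def power2_norm_eq_inner Gp_def by (simp add: nz field_simps)
    show "corr P psi0 psi1 Tn Tn1 x = pEc P * ?iW * ?lf * (?ieps * ?df\<^sup>2 * ?idt / 8)
        - pEc P * ?iW * ?lf * (peps P * (?an - 2 * (?am) + grad psi0 x \<bullet> grad psi0 x) * ?idt / 2)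
        + cor2"
      unfolding corr_def cor2_def power2_norm_eq_inner Gp_def
      by (simp add: nz inner_diff_left inner_diff_right inner_commute field_simps)
    show "?ft = ?df * ?idt" by (simp add: tbar_def divide_inverse)
    show "lam_u P = ?lf + lam_s P * Tn x" by (simp add: lam_u_def lam_f_def lam_s_def algebra_simps)
  qed
  \<comment> \<open>The mixed time levels are those of the discrete product rule for
    \<open>rho * Ch\<close>, which is exact because both factors are affine in
    \<open>\<psi>\<close>; the same bracket occurs in \<open>Upsi\<close>.\<close>
  define A where "A = (1 - zrho P) * Ch P psi1 x + (1 - zCh P) * rho P psi0 x"
  have lnr: "ln (Tn1 x / Tn x) = ?ll - ?l"
    using Tx T0 by (simp add: ln_div)
  let ?prod = "kap P psi1 x * ?iE * ?iPT * (?bn + 2 * (?bm) + ?bo)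
        * ?iT * ?iT / 4
      + ?visc * ?iT + m x * ?iPe * u * ?iT
      + (?lf * ?iW * ?ieps * ?iT * ?idt *
           (?df\<^sup>2 / 8 + ?w * ?df - Wf (psi1 x) + Wf (psi0 x))
         + ?RC * ?iE * ?iT * ?idt *
           (Tn x * ?dT\<^sup>2 * ?iTm / 2 - (Tn1 x - Tn x - Tn x * (?ll - ?l))))"
  let ?rate = "(?iE * ?RC * ?ll
       - ?iE * (rho P psi0 x * Ch P psi0 x) * ?l) * ?idt
      + ?iW * lam_s P * ?dbar"
  have "?rate =
      ?prod
      + divg ?flux x"
  proof (rule entropy_balance_algebra[where A=A, OF RCT cor2_def])
    show "?Up = ?iE * A * Tn x" by (simp add: Upsi_def A_def divide_inverse)
    show "?ft = ?df * ?idt" by (simp add: tbar_def divide_inverse)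
    show "tbar P Tn1 Tn x = ?dT * ?idt" by (simp add: tbar_def divide_inverse)
    show "?RC - rho P psi0 x * Ch P psi0 x = A * ?df"
      by (simp add: A_def rho_def Ch_def lam_def algebra_simps)
    show "pEc P * ?iE = 1" "Tn x * ?iT = 1" using pos' Tx by auto
  qed (use fluxeq in simp)
  moreover have "(shat P psi1 Tn1 x - shat P psi0 Tn x) / pdt P =
      ?rate"
    by (simp add: shat_def tbar_def divide_inverse algebra_simps)
  moreover have "prod_density P v1 psi0 psi1 Tn Tn1 p x =
      ?prod"
  proof -
    have "(norm (grad Tn1 x + grad Tn x))\<^sup>2 = ?bn + 2 * (?bm) + ?bo"
      by (simp add: power2_norm_eq_inner inner_add_left inner_add_right inner_commute)
    then show ?thesis
      unfolding prod_density_def res_def lnr mm[OF \<Omega>(3)] u_def \<mu>_def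
      by (simp add: nz field_simps power2_eq_square[of "Tn x"])
  qed
  ultimately show ?thesis by simp
qed

section \<open>Mass conservation and entropy production\<close>

text \<open>Taylor expansion of the quartic \<open>Wf\<close> at \<open>b\<close>. With
  \<open>x = a - b\<close> and \<open>y = b - 1 / 2\<close> the second-order term is
  \<open>(3 * y\<^sup>2 - 1 / 4) * x\<^sup>2 / 2\<close>; adding \<open>x\<^sup>2 / 8\<close>
  removes its negative part, and the rest is a sum of squares.\<close>

lemma double_well_tangent:
  "1 / 8 * (b - a)\<^sup>2 + dW b * (b - a) - Wf b + Wf a
    = (a - b)\<^sup>2 * (((a - b) / 2 + (b - 1 / 2))\<^sup>2 + (b - 1 / 2)\<^sup>2 / 2)"
  unfolding dW_def Wf_def by (simp add: power2_eq_square field_simps)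

text \<open>After division by \<open>T\<close>, the difference \<open>f\<close> of the two sides
  vanishes at \<open>T\<close> and has derivative
  \<open>(s - T) * (1 / m\<^sup>2 - 1 / (T * s))\<close>. The second factor is nonnegative when
  \<open>T\<close> and \<open>s\<close> are at least \<open>m\<close>, so \<open>f\<close> is
  minimal at \<open>T\<close>.\<close>

lemma ln_quadratic_lower_bound:
  fixes T T1 m :: real
  assumes m: "m > 0" and T: "m \<le> T" "m \<le> T1"
  shows "T1 - T - T * ln (T1 / T) \<le> T * (T1 - T)\<^sup>2 / (2 * m\<^sup>2)"
proof -
  define f where "f s = (s - T)\<^sup>2 / (2 * m\<^sup>2) - ((s - T) / T - ln (s / T))" for s
  have Tpos: "T > 0" "T1 > 0" using m T by auto
  have df: "(f has_real_derivative (s - T) * (1 / m\<^sup>2 - 1 / (T * s))) (at s)" if "s > 0" for s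
    unfolding f_def using that Tpos m
    by (auto intro!: derivative_eq_intros simp: field_simps power2_eq_square)
  have sgn: "1 / m\<^sup>2 - 1 / (T * s) \<ge> 0" if "m \<le> s" for s
  proof -
    have "m\<^sup>2 \<le> T * s" unfolding power2_eq_square using that T m by (intro mult_mono) auto
    then show ?thesis using m by (simp add: frac_le)
  qed
  have "f T \<le> f T1"
  proof (cases "T \<le> T1")
    case True
    show ?thesis
    proof (rule DERIV_nonneg_imp_nondecreasing[OF True])
      fix s assume s: "T \<le> s" "s \<le> T1"
      then have "(s - T) * (1 / m\<^sup>2 - 1 / (T * s)) \<ge> 0" using sgn[of s] T by (intro mult_nonneg_nonneg) auto
      then show "\<exists>y. (f has_real_derivative y) (at s) \<and> 0 \<le> y" using df[of s] s Tpos by auto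
    qed
  next
    case False
    then have le: "T1 \<le> T" by simp
    show ?thesis
    proof (rule DERIV_nonpos_imp_nonincreasing[OF le])
      fix s assume s: "T1 \<le> s" "s \<le> T"
      then have "(s - T) * (1 / m\<^sup>2 - 1 / (T * s)) \<le> 0" using sgn[of s] T by (intro mult_nonpos_nonneg) auto
      then show "\<exists>y. (f has_real_derivative y) (at s) \<and> y \<le> 0" using df[of s] s Tpos by auto
    qed
  qed
  moreover have "f T = 0" using Tpos by (simp add: f_def)
  ultimately have "0 \<le> T * f T1" using Tpos by simp
  also have "T * f T1 = T * (T1 - T)\<^sup>2 / (2 * m\<^sup>2) - (T1 - T - T * ln (T1 / T))"
  proof -
    have e: "T * ((T1 - T) / T) = T1 - T" using Tpos by simp
    show ?thesis unfolding f_def right_diff_distrib e by simp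
  qed
  finally show ?thesis by simp
qed

lemma lam_nonneg: "z > 0 \<Longrightarrow> 0 \<le> s \<Longrightarrow> s \<le> 1 \<Longrightarrow> lam z s \<ge> 0"
  by (simp add: lam_def)

text \<open>The symmetric part contributes half the squared norm of \<open>J\<close> plus its
  transpose. Keeping only the diagonal leaves twice the sum of the squared diagonal entries, and
  Cauchy-Schwarz bounds the squared trace by at most three times that sum. The coefficient
  \<open>2 / 3\<close> in \<open>tau\<close> is just compatible with the factor three.\<close>

lemma viscous_dissipation_nonneg:
  fixes v :: "real^'n::finite \<Rightarrow> real^'n"
  assumes dim: "CARD('n) \<le> 3" and mu: "visc P psi0 x \<ge> 0"
  shows "ddot (tau P psi0 v x) (jac v x) \<ge> 0"
proof -
  define J where "J i j = jac v x $ i $ j" for i j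
  have d: "divg v x = (\<Sum>i\<in>UNIV. J i i)" by (simp add: divg_def J_def jac_def)
  define A where "A = (\<Sum>i\<in>UNIV. \<Sum>j\<in>UNIV. (J i j + J j i) * J i j)"
  have "A = (\<Sum>i\<in>UNIV. \<Sum>j\<in>UNIV. (J i j + J j i) * J j i)"
    unfolding A_def by (subst sum.swap) (simp add: add.commute)
  then have "2 * A = A + (\<Sum>i\<in>UNIV. \<Sum>j\<in>UNIV. (J i j + J j i) * J j i)" by simp
  also have "\<dots> = (\<Sum>i\<in>UNIV. \<Sum>j\<in>UNIV. (J i j + J j i)\<^sup>2)"
    unfolding A_def by (simp only: sum.distrib[symmetric] power2_eq_square distrib_left)
  finally have "2 * A = (\<Sum>i\<in>UNIV. \<Sum>j\<in>UNIV. (J i j + J j i)\<^sup>2)" .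
  moreover have "(\<Sum>i\<in>UNIV. (J i i + J i i)\<^sup>2) \<le> (\<Sum>i\<in>UNIV. \<Sum>j\<in>UNIV. (J i j + J j i)\<^sup>2)"
    by (intro sum_mono member_le_sum) auto
  moreover have "(\<Sum>i\<in>UNIV. (J i i + J i i)\<^sup>2) = 4 * (\<Sum>i\<in>UNIV. (J i i)\<^sup>2)"
    by (simp add: sum_distrib_left power2_eq_square)
  ultimately have A1: "A \<ge> 2 * (\<Sum>i\<in>UNIV. (J i i)\<^sup>2)" by linarith
  have "(divg v x)\<^sup>2 \<le> (\<Sum>i\<in>UNIV. (J i i)\<^sup>2) * real CARD('n)"
    unfolding d by (rule sum_squared_le_sum_of_squares)
  also have "\<dots> \<le> (\<Sum>i\<in>UNIV. (J i i)\<^sup>2) * 3" using dim by (intro mult_left_mono sum_nonneg) auto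
  finally have A2: "A - 2 / 3 * (divg v x)\<^sup>2 \<ge> 0" using A1 by linarith
  have "ddot (jac v x + transpose (jac v x)) (jac v x) = A"
    by (simp add: ddot_def A_def J_def transpose_def)
  then have "ddot (tau P psi0 v x) (jac v x) = visc P psi0 x * (A - 2 / 3 * (divg v x)\<^sup>2)"
    unfolding tau_def ddot_diff_left ddot_scaleR_left ddot_mat_1_jac
    by (simp only:) (simp add: power2_eq_square algebra_simps)
  then show ?thesis using mu A2 by simp
qed

lemma res_nonneg:
  assumes pos: "params_pos P" and T: "Tn x \<ge> pTmin P" "Tn1 x \<ge> pTmin P"
    and psi: "0 \<le> psi1 x" "psi1 x \<le> 1" and lf: "lam_f P (Tn x) \<ge> 0"
  shows "res P psi0 psi1 Tn Tn1 x \<ge> 0"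
proof -
  note pos' = pos[unfolded params_pos_def]
  have Tpos: "Tn x > 0" using pos' T by linarith
  have "1 / 8 * (psi1 x - psi0 x)\<^sup>2 + dW (psi1 x) * (psi1 x - psi0 x) - Wf (psi1 x) + Wf (psi0 x) \<ge> 0"
    unfolding double_well_tangent by simp
  moreover have "Tn x * (Tn1 x - Tn x)\<^sup>2 / (2 * (pTmin P)\<^sup>2) - (Tn1 x - Tn x - Tn x * ln (Tn1 x / Tn x)) \<ge> 0"
    using ln_quadratic_lower_bound[of "pTmin P" "Tn x" "Tn1 x"] pos' T by simp
  moreover have "rho P psi1 x \<ge> 0" "Ch P psi1 x \<ge> 0"
    using pos' psi by (auto simp: rho_def Ch_def lam_nonneg)
  ultimately show ?thesis
    unfolding res_def using pos' Tpos lf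
    by (intro add_nonneg_nonneg[OF mult_nonneg_nonneg mult_nonneg_nonneg] divide_nonneg_nonneg) auto
qed

lemma prod_density_nonneg:
  fixes x :: "real^'n::finite"
  assumes dim: "CARD('n) \<le> 3" and pos: "params_pos P" and T: "Tn x \<ge> pTmin P" "Tn1 x \<ge> pTmin P"
    and psi: "0 \<le> psi0 x" "psi0 x \<le> 1" "0 \<le> psi1 x" "psi1 x \<le> 1" and lf: "lam_f P (Tn x) \<ge> 0"
  shows "prod_density P v1 psi0 psi1 Tn Tn1 p x \<ge> 0"
proof -
  note pos' = pos[unfolded params_pos_def]
  have Tpos: "Tn x > 0" using pos' T by linarith
  have "visc P psi0 x \<ge> 0" "kap P psi1 x \<ge> 0" using pos' psi by (auto simp: visc_def kap_def lam_nonneg)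
  moreover from this have "ddot (tau P psi0 v1 x) (jac v1 x) \<ge> 0" by (intro viscous_dissipation_nonneg dim)
  moreover have "res P psi0 psi1 Tn Tn1 x \<ge> 0" by (rule res_nonneg[where x=x and P=P and Tn=Tn and ?Tn1.0=Tn1 and ?psi0.0=psi0 and ?psi1.0=psi1, OF pos T psi(3,4) lf])
  moreover have "mpsi psi0 x \<ge> 0" by (simp add: mpsi_def)
  ultimately show ?thesis
    unfolding prod_density_def using pos' Tpos
    by (intro add_nonneg_nonneg mult_nonneg_nonneg divide_nonneg_nonneg) auto
qed

theorem theorem3:
  fixes P :: prm and \<Omega> :: "(real^'n::finite) set" and j :: 'n
    and v0 v1 :: "real^'n \<Rightarrow> real^'n"
    and p psi0 psi1 Tn Tn1 :: "real^'n \<Rightarrow> real"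
  assumes dim: "CARD('n) = 2 \<or> CARD('n) = 3"
    and pos: "params_pos P"
    and dom: "lipschitz_domain \<Omega>"
    and smooth: "\<exists>U. open U \<and> closure \<Omega> \<subseteq> U \<and> smooth_vec_on U v0 \<and> smooth_vec_on U v1 \<and>
        smooth_on U p \<and> smooth_on U psi0 \<and> smooth_on U psi1 \<and> smooth_on U Tn \<and> smooth_on U Tn1"
    and mom: "\<forall>x\<in>\<Omega>. rho P psi0 x *\<^sub>R ((1 / pdt P) *\<^sub>R (v1 x - v0 x)) + rho P psi0 x *\<^sub>R (jac v1 x *v v0 x)
        = divT (Sigma P v1 psi0 psi1 Tn p) x - (rho P psi0 x / pFr P) *\<^sub>R axis j 1"
    and divc: "\<forall>x\<in>\<Omega>. divg v0 x = alph P / pPepsi P *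
        divg (\<lambda>y. mpsi psi0 y *\<^sub>R grad (muc P psi0 psi1 Tn p) y) x"
    and phase: "\<forall>x\<in>\<Omega>. tbar P psi1 psi0 x + divg (\<lambda>y. psi1 y *\<^sub>R v0 y) x = 1 / pPepsi P *
        divg (\<lambda>y. mpsi psi0 y *\<^sub>R grad (muc P psi0 psi1 Tn p) y) x"
    and energy: "\<forall>x\<in>\<Omega>. rho P psi1 x * Ch P psi1 x * tbar P Tn1 Tn x
        + rho P psi1 x * Ch P psi1 x * (v0 x \<bullet> grad Tn x)
        = - divg (qE P v0 psi0 psi1 Tn Tn1 p) x + hs P v0 v1 psi0 psi1 Tn Tn1 p x"
    and bc_v: "\<forall>x\<in>frontier \<Omega>. v0 x = 0"
    and bc_n: "\<forall>x \<nu>. outward_normal \<Omega> x \<nu> \<longrightarrow>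
        \<nu> \<bullet> grad (muc P psi0 psi1 Tn p) x = 0 \<and> \<nu> \<bullet> grad psi1 x = 0 \<and>
        \<nu> \<bullet> grad Tn x = 0 \<and> \<nu> \<bullet> grad Tn1 x = 0"
  shows "integral \<Omega> (rho P psi1) = integral \<Omega> (rho P psi0) \<and>
    ((\<forall>x\<in>\<Omega>. Tn x \<ge> pTmin P \<and> Tn1 x \<ge> pTmin P \<and> 0 \<le> psi0 x \<and> psi0 x \<le> 1 \<and>
               0 \<le> psi1 x \<and> psi1 x \<le> 1 \<and> lam_f P (Tn x) \<ge> 0) \<longrightarrow>
      (integral \<Omega> (shat P psi1 Tn1) - integral \<Omega> (shat P psi0 Tn)) / pdt P
          = integral \<Omega> (prod_density P v1 psi0 psi1 Tn Tn1 p) \<and>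
      integral \<Omega> (prod_density P v1 psi0 psi1 Tn Tn1 p) \<ge> 0 \<and>
      (\<forall>x\<in>\<Omega>. res P psi0 psi1 Tn Tn1 x \<ge> 0))"
proof -
  note pos' = pos[unfolded params_pos_def]
  have \<Omega>: "open \<Omega>" "bounded \<Omega>" using dom by (auto simp: lipschitz_domain_def)
  obtain U where U: "open U" "closure \<Omega> \<subseteq> U" and v0: "smooth_vec_on U v0" and p: "smooth_on U p"
    and psi0: "smooth_on U psi0" and psi1: "smooth_on U psi1" and Tn: "smooth_on U Tn" and Tn1: "smooth_on U Tn1"
    using smooth by blast
  have \<Omega>U: "\<Omega> \<subseteq> U" using U(2) closure_subset by blast
  have v0_tang: "\<nu> \<bullet> v0 x = 0" if "outward_normal \<Omega> x \<nu>" for x \<nu>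
    using that bc_v by (simp add: outward_normal_def)
  have mass: "integral \<Omega> (rho P psi1) = integral \<Omega> (rho P psi0)"
  proof (cases "zrho P = 1")
    case True
    \<comment> \<open>Here \<open>alph P\<close> is zero and cannot be divided by, but both
      densities are the constant 1.\<close>
    then have "rho P psi1 = rho P psi0" by (simp add: fun_eq_iff rho_def lam_def)
    then show ?thesis by simp
  next
    case False
    then have al: "alph P \<noteq> 0" using pos' by (simp add: alph_def)
    \<comment> \<open>Dividing the constraint by \<open>alph P\<close> and subtracting the phase
      equation eliminates the diffusive divergence. The remaining field is a multiple of
      \<open>v0\<close>, which vanishes on the boundary.\<close>
    define F where "F y = (1 / alph P) *\<^sub>R v0 y + (-1) *\<^sub>R (psi1 y *\<^sub>R v0 y)" for y
    have pv: "smooth_vec_on U (\<lambda>y. psi1 y *\<^sub>R v0 y)" by (rule smooth_vec_on_scaleR[OF U(1) psi1 v0])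
    have c1: "smooth_vec_on U (\<lambda>y. (1 / alph P) *\<^sub>R v0 y)" "smooth_vec_on U (\<lambda>y. (-1) *\<^sub>R (psi1 y *\<^sub>R v0 y))"
      by (intro smooth_vec_on_scaleR smooth_on_const U v0 pv)+
    have F: "smooth_vec_on U F" unfolding F_def[abs_def] by (rule smooth_vec_on_add[OF U(1) c1])
    have divF: "divg F x = tbar P psi1 psi0 x" if "x \<in> \<Omega>" for x
    proof -
      have xU: "x \<in> U" using that \<Omega>U by blast
      have "divg F x = 1 / alph P * divg v0 x + (-1) * divg (\<lambda>y. psi1 y *\<^sub>R v0 y) x"
        unfolding F_def[abs_def] divg_add_smooth[OF c1 xU] divg_cmult[OF U(1) v0 xU] divg_cmult[OF U(1) pv xU] ..
      moreover have "1 / alph P * divg v0 x = tbar P psi1 psi0 x + divg (\<lambda>y. psi1 y *\<^sub>R v0 y) x"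
        using divc[rule_format, OF that] phase[rule_format, OF that] al by simp
      ultimately show ?thesis by simp
    qed
    have tang: "tangential \<Omega> F" unfolding tangential_def F_def using v0_tang by (simp add: inner_diff_right)
    have CF: "\<And>i. Ck (Suc 0) U (\<lambda>x. F x $ i)" using F by (simp add: smooth_vec_on_def smooth_onD)
    note div = divergence_tangential[OF dom U CF tang]
    have int: "rho P psi1 integrable_on \<Omega>" "rho P psi0 integrable_on \<Omega>"
      using smooth_on_continuous[OF smooth_on_rho[OF U(1) psi1]] smooth_on_continuous[OF smooth_on_rho[OF U(1) psi0]]
        continuous_on_subset U(2) by (blast intro: integral_eq_lborel_indicator(1)[OF \<Omega>])+
    have "integral \<Omega> (rho P psi1) - integral \<Omega> (rho P psi0) = integral \<Omega> (\<lambda>x. rho P psi1 x - rho P psi0 x)"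
      by (rule Henstock_Kurzweil_Integration.integral_diff[OF int, symmetric])
    also have "\<dots> = integral \<Omega> (\<lambda>x. ((1 - zrho P) * pdt P) * divg F x)"
    proof (rule integral_cong)
      fix x assume "x \<in> \<Omega>"
      then have "pdt P * divg F x = psi1 x - psi0 x" using pos' by (simp add: divF tbar_def)
      then show "rho P psi1 x - rho P psi0 x = ((1 - zrho P) * pdt P) * divg F x"
        unfolding mult.assoc by (simp only:) (simp add: rho_def lam_def algebra_simps)
    qed
    also have "\<dots> = 0" by (simp add: div(2))
    finally show ?thesis by simp
  qed
  moreover have "(integral \<Omega> (shat P psi1 Tn1) - integral \<Omega> (shat P psi0 Tn)) / pdt P
          = integral \<Omega> (prod_density P v1 psi0 psi1 Tn Tn1 p) \<and>
      integral \<Omega> (prod_density P v1 psi0 psi1 Tn Tn1 p) \<ge> 0 \<and>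
      (\<forall>x\<in>\<Omega>. res P psi0 psi1 Tn Tn1 x \<ge> 0)"
    if H: "\<forall>x\<in>\<Omega>. Tn x \<ge> pTmin P \<and> Tn1 x \<ge> pTmin P \<and> 0 \<le> psi0 x \<and> psi0 x \<le> 1 \<and>
               0 \<le> psi1 x \<and> psi1 x \<le> 1 \<and> lam_f P (Tn x) \<ge> 0"
  proof -
    \<comment> \<open>Positivity of the temperatures on an open neighbourhood is needed for
      \<open>ln\<close> and \<open>1 / T\<close> to be smooth up to the boundary. The closure of
      \<open>\<Omega>\<close> lies in it because the lower bound \<open>pTmin P\<close> passes to
      the closure by continuity.\<close>
    define V where "V = (U \<inter> Tn -` {0<..}) \<inter> (U \<inter> Tn1 -` {0<..})"
    have V: "open V"
      unfolding V_def by (intro open_Int continuous_open_preimage smooth_on_continuous Tn Tn1 U) auto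
    have VU: "V \<subseteq> U" and Tpos: "\<And>y. y \<in> V \<Longrightarrow> Tn y > 0" "\<And>y. y \<in> V \<Longrightarrow> Tn1 y > 0" by (auto simp: V_def)
    have clV: "closure \<Omega> \<subseteq> V"
    proof
      fix x assume x: "x \<in> closure \<Omega>"
      have "continuous_on (closure \<Omega>) Tn" "continuous_on (closure \<Omega>) Tn1"
        using smooth_on_continuous[OF Tn] smooth_on_continuous[OF Tn1] U(2) continuous_on_subset by blast+
      then have "Tn x \<ge> pTmin P" "Tn1 x \<ge> pTmin P"
        using continuous_ge_on_closure[OF _ x] H by blast+
      then show "x \<in> V" using x U(2) pos' by (auto simp: V_def)
    qed
    have \<Omega>V: "\<Omega> \<subseteq> V" using clV closure_subset by blast
    have T0: "pT0 P > 0" using pos' by simp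
    note sm = smooth_vec_on_subset[OF v0 VU] smooth_on_subset[OF p VU] smooth_on_subset[OF psi0 VU]
      smooth_on_subset[OF psi1 VU] smooth_on_subset[OF Tn VU] smooth_on_subset[OF Tn1 VU]
    define \<Psi> where "\<Psi> = entropy_flux P v0 psi0 psi1 Tn Tn1"
    have "smooth_vec_on V \<Psi>"
      unfolding \<Psi>_def by (rule smooth_vec_on_entropy_flux[OF V sm(1,3,4,5,6) Tpos(1) T0])
    then have C\<Psi>: "\<And>i. Ck (Suc 0) V (\<lambda>x. \<Psi> x $ i)" by (simp add: smooth_vec_on_def smooth_onD)
    \<comment> \<open>Every summand is a scalar multiple of \<open>grad Tn + grad Tn1\<close>, of
      \<open>grad psi1\<close> or of \<open>v0\<close>.\<close>
    have tang: "tangential \<Omega> \<Psi>"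
      unfolding tangential_def \<Psi>_def entropy_flux_def using bc_n v0_tang
      by (simp add: inner_add_right inner_diff_right)
    note div = divergence_tangential[OF dom V clV C\<Psi> tang]
    have balance: "(shat P psi1 Tn1 x - shat P psi0 Tn x) / pdt P =
        prod_density P v1 psi0 psi1 Tn Tn1 p x + divg \<Psi> x" if x: "x \<in> \<Omega>" for x
      unfolding \<Psi>_def
      by (rule entropy_balance_pointwise[OF pos V \<Omega>(1) \<Omega>V x sm Tpos])
         (use H divc phase energy x in blast)+
    have int: "shat P psi1 Tn1 integrable_on \<Omega>" "shat P psi0 Tn integrable_on \<Omega>"
      using smooth_on_continuous[OF smooth_on_shat[OF V sm(4,6) Tpos(2) T0]]
        smooth_on_continuous[OF smooth_on_shat[OF V sm(3,5) Tpos(1) T0]]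
        continuous_on_subset clV by (blast intro: integral_eq_lborel_indicator(1)[OF \<Omega>])+
    let ?g = "\<lambda>x. (shat P psi1 Tn1 x - shat P psi0 Tn x) / pdt P"
    have intg: "?g integrable_on \<Omega>" by (intro integrable_on_divide integrable_diff int)
    have eq: "prod_density P v1 psi0 psi1 Tn Tn1 p x = ?g x - divg \<Psi> x" if "x \<in> \<Omega>" for x
      using balance[OF that] by simp
    \<comment> \<open>Integrability of the production is read off from the balance, as a difference
      of two integrable functions, instead of from its individual terms.\<close>
    have intp: "prod_density P v1 psi0 psi1 Tn Tn1 p integrable_on \<Omega>"
      by (subst integrable_cong[OF eq]) (auto intro: integrable_diff intg div(1))
    have "integral \<Omega> (prod_density P v1 psi0 psi1 Tn Tn1 p) = integral \<Omega> (\<lambda>x. ?g x - divg \<Psi> x)"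
      by (rule integral_cong) (rule eq)
    also have "\<dots> = integral \<Omega> ?g" using Henstock_Kurzweil_Integration.integral_diff[OF intg div(1)] div(2) by simp
    also have "\<dots> = (integral \<Omega> (shat P psi1 Tn1) - integral \<Omega> (shat P psi0 Tn)) / pdt P"
      by (simp add: Henstock_Kurzweil_Integration.integral_diff[OF int])
    finally have 1: "(integral \<Omega> (shat P psi1 Tn1) - integral \<Omega> (shat P psi0 Tn)) / pdt P
          = integral \<Omega> (prod_density P v1 psi0 psi1 Tn Tn1 p)" ..
    have card3: "CARD('n) \<le> 3" using dim by auto
    have "integral \<Omega> (prod_density P v1 psi0 psi1 Tn Tn1 p) \<ge> 0"
      by (rule Henstock_Kurzweil_Integration.integral_nonneg[OF intp]) (rule prod_density_nonneg[OF card3 pos]; use H in blast)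
    moreover have "\<forall>x\<in>\<Omega>. res P psi0 psi1 Tn Tn1 x \<ge> 0"
      by (rule ballI, rule res_nonneg[OF pos]; use H in blast)
    ultimately show ?thesis using 1 by blast
  qed
  ultimately show ?thesis by blast
qed

end
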